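(* Let $G=\mathbb{Z}_p\times\mathbb{Z}_q\times\mathbb{Z}_2\times\mathbb{Z}_2$ for distinct odd primes $p$ and $q$, let $S$ be a proper subset of $G\setminus\{0\}$ that generates $G$, and let $S_0=S\cup\{0\}$. Let $0\in C\subseteq G$. Put $\mathbf{e}_1=(1,0,0,0)$ and $\mathbf{e}_2=(0,1,0,0)$. Then $C$ is a perfect code in $\mathrm{Cay}(G,S)$ if and only if there exist two elements $\mathbf{e}_3,\mathbf{e}_4$ generating $\{0\}\times\{0\}\times\mathbb{Z}_2\times\mathbb{Z}_2$ and integer parameters such that $(S_0,C)$ is one of the following pairs: (1) $S_0=\{i\mathbf{e}_1+\alpha_i\mathbf{e}_2+\beta_i\mathbf{e}_3+\gamma_i\mathbf{e}_4\mid i\in[p]\}$, $C=\{i\mathbf{e}_2+j\mathbf{e}_3+k\mathbf{e}_4\mid i\in[q],j,k\in[2]\}$; (2) $S_0=\{\alpha_i\mathbf{e}_1+i\mathbf{e}_2+\beta_i\mathbf{e}_3+\gamma_i\mathbf{e}_4\mid i\in[q]\}$, $C=\{i\mathbf{e}_1+j\mathbf{e}_3+k\mathbf{e}_4\mid i\in[p],j,k\in[2]\}$; (3) $S_0=\{j\mathbf{e}_1+i\mathbf{e}_2+\alpha_i\mathbf{e}_3+\beta_i\mathbf{e}_4\mid i\in[q],j\in[p]\}$, $C=\{\lambda_{ij}\mathbf{e}_1+i\mathbf{e}_3+j\mathbf{e}_4\mid i,j\in[2]\}$; (4) $S_0=\{i\mathbf{e}_1+j\mathbf{e}_2+\alpha_i\mathbf{e}_3+\beta_i\mathbf{e}_4\mid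 i\in[p],j\in[q]\}$, $C=\{\lambda_{ij}\mathbf{e}_2+i\mathbf{e}_3+j\mathbf{e}_4\mid i,j\in[2]\}$; (5) $S_0=\{j\mathbf{e}_1+i\mathbf{e}_2+\alpha_{ij}\mathbf{e}_3+\alpha_i\mathbf{e}_4\mid i\in[q],j\in[p]\}$, $C=\{\lambda_i\mathbf{e}_1+j\mathbf{e}_3+i\mathbf{e}_4\mid i,j\in[2]\}$; (6) $S_0=\{i\mathbf{e}_1+j\mathbf{e}_2+\alpha_{ij}\mathbf{e}_3+\alpha_i\mathbf{e}_4\mid i\in[p],j\in[q]\}$, $C=\{\lambda_i\mathbf{e}_2+j\mathbf{e}_3+i\mathbf{e}_4\mid i,j\in[2]\}$; (7) $S_0=\{i\mathbf{e}_1+j\mathbf{e}_2+\alpha_{ij}\mathbf{e}_3+\beta_{ij}\mathbf{e}_4\mid i\in[p],j\in[q]\}$, $C=\{i\mathbf{e}_3+j\mathbf{e}_4\mid i,j\in[2]\}$; (8) $S_0=\{i\mathbf{e}_1+\alpha_i\mathbf{e}_2+j\mathbf{e}_3+\beta_i\mathbf{e}_4\mid i\in[p],j\in[2]\}$, $C=\{i\mathbf{e}_2+\lambda_{ij}\mathbf{e}_3+j\mathbf{e}_4\mid i\in[q],j\in[2]\}$; (9) $S_0=\{j\mathbf{e}_1+\alpha_i\mathbf{e}_2+\alpha_{ij}\mathbf{e}_3+i\mathbf{e}_4\mid i\in[2],j\in[p]\}$, $C=\{\lambda_i\mathbf{e}_1+i\mathbf{e}_2+j\mathbf{e}_3\mid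 i\in[q],j\in[2]\}$; (10) $S_0=\{i\mathbf{e}_1+\alpha_i\mathbf{e}_2+\alpha_{ij}\mathbf{e}_3+j\mathbf{e}_4\mid i\in[p],j\in[2]\}$, $C=\{i\mathbf{e}_2+j\mathbf{e}_3+\lambda_i\mathbf{e}_4\mid i\in[q],j\in[2]\}$; (11) $S_0=\{i\mathbf{e}_1+\alpha_{ij}\mathbf{e}_2+j\mathbf{e}_3+\alpha_i\mathbf{e}_4\mid i\in[p],j\in[2]\}$, $C=\{j\mathbf{e}_2+\lambda_i\mathbf{e}_3+i\mathbf{e}_4\mid i\in[2],j\in[q]\}$; (12) $S_0=\{i\mathbf{e}_1+\alpha_{ij}\mathbf{e}_2+\alpha_{ij}\mathbf{e}_3+j\mathbf{e}_4\mid i\in[p],j\in[2]\}$, $C=\{i\mathbf{e}_2+j\mathbf{e}_3\mid i\in[q],j\in[2]\}$; (13) $S_0=\{\alpha_i\mathbf{e}_1+i\mathbf{e}_2+j\mathbf{e}_3+\beta_i\mathbf{e}_4\mid i\in[q],j\in[2]\}$, $C=\{i\mathbf{e}_1+\lambda_{ij}\mathbf{e}_3+j\mathbf{e}_4\mid i\in[p],j\in[2]\}$; (14) $S_0=\{\alpha_i\mathbf{e}_1+j\mathbf{e}_2+\alpha_{ij}\mathbf{e}_3+i\mathbf{e}_4\mid i\in[2],j\in[q]\}$, $C=\{i\mathbf{e}_1+\lambda_i\mathbf{e}_2+j\mathbf{e}_3\mid i\in[p],j\in[2]\}$; (15) $S_0=\{\alpha_i\mathbf{e}_1+i\mathbf{e}_2+\alpha_{ij}\mathbf{e}_3+j\mathbf{e}_4\mid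 i\in[q],j\in[2]\}$, $C=\{i\mathbf{e}_1+j\mathbf{e}_3+\lambda_i\mathbf{e}_4\mid i\in[p],j\in[2]\}$; (16) $S_0=\{\alpha_{ij}\mathbf{e}_1+i\mathbf{e}_2+j\mathbf{e}_3+\alpha_i\mathbf{e}_4\mid i\in[q],j\in[2]\}$, $C=\{j\mathbf{e}_1+\lambda_i\mathbf{e}_3+i\mathbf{e}_4\mid i\in[2],j\in[p]\}$; (17) $S_0=\{\alpha_{ij}\mathbf{e}_1+i\mathbf{e}_2+\alpha_{ij}\mathbf{e}_3+j\mathbf{e}_4\mid i\in[q],j\in[2]\}$, $C=\{i\mathbf{e}_1+j\mathbf{e}_3\mid i\in[p],j\in[2]\}$; (18) $S_0=\{\alpha_i\mathbf{e}_1+\beta_i\mathbf{e}_2+j\mathbf{e}_3+i\mathbf{e}_4\mid i,j\in[2]\}$, $C=\{i\mathbf{e}_1+j\mathbf{e}_2+\lambda_{ij}\mathbf{e}_3\mid i\in[p],j\in[q]\}$; (19) $S_0=\{\alpha_{ij}\mathbf{e}_1+\alpha_i\mathbf{e}_2+j\mathbf{e}_3+i\mathbf{e}_4\mid i,j\in[2]\}$, $C=\{j\mathbf{e}_1+i\mathbf{e}_2+\lambda_i\mathbf{e}_3\mid i\in[q],j\in[p]\}$; (20) $S_0=\{\alpha_i\mathbf{e}_1+\alpha_{ij}\mathbf{e}_2+j\mathbf{e}_3+i\mathbf{e}_4\mid i,j\in[2]\}$, $C=\{i\mathbf{e}_1+j\mathbf{e}_2+\lambda_i\mathbf{e}_3\mid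 i\in[p],j\in[q]\}$; (21) $S_0=\{\alpha_{ij}\mathbf{e}_1+\alpha_{ij}\mathbf{e}_2+i\mathbf{e}_3+j\mathbf{e}_4\mid i,j\in[2]\}$, $C=\{i\mathbf{e}_1+j\mathbf{e}_2\mid i\in[p],j\in[q]\}$; (22) $S_0=\{i\mathbf{e}_1+j\mathbf{e}_2+k\mathbf{e}_3+\alpha_{ij}\mathbf{e}_4\mid i\in[p],j\in[q],k\in[2]\}$, $C=\{\lambda_i\mathbf{e}_3+i\mathbf{e}_4\mid i\in[2]\}$; (23) $S_0=\{k\mathbf{e}_1+i\mathbf{e}_2+\alpha_{ij}\mathbf{e}_3+j\mathbf{e}_4\mid i\in[q],j\in[2],k\in[p]\}$, $C=\{\lambda_i\mathbf{e}_1+i\mathbf{e}_3\mid i\in[2]\}$; (24) $S_0=\{i\mathbf{e}_1+k\mathbf{e}_2+\alpha_{ij}\mathbf{e}_3+j\mathbf{e}_4\mid i\in[p],j\in[2],k\in[q]\}$, $C=\{\lambda_i\mathbf{e}_2+i\mathbf{e}_3\mid i\in[2]\}$; (25) $S_0=\{j\mathbf{e}_1+i\mathbf{e}_2+k\mathbf{e}_3+\alpha_i\mathbf{e}_4\mid i\in[q],j\in[p],k\in[2]\}$, $C=\{\lambda_i\mathbf{e}_1+\lambda_i\mathbf{e}_3+i\mathbf{e}_4\mid i\in[2]\}$; (26) $S_0=\{i\mathbf{e}_1+j\mathbf{e}_2+k\mathbf{e}_3+\alpha_i\mathbf{e}_4\mid i\in[p],j\in[q],k\in[2]\}$, $C=\{\lambda_i\mathbf{e}_2+\lambda_i\mathbf{e}_3+i\mathbf{e}_4\mid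 i\in[2]\}$; (27) $S_0=\{i\mathbf{e}_1+j\mathbf{e}_2+\alpha_{ijk}\mathbf{e}_3+k\mathbf{e}_4\mid i\in[p],j\in[q],k\in[2]\}$, $C=\{i\mathbf{e}_3\mid i\in[2]\}$; (28) $S_0=\{i\mathbf{e}_1+\alpha_{ij}\mathbf{e}_2+k\mathbf{e}_3+j\mathbf{e}_4\mid i\in[p],j,k\in[2]\}$, $C=\{i\mathbf{e}_2+\lambda_i\mathbf{e}_3\mid i\in[q]\}$; (29) $S_0=\{k\mathbf{e}_1+\alpha_{ij}\mathbf{e}_2+i\mathbf{e}_3+j\mathbf{e}_4\mid i,j\in[2],k\in[p]\}$, $C=\{\lambda_i\mathbf{e}_1+i\mathbf{e}_2\mid i\in[q]\}$; (30) $S_0=\{i\mathbf{e}_1+\alpha_i\mathbf{e}_2+j\mathbf{e}_3+k\mathbf{e}_4\mid i\in[p],j,k\in[2]\}$, $C=\{i\mathbf{e}_2+\lambda_i\mathbf{e}_3+\mu_i\mathbf{e}_4\mid i\in[q]\}$; (31) $S_0=\{j\mathbf{e}_1+\alpha_i\mathbf{e}_2+k\mathbf{e}_3+i\mathbf{e}_4\mid i,k\in[2],j\in[p]\}$, $C=\{\lambda_i\mathbf{e}_1+i\mathbf{e}_2+\lambda_i\mathbf{e}_3\mid i\in[q]\}$; (32) $S_0=\{i\mathbf{e}_1+\alpha_{ijk}\mathbf{e}_2+j\mathbf{e}_3+k\mathbf{e}_4\mid i\in[p],j,k\in[2]\}$, $C=\{i\mathbf{e}_2\mid i\in[q]\}$;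 (33) $S_0=\{\alpha_{ij}\mathbf{e}_1+i\mathbf{e}_2+k\mathbf{e}_3+j\mathbf{e}_4\mid i\in[q],j,k\in[2]\}$, $C=\{i\mathbf{e}_1+\lambda_i\mathbf{e}_3\mid i\in[p]\}$; (34) $S_0=\{\alpha_{ij}\mathbf{e}_1+k\mathbf{e}_2+i\mathbf{e}_3+j\mathbf{e}_4\mid i,j\in[2],k\in[q]\}$, $C=\{i\mathbf{e}_1+\lambda_i\mathbf{e}_2\mid i\in[p]\}$; (35) $S_0=\{\alpha_i\mathbf{e}_1+i\mathbf{e}_2+j\mathbf{e}_3+k\mathbf{e}_4\mid i\in[q],j,k\in[2]\}$, $C=\{i\mathbf{e}_1+\lambda_i\mathbf{e}_3+\mu_i\mathbf{e}_4\mid i\in[p]\}$; (36) $S_0=\{\alpha_i\mathbf{e}_1+j\mathbf{e}_2+k\mathbf{e}_3+i\mathbf{e}_4\mid i,k\in[2],j\in[q]\}$, $C=\{i\mathbf{e}_1+\lambda_i\mathbf{e}_2+\lambda_i\mathbf{e}_3\mid i\in[p]\}$; (37) $S_0=\{\alpha_{ijk}\mathbf{e}_1+i\mathbf{e}_2+j\mathbf{e}_3+k\mathbf{e}_4\mid i\in[q],j,k\in[2]\}$, $C=\{i\mathbf{e}_1\mid i\in[p]\}$.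
   Context: Groups are finite abelian, written additively; $\mathbb{Z}_n$ is the group of integers modulo $n$ and $[n]=\{0,1,\dots,n-1\}$. For $S\subseteq G\setminus\{0\}$, $\mathrm{Cay}(G,S)$ is the directed graph with vertex set $G$ and an arc from $x$ to $y$ if and only if $y-x\in S$ ($S$ is not assumed to be inverse-closed). A subset $C\subseteq G$ is a perfect code in $\mathrm{Cay}(G,S)$ if the sets $\{c\}\cup\{v:\text{there is an arc from } c \text{ to } v\}$, $c\in C$, form a partition of $G$. Greek letters with subscripts denote arbitrary integers, one for each value of the displayed indices, subject only to being $0$ when all subscripts are $0$; different letters (or index patterns) denote independent families, and an integer occurring several times in one element is the same integer each time. *)

theory Defs
  imports "HOL-Computational_Algebra.Primes" "HOL-Algebra.Elementary_Groups"
    "HOL-Library.Disjoint_Sets" "Graph_Theory.Pair_Digraph"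
begin

text \<open>HOL-Algebra writes groups multiplicatively: the zero of an additive group is
  \<open>\<one>\<close>, the difference \<open>y - x\<close> is \<open>y \<otimes> inv x\<close>, and the integer multiple
  \<open>n x\<close> is \<open>x [^] n\<close>.\<close>

definition cayley_digraph :: "('a, 'm) monoid_scheme \<Rightarrow> 'a set \<Rightarrow> 'a pair_pre_digraph" where
  "cayley_digraph G S =
     \<lparr>pverts = carrier G,
      parcs = {(x, y). x \<in> carrier G \<and> y \<in> carrier G \<and> y \<otimes>\<^bsub>G\<^esub> inv\<^bsub>G\<^esub> x \<in> S}\<rparr>"

definition closed_out_nbhd :: "'a pair_pre_digraph \<Rightarrow> 'a \<Rightarrow> 'a set" where
  "closed_out_nbhd D c = insert c {v. (c, v) \<in> parcs D}"

text \<open>The neighbourhoods partition the vertex set as a family indexed by \<open>C\<close>: two different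
  elements of \<open>C\<close> with the same closed out-neighbourhood are excluded.\<close>

definition perfect_code :: "'a pair_pre_digraph \<Rightarrow> 'a set \<Rightarrow> bool" where
  "perfect_code D C \<longleftrightarrow>
     C \<subseteq> pverts D \<and>
     disjoint_family_on (closed_out_nbhd D) C \<and>
     (\<Union>c\<in>C. closed_out_nbhd D c) = pverts D"

definition Zpq22 :: "nat \<Rightarrow> nat \<Rightarrow> (int \<times> int \<times> int \<times> int) monoid" where
  "Zpq22 p q = integer_mod_group p \<times>\<times> integer_mod_group q \<times>\<times>
               integer_mod_group 2 \<times>\<times> integer_mod_group 2"

text \<open>\<open>lincomb G e1 e2 e3 e4 a b c d\<close> is, written additively,
  \<open>a e1 + b e2 + c e3 + d e4\<close>.\<close>

definition lincomb :: "('a, 'm) monoid_scheme \<Rightarrow> 'a \<Rightarrow> 'a \<Rightarrow> 'a \<Rightarrow> 'a \<Rightarrow>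
    int \<Rightarrow> int \<Rightarrow> int \<Rightarrow> int \<Rightarrow> 'a" where
  "lincomb G e1 e2 e3 e4 a b c d =
     e1 [^]\<^bsub>G\<^esub> a \<otimes>\<^bsub>G\<^esub> e2 [^]\<^bsub>G\<^esub> b \<otimes>\<^bsub>G\<^esub> e3 [^]\<^bsub>G\<^esub> c \<otimes>\<^bsub>G\<^esub> e4 [^]\<^bsub>G\<^esub> d"

end

theory Submission
  imports Defs "HOL-Number_Theory.Cong" "HOL-Library.Z2" "HOL-Library.Product_Plus"
begin

text \<open>A set \<open>C\<close> is a perfect code in \<open>Cay(G, S)\<close> exactly if every element of \<open>G\<close> is a sum
\<open>s + c\<close> with \<open>s \<in> S\<^sub>0\<close> and \<open>c \<in> C\<close> in exactly one way (\<open>perfect_code_iff_factorization\<close>).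
So the theorem classifies the factorizations \<open>G = S\<^sub>0 + C\<close> of
\<open>G = \<int>\<^sub>p \<times> \<int>\<^sub>q \<times> V\<close>, with \<open>V\<close> the Klein four-group, whose first factor generates \<open>G\<close>.

Everything rests on one fact: if \<open>G = A + B\<close> is a factorization and \<open>k\<close> is coprime to \<open>card A\<close>,
then \<open>G = k A + B\<close> is a factorization as well (\<open>factorization_power\<close>). Suppose that \<open>p\<close> does not
divide \<open>card A\<close>. By the Chinese remainder theorem the multiplier \<open>k\<close> can be chosen to act as an
arbitrary integer \<open>c\<close> on \<open>\<int>\<^sub>p\<close> and as the identity on the other components; hence the
\<open>\<int>\<^sub>p\<close>-coordinates of \<open>A\<close> may be multiplied by any \<open>c\<close>, even by \<open>0\<close> (\<open>factorization_scale\<close>).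
Now let two sums \<open>a + b\<close> and \<open>a' + b'\<close> agree outside \<open>\<int>\<^sub>p\<close>. Some \<open>c\<close> makes them agree in \<open>\<int>\<^sub>p\<close> too,
unless \<open>a\<close> and \<open>a'\<close> have equal and \<open>b\<close> and \<open>b'\<close> have different \<open>\<int>\<^sub>p\<close>-coordinates. Apart from
this exception, then, \<open>a = a'\<close> and \<open>b = b'\<close> (\<open>offset_P\<close>, and \<open>offset_PQ\<close>, \<open>offset_QP\<close> for both primes).

Since \<open>card A * card B = 4 p q\<close>, each of \<open>p\<close> and \<open>q\<close> divides only one of the two cardinalities, so
this rigidity is always available, and it settles every possible pair of orders.

\<^item> If one factor has order \<open>q\<close>, the other one is the graph of a function
  \<open>f : \<int>\<^sub>p \<times> V \<rightarrow> \<int>\<^sub>q\<close> that is invariant under the \<open>V\<close>-coordinates of the first factor, and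
  constant in the \<open>\<int>\<^sub>p\<close>-direction unless the first factor lies in \<open>\<int>\<^sub>q \<times> V\<close> (\<open>prime_cofactor\<close>).
\<^item> If one factor has order \<open>4\<close>, it is the graph of functions \<open>g, h\<close> on \<open>V\<close> and the other one is the
  graph of a function \<open>f\<close> with values in \<open>V\<close>. Every difference of two values of \<open>f\<close> along the
  \<open>\<int>\<^sub>p\<close>-direction is a period of \<open>g\<close>, and likewise for \<open>\<int>\<^sub>q\<close> and \<open>h\<close> (\<open>cofactor_card_4\<close>,
  \<open>graph_rigidity\<close>).
\<^item> If \<open>C = {0, c}\<close>, the set \<open>S\<^sub>0\<close> contains exactly one element of each pair that differs by the
  \<open>V\<close>-coordinate of \<open>c\<close>, and it is periodic in every odd direction in which \<open>c\<close> does not vanish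
  (\<open>card_2_halving\<close>).
\<^item> If the orders are \<open>2 p\<close> and \<open>2 q\<close>, the fibres of the first factor over \<open>\<int>\<^sub>p\<close> and those of the
  second factor over \<open>\<int>\<^sub>q\<close> are pairs in \<open>V\<close>, and a pair of one kind never has the same direction as
  one of the other kind (\<open>slice_rigid\<close>, \<open>slice_directions\<close>).

That \<open>S\<close> generates \<open>G\<close> is used through its coordinates alone: neither odd coordinate vanishes
identically on \<open>S\<close>, and the \<open>V\<close>-coordinates do not all lie in a proper subgroup of \<open>V\<close>.

Conversely, all pairs of the list are triangular: the coordinates can be ordered so that a sum
\<open>s + c\<close> determines, one coordinate after the other, the parameters of \<open>s\<close> and \<open>c\<close>. Counting then
shows that they are factorizations.\<close>

section \<open>Multiplying one factor of a factorization by an integer\<close>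

text \<open>The points that are not fixed fall into orbits, and a map whose \<open>k\<close>-th iterate is the identity,
with \<open>k\<close> prime, has only orbits of length \<open>1\<close> and \<open>k\<close>.\<close>

lemma card_cong_fixed_points:
  assumes fin: "finite T" and k: "prime (k::nat)"
    and maps: "\<And>x. x \<in> T \<Longrightarrow> f x \<in> T" and per: "\<And>x. x \<in> T \<Longrightarrow> (f ^^ k) x = x"
  shows "[card T = card {x \<in> T. f x = x}] (mod k)"
proof -
  have k1: "k > 1" using k by (rule prime_gt_1_nat)
  define orb where "orb x = (\<lambda>i. (f ^^ i) x) ` {..<k}" for x
  have iter: "(f ^^ i) x \<in> T" if "x \<in> T" for i x
    using that by (induction i) (auto simp: maps)
  have mult: "(f ^^ (k * n)) x = x" if "x \<in> T" for n x
    using that by (induction n) (auto simp: per funpow_add)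
  have modk: "(f ^^ i) x = (f ^^ (i mod k)) x" if "x \<in> T" for i x
  proof -
    have "(f ^^ i) x = (f ^^ (i mod k + k * (i div k))) x" by simp
    also have "\<dots> = (f ^^ (i mod k)) x"
      unfolding funpow_add using mult[OF that] by simp
    finally show ?thesis .
  qed
  have fix1: "f x = x" if x: "x \<in> T" and ij: "(f ^^ i) x = (f ^^ j) x" "i < j" "j < k" for x i j
  proof -
    define d where "d = j - i"
    have d: "0 < d" "d < k" using ij by (auto simp: d_def)
    have "(f ^^ (k - i)) ((f ^^ i) x) = (f ^^ (k - i)) ((f ^^ j) x)" using ij by simp
    then have "(f ^^ (k - i + i)) x = (f ^^ (k - i + j)) x"
      unfolding funpow_add by simp
    moreover have "k - i + i = k" "k - i + j = d + k" using ij by (auto simp: d_def)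
    ultimately have fd: "(f ^^ d) x = x" using per[OF x] by (simp add: funpow_add)
    have fdn: "(f ^^ (d * n)) x = x" for n
      by (induction n) (auto simp: fd funpow_add)
    \<comment> \<open>a shorter period is invertible modulo the prime, so a multiple of it is a single step\<close>
    have "coprime d k" using d k
      by (metis coprime_commute nat_dvd_not_less prime_imp_coprime)
    then obtain n where n: "[d * n = 1] (mod k)"
      using cong_solve_coprime_nat by auto
    have "f x = (f ^^ 1) x" by simp
    also have "\<dots> = (f ^^ (d * n)) x"
      using modk[OF x, of 1] modk[OF x, of "d * n"] n by (simp add: cong_def)
    finally show ?thesis using fdn by simp
  qed
  define N where "N = {x \<in> T. f x \<noteq> x}"
  have finN: "finite N" using fin by (simp add: N_def)
  have fixit: "f x = x" if x: "x \<in> T" and "f ((f ^^ i) x) = (f ^^ i) x" for x i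
  proof -
    have "(f ^^ Suc (i mod k)) x = (f ^^ (i mod k)) x" 
    proof -
      have "(f ^^ Suc (i mod k)) x = f ((f ^^ (i mod k)) x)" by simp
      thus ?thesis using that modk[OF x, of i] by simp
    qed
    then have *: "(f ^^ (Suc (i mod k) mod k)) x = (f ^^ (i mod k)) x"
      using modk[OF x, of "Suc (i mod k)"] by simp
    have ik: "i mod k < k" "Suc (i mod k) mod k < k" using k1 by auto
    have "Suc (i mod k) mod k \<noteq> i mod k"
    proof (cases "Suc (i mod k) = k")
      case True then show ?thesis using k1 by auto
    next
      case False then show ?thesis using ik by auto
    qed
    then show ?thesis using fix1[OF x *] fix1[OF x *[symmetric]] ik by (metis nat_neq_iff)
  qed
  have orbN: "orb x \<subseteq> N" if "x \<in> N" for x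
    using that fixit iter by (auto simp: orb_def N_def)
  have card_orb: "card (orb x) = k" if "x \<in> N" for x
  proof -
    have "inj_on (\<lambda>i. (f ^^ i) x) {..<k}"
    proof (rule inj_onI, rule ccontr)
      fix i j assume "i \<in> {..<k}" "j \<in> {..<k}" "(f ^^ i) x = (f ^^ j) x" "i \<noteq> j"
      then have "f x = x" using fix1[of x i j] fix1[of x j i] that by (auto simp: N_def nat_neq_iff)
      then show False using that by (simp add: N_def)
    qed
    then show ?thesis by (simp add: orb_def card_image)
  qed
  have self: "x \<in> orb x" for x
    using k1 by (auto simp: orb_def intro!: image_eqI[of _ _ 0])
  have sub: "orb y \<subseteq> orb x" if xy: "x \<in> T" "y \<in> orb x" for x y
  proof
    fix z assume "z \<in> orb y"
    then obtain i where i: "z = (f ^^ i) y" unfolding orb_def by blast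
    obtain j where j: "y = (f ^^ j) x" using xy unfolding orb_def by blast
    from i j have "z = (f ^^ (i + j)) x" by (simp add: funpow_add)
    then show "z \<in> orb x" using modk[OF xy(1), of "i + j"] k1 by (auto simp: orb_def)
  qed
  have sym: "x \<in> orb y" if x: "x \<in> T" and "y \<in> orb x" for x y
  proof -
    obtain i where i: "i < k" "y = (f ^^ i) x" using \<open>y \<in> orb x\<close> unfolding orb_def by blast
    have "(f ^^ (k - i)) y = (f ^^ (k - i + i)) x" by (simp add: i funpow_add del: le_add_diff_inverse2)
    then have "(f ^^ (k - i)) y = x" using per[OF x] i by simp
    moreover have "y \<in> T" using iter x i by simp
    ultimately have "x = (f ^^ ((k - i) mod k)) y" using modk by metis
    then show ?thesis using k1 by (auto simp: orb_def)
  qed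
  have eq: "orb y = orb x" if "x \<in> N" "y \<in> orb x" for x y
  proof -
    have "x \<in> T" "y \<in> T" using that orbN[OF that(1)] by (auto simp: N_def)
    then show ?thesis using sub sym that(2) by (meson subset_antisym)
  qed
  have "k * card (orb ` N) = card (\<Union> (orb ` N))"
  proof (rule card_partition)
    show "finite (\<Union> (orb ` N))" using finN by (auto simp: orb_def)
    fix c1 c2 assume "c1 \<in> orb ` N" "c2 \<in> orb ` N" "c1 \<noteq> c2"
    then show "c1 \<inter> c2 = {}" using eq by (metis IntE disjoint_iff imageE)
  qed (use finN card_orb in auto)
  moreover have "\<Union> (orb ` N) = N" using orbN self by blast
  ultimately have "k dvd card N" by (metis dvd_triv_left)
  moreover have "card T = card N + card {x \<in> T. f x = x}"
  proof -
    have "T = N \<union> {x \<in> T. f x = x}" by (auto simp: N_def)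
    moreover have "card (N \<union> {x \<in> T. f x = x}) = card N + card {x \<in> T. f x = x}"
      by (rule card_Un_disjoint) (use fin in \<open>auto simp: N_def\<close>)
    ultimately show ?thesis by simp
  qed
  ultimately show ?thesis by (auto simp: cong_def)
qed

definition factorization :: "('a, 'm) monoid_scheme \<Rightarrow> 'a set \<Rightarrow> 'a set \<Rightarrow> bool" where
  "factorization G A B \<longleftrightarrow> A \<subseteq> carrier G \<and> B \<subseteq> carrier G \<and>
     bij_betw (\<lambda>(a, b). a \<otimes>\<^bsub>G\<^esub> b) (A \<times> B) (carrier G)"

lemma factorization_unique:
  assumes "factorization G A B" "a \<in> A" "a' \<in> A" "b \<in> B" "b' \<in> B"
    "a \<otimes>\<^bsub>G\<^esub> b = a' \<otimes>\<^bsub>G\<^esub> b'"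
  shows "a = a' \<and> b = b'"
proof -
  have "inj_on (\<lambda>(a, b). a \<otimes>\<^bsub>G\<^esub> b) (A \<times> B)"
    using assms(1) by (simp add: factorization_def bij_betw_def)
  from inj_onD[OF this, of "(a, b)" "(a', b')"] show ?thesis using assms(2-) by simp
qed

lemma factorization_obtain:
  assumes "factorization G A B" "g \<in> carrier G"
  obtains a b where "a \<in> A" "b \<in> B" "g = a \<otimes>\<^bsub>G\<^esub> b"
proof -
  have "g \<in> (\<lambda>(a, b). a \<otimes>\<^bsub>G\<^esub> b) ` (A \<times> B)"
    using assms by (auto simp: factorization_def bij_betw_def)
  then show ?thesis using that by auto
qed

lemma factorization_card:
  assumes "factorization G A B" shows "card A * card B = card (carrier G)"
  using assms by (metis bij_betw_same_card card_cartesian_product factorization_def)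

lemma (in comm_group) factorization_commute:
  assumes "factorization G A B" shows "factorization G B A"
proof -
  have "bij_betw (\<lambda>(b, a). b \<otimes> a) (B \<times> A) (carrier G)"
  proof -
    have "bij_betw (\<lambda>(a, b). (b, a)) (B \<times> A) (A \<times> B)"
      by (rule bij_betw_byWitness[where f' = "\<lambda>(a, b). (b, a)"]) auto
    then have "bij_betw ((\<lambda>(a, b). a \<otimes> b) \<circ> (\<lambda>(a, b). (b, a))) (B \<times> A) (carrier G)"
      using assms unfolding factorization_def by (metis bij_betw_trans)
    then show ?thesis
      by (rule bij_betw_cong[THEN iffD1, rotated])
         (use assms in \<open>auto simp: factorization_def m_comm subset_iff\<close>)
  qed
  then show ?thesis using assms by (simp add: factorization_def)
qed

text \<open>For an element \<open>g\<close> count the solutions of \<open>a\<^sub>1 + \<dots> + a\<^sub>k + b = g\<close>. Choosing all but the last \<open>a\<^sub>i\<close>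
freely leaves one solution, so there are \<open>(card A) ^ (k - 1)\<close> of them, which is not divisible by \<open>k\<close>.
Rotating \<open>(a\<^sub>1, \<dots>, a\<^sub>k)\<close> permutes the solutions with period \<open>k\<close>, so some solution is constant:
\<open>g = k a + b\<close>. A surjection between finite sets of equal size is bijective.\<close>

lemma (in comm_group) factorization_power_prime:
  assumes fin: "finite (carrier G)" and F: "factorization G A B" and k: "prime (k::nat)"
    and nd: "\<not> k dvd card A"
  shows "inj_on (\<lambda>a. a [^] k) A \<and> factorization G ((\<lambda>a. a [^] k) ` A) B"
proof -
  define lp where "lp xs = foldr (\<otimes>) xs \<one>" for xs
  have AG: "A \<subseteq> carrier G" and BG: "B \<subseteq> carrier G" using F by (auto simp: factorization_def)
  have finA: "finite A" and finB: "finite B" using AG BG fin finite_subset by auto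
  have k0: "k > 0" using k prime_gt_0_nat by simp
  have lpc: "lp xs \<in> carrier G" if "set xs \<subseteq> A" for xs
    using that AG by (induction xs) (auto simp: lp_def)
  have lp_app: "lp (xs @ [a]) = lp xs \<otimes> a" if "set xs \<subseteq> A" "a \<in> A" for xs a
    using that AG
  proof (induction xs)
    case (Cons x xs)
    then show ?case using lpc[of xs] by (auto simp: lp_def m_assoc subset_iff)
  qed (auto simp: lp_def)
  have lp_rot: "lp (rotate1 xs) = lp xs" if "set xs \<subseteq> A" for xs
  proof (cases xs)
    case (Cons x ys)
    then show ?thesis using that lp_app[of ys x] lpc[of ys] AG
      by (auto simp: lp_def m_comm subset_iff)
  qed simp
  have lp_rep: "lp (replicate n a) = a [^] n" if "a \<in> A" for n a
  proof (induction n)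
    case (Suc n)
    have "a \<in> carrier G" using that AG by auto
    then show ?case using Suc by (simp add: lp_def m_comm)
  qed (simp add: lp_def)
  have ex: "\<exists>a\<in>A. \<exists>b\<in>B. a [^] k \<otimes> b = g" if g: "g \<in> carrier G" for g
  proof -
    define T where "T = {(xs, b). set xs \<subseteq> A \<and> length xs = k \<and> b \<in> B \<and> lp xs \<otimes> b = g}"
    define Y where "Y = {xs. set xs \<subseteq> A \<and> length xs = k - 1}"
    define f where "f = (\<lambda>(xs :: 'a list, b :: 'a). (rotate1 xs, b))"
    have finT: "finite T"
    proof (rule finite_subset)
      show "T \<subseteq> {xs. set xs \<subseteq> A \<and> length xs = k} \<times> B" by (auto simp: T_def)
      show "finite ({xs. set xs \<subseteq> A \<and> length xs = k} \<times> B)"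
        using finite_lists_length_eq[OF finA] finB by simp
    qed
    have "bij_betw (\<lambda>(xs, b). tl xs) T Y"
    proof (rule bij_betwI')
      show "((\<lambda>(xs, b). tl xs) x = (\<lambda>(xs, b). tl xs) y) = (x = y)" if "x \<in> T" "y \<in> T" for x y
      proof
        assume eq: "(\<lambda>(xs, b). tl xs) x = (\<lambda>(xs, b). tl xs) y"
        obtain u us b v vs c where xy: "x = (u # us, b)" "y = (v # vs, c)"
          using \<open>x \<in> T\<close> \<open>y \<in> T\<close> k0 unfolding T_def
          by (auto simp: length_Suc_conv gr0_conv_Suc)
        then have vs: "vs = us" using eq by simp
        have m: "set us \<subseteq> A" "u \<in> A" "v \<in> A" "b \<in> B" "c \<in> B"
          "(u \<otimes> lp us) \<otimes> b = g" "(v \<otimes> lp us) \<otimes> c = g"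
          using \<open>x \<in> T\<close> \<open>y \<in> T\<close> xy vs by (auto simp: T_def lp_def)
        have cc: "u \<in> carrier G" "v \<in> carrier G" "b \<in> carrier G" "c \<in> carrier G" "lp us \<in> carrier G"
          using m AG BG lpc by auto
        have "lp us \<otimes> (u \<otimes> b) = lp us \<otimes> (v \<otimes> c)"
          using m(6,7) cc by (metis m_assoc m_comm)
        then have "u \<otimes> b = v \<otimes> c" using cc by simp
        then show "x = y" using factorization_unique[OF F m(2,3,4,5)] xy vs by simp
      qed simp
      show "(\<lambda>(xs, b). tl xs) x \<in> Y" if "x \<in> T" for x
      proof -
        obtain xs b where x: "x = (xs, b)" "set xs \<subseteq> A" "length xs = k"
          using \<open>x \<in> T\<close> by (auto simp: T_def)
        then show ?thesis using k0 by (cases xs) (auto simp: Y_def)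
      qed
      show "\<exists>x\<in>T. y = (\<lambda>(xs, b). tl xs) x" if "y \<in> Y" for y
      proof -
        have y: "set y \<subseteq> A" "length y = k - 1" using that by (auto simp: Y_def)
        have l: "lp y \<in> carrier G" using lpc y by simp
        obtain a b where ab: "a \<in> A" "b \<in> B" "g \<otimes> inv (lp y) = a \<otimes> b"
          using factorization_obtain[OF F, of "g \<otimes> inv (lp y)"] g l by auto
        have cc: "a \<in> carrier G" "b \<in> carrier G" using ab AG BG by auto
        have "lp (a # y) \<otimes> b = (a \<otimes> b) \<otimes> lp y"
          using cc l by (simp add: lp_def m_assoc m_comm[of b])
        also have "\<dots> = g" using g l by (simp add: ab(3)[symmetric] m_assoc)
        finally have "(a # y, b) \<in> T" using ab y k0 by (auto simp: T_def)
        then show ?thesis by force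
      qed
    qed
    then have "card T = card A ^ (k - 1)"
      using card_lists_length_eq[OF finA, of "k - 1"] bij_betw_same_card unfolding Y_def by fastforce
    then have ndT: "\<not> k dvd card T" using nd k prime_dvd_power by auto
    have "[card T = card {x \<in> T. f x = x}] (mod k)"
    proof (rule card_cong_fixed_points[OF finT k])
      show "f x \<in> T" if "x \<in> T" for x using that lp_rot by (auto simp: T_def f_def)
      have "(f ^^ n) (xs, b) = ((rotate1 ^^ n) xs, b)" for n xs b
        by (induction n) (auto simp: f_def)
      then show "(f ^^ k) x = x" if "x \<in> T" for x
        using that by (auto simp: T_def simp flip: rotate_def)
    qed
    then have "card {x \<in> T. f x = x} \<noteq> 0" using ndT by (metis cong_dvd_iff dvd_0_right)
    then have "{x \<in> T. f x = x} \<noteq> {}" by (metis card.empty)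
    then obtain xs b where x: "(xs, b) \<in> T" "rotate1 xs = xs"
      by (auto simp: f_def)
    have len: "length xs = k" using x by (simp add: T_def)
    have const: "xs ! i = xs ! 0" if "i < k" for i
      using that
    proof (induction i)
      case (Suc i)
      have "rotate1 xs ! i = xs ! (Suc i mod length xs)"
        using Suc.prems len by (simp add: nth_rotate1)
      then show ?case using Suc x len by simp
    qed simp
    have "xs = replicate k (xs ! 0)"
    proof (rule nth_equalityI)
      fix i assume "i < length xs"
      then have "i < k" using len by simp
      from const[OF this] show "xs ! i = replicate k (xs ! 0) ! i" using \<open>i < k\<close> by simp
    qed (use len in simp)
    moreover have "xs ! 0 \<in> A" using x len k0 by (auto simp: T_def)
    ultimately have "lp xs = (xs ! 0) [^] k" using lp_rep by metis
    then show ?thesis using x \<open>xs ! 0 \<in> A\<close> by (auto simp: T_def)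
  qed
  define m where "m = (\<lambda>(a, b). a [^] k \<otimes> b)"
  have im: "m ` (A \<times> B) = carrier G"
  proof
    show "m ` (A \<times> B) \<subseteq> carrier G" using AG BG by (auto simp: m_def)
    show "carrier G \<subseteq> m ` (A \<times> B)" using ex by (force simp: m_def)
  qed
  have inj: "inj_on m (A \<times> B)"
    using finA finB factorization_card[OF F] im
    by (intro eq_card_imp_inj_on) (auto simp: card_cartesian_product)
  obtain b0 where b0: "b0 \<in> B" using factorization_obtain[OF F one_closed] by metis
  have inj1: "inj_on (\<lambda>a. a [^] k) A"
    using inj b0 by (auto simp: inj_on_def m_def)
  have "bij_betw (\<lambda>(a, b). a \<otimes> b) ((\<lambda>a. a [^] k) ` A \<times> B) (carrier G)"
    unfolding bij_betw_def
  proof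
    show "inj_on (\<lambda>(a, b). a \<otimes> b) ((\<lambda>a. a [^] k) ` A \<times> B)"
      using inj by (fastforce simp: inj_on_def m_def)
    show "(\<lambda>(a, b). a \<otimes> b) ` ((\<lambda>a. a [^] k) ` A \<times> B) = carrier G"
      unfolding im[symmetric] by (force simp: m_def)
  qed
  then show ?thesis using inj1 AG BG by (auto simp: factorization_def)
qed

text \<open>The prime factors of \<open>k\<close> are applied one after the other; the order of the first factor stays the same.\<close>

lemma (in comm_group) factorization_power:
  assumes fin: "finite (carrier G)" and F: "factorization G A B" and k: "coprime (k::nat) (card A)" "k > 0"
  shows "inj_on (\<lambda>a. a [^] k) A \<and> factorization G ((\<lambda>a. a [^] k) ` A) B"
  using F k
proof (induction k arbitrary: A rule: less_induct)
  case (less k)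
  have AG: "A \<subseteq> carrier G" using less.prems by (auto simp: factorization_def)
  show ?case
  proof (cases "k = 1")
    case True
    have "(\<lambda>a. a [^] k) ` A = A" using AG True by (auto simp: subset_iff)
    moreover have "inj_on (\<lambda>a. a [^] k) A" using AG True by (auto simp: inj_on_def subset_iff)
    ultimately show ?thesis using less.prems by simp
  next
    case False
    then obtain l where l: "prime l" "l dvd k" using prime_factor_nat by blast
    then obtain k' where k': "k = l * k'" by auto
    have nl: "\<not> l dvd card A"
      using less.prems(2) l not_prime_unit coprime_common_divisor by blast
    define A' where "A' = (\<lambda>a. a [^] l) ` A"
    have 1: "inj_on (\<lambda>a. a [^] l) A" "factorization G A' B"
      using factorization_power_prime[OF fin less.prems(1) l(1) nl] by (auto simp: A'_def)
    have "card A' = card A" using 1 by (simp add: A'_def card_image)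
    moreover have "k' < k" "k' > 0" using k' less.prems l prime_gt_1_nat[OF l(1)] by auto
    moreover have "coprime k' (card A)" using less.prems(2) k' by simp
    ultimately have 2: "inj_on (\<lambda>a. a [^] k') A'" "factorization G ((\<lambda>a. a [^] k') ` A') B"
      using less.IH[of k' A'] 1 by auto
    have pw: "(a [^] l) [^] k' = a [^] k" if "a \<in> A" for a
      using that AG k' by (auto simp: nat_pow_pow)
    have "(\<lambda>a. a [^] k) ` A = (\<lambda>a. a [^] k') ` A'"
      by (simp add: A'_def image_image pw cong: image_cong)
    moreover have "inj_on (\<lambda>a. a [^] k) A"
    proof (rule inj_onI)
      fix x y assume xy: "x \<in> A" "y \<in> A" "x [^] k = y [^] k"
      then have "(x [^] l) [^] k' = (y [^] l) [^] k'" by (simp add: pw)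
      then have "x [^] l = y [^] l"
        by (rule inj_onD[OF 2(1)]) (use xy in \<open>auto simp only: A'_def\<close>)
      then show "x = y" by (rule inj_onD[OF 1(1)]) (use xy in auto)
    qed
    ultimately show ?thesis using 2 by simp
  qed
qed

section \<open>The Klein four-group\<close>

type_synonym klein = "bit \<times> bit"

lemma bit_self [simp]: "(x :: bit) + x = 0"
  by (cases x) auto

lemma klein_self [simp]: "(v :: klein) + v = 0"
  by (simp add: prod_eq_iff)

lemma klein_self_left [simp]: "(v :: klein) + (v + w) = w"
  by (simp add: add.assoc [symmetric])

lemma klein_add_eq_0 [simp]: "(v :: klein) + w = 0 \<longleftrightarrow> v = w"
  by (metis add.right_neutral klein_self klein_self_left)

lemma klein_cases:
  fixes v w w' :: klein
  assumes "w \<noteq> 0" "w' \<noteq> 0" "w \<noteq> w'"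
  shows "v = 0 \<or> v = w \<or> v = w' \<or> v = w + w'"
proof -
  obtain a b where v: "v = (a, b)" by (cases v)
  obtain c d where w: "w = (c, d)" by (cases w)
  obtain e f where w': "w' = (e, f)" by (cases w')
  show ?thesis using assms unfolding v w w'
    by (cases a; cases b; cases c; cases d; cases e; cases f) (auto simp: zero_prod_def)
qed

lemma card_klein: "card (UNIV :: klein set) = 4"
proof -
  have "x \<in> {0, 1}" for x :: bit by (cases x) auto
  then have "(UNIV :: bit set) = {0, 1}" by blast
  then have "card (UNIV :: bit set) = card {0 :: bit, 1}" by (simp only:)
  then have "card (UNIV :: bit set) = 2" by simp
  then show ?thesis by (simp add: card_cartesian_product flip: UNIV_Times_UNIV)
qed

lemma finite_klein [simp]: "finite (A :: klein set)"
  using card_klein by (metis card.infinite finite_subset subset_UNIV zero_neq_numeral)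

lemma klein_basis_ex: "(w :: klein) \<noteq> 0 \<Longrightarrow> \<exists>w'. w' \<noteq> 0 \<and> w' \<noteq> w"
proof (rule ccontr)
  assume "\<nexists>w'. w' \<noteq> 0 \<and> w' \<noteq> w"
  then have "(UNIV :: klein set) \<subseteq> {0, w}" by auto
  then have "card (UNIV :: klein set) \<le> card {0, w}" by (rule card_mono[rotated]) simp
  also have "\<dots> \<le> 2" by (simp add: card_insert_if)
  finally show False by (simp add: card_klein)
qed

lemma cong_mult_solve:
  fixes u w :: int
  assumes "prime (p :: nat)" and "\<not> int p dvd u \<or> w = 0"
  obtains c where "[c * u = w] (mod int p)"
proof (cases "w = 0")
  case True then show ?thesis using that[of 0] by simp
next
  case False
  then have "coprime u (int p)"
    using assms by (metis coprime_commute prime_imp_coprime prime_nat_int_transfer)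
  then obtain x where "[u * x = 1] (mod int p)" using cong_solve_coprime_int by blast
  then have "[x * w * u = w] (mod int p)"
    using cong_scalar_left[of "u * x" 1 "int p" w] by (simp add: mult_ac)
  then show ?thesis using that by blast
qed

section \<open>Coordinates in two cyclic groups of odd prime order and the Klein four-group\<close>

text \<open>The group is given by coordinate maps and not as a concrete product, so that the roles of \<open>p\<close> and
\<open>q\<close> can be exchanged by interpreting the locale a second time (\<open>swap\<close>). An interpretation sees
the facts of the blocks that are closed before it; this is why the context is reopened several
times below.\<close>

locale pq_group = comm_group G for G (structure) +
  fixes p q :: nat and P Q :: "'a \<Rightarrow> int" and V :: "'a \<Rightarrow> klein"
  assumes p: "prime p" "odd p" and q: "prime q" "odd q" and pq: "p \<noteq> q"
    and coord: "bij_betw (\<lambda>g. (P g, Q g, V g)) (carrier G) ({0..<int p} \<times> {0..<int q} \<times> UNIV)"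
    and P_mult: "\<And>x y. x \<in> carrier G \<Longrightarrow> y \<in> carrier G \<Longrightarrow> P (x \<otimes> y) = (P x + P y) mod int p"
    and Q_mult: "\<And>x y. x \<in> carrier G \<Longrightarrow> y \<in> carrier G \<Longrightarrow> Q (x \<otimes> y) = (Q x + Q y) mod int q"
    and V_mult: "\<And>x y. x \<in> carrier G \<Longrightarrow> y \<in> carrier G \<Longrightarrow> V (x \<otimes> y) = V x + V y"
begin

lemma p_pos [simp]: "p > 0" "int p > 0" and q_pos [simp]: "q > 0" "int q > 0"
  using p q prime_gt_0_nat by auto

definition el :: "int \<Rightarrow> int \<Rightarrow> klein \<Rightarrow> 'a" where
  "el a b v = inv_into (carrier G) (\<lambda>g. (P g, Q g, V g)) (a mod int p, b mod int q, v)"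

lemma swap: "pq_group G q p Q P V"
proof unfold_locales
  have "bij_betw (\<lambda>(x, y, v). (y, x, v)) ({0..<int p} \<times> {0..<int q} \<times> (UNIV :: klein set))
      ({0..<int q} \<times> {0..<int p} \<times> UNIV)"
    by (rule bij_betw_byWitness[where f' = "\<lambda>(x, y, v). (y, x, v)"]) auto
  from bij_betw_trans[OF coord this]
  show "bij_betw (\<lambda>g. (Q g, P g, V g)) (carrier G) ({0..<int q} \<times> {0..<int p} \<times> UNIV)"
    by (simp add: o_def)
qed (use p q pq P_mult Q_mult V_mult in auto)

lemma range:
  assumes "g \<in> carrier G"
  shows P_range: "0 \<le> P g" "P g < int p" and Q_range: "0 \<le> Q g" "Q g < int q"
  using bij_betwE[OF coord] assms by auto

lemma coords_eq:
  assumes "g \<in> carrier G" "h \<in> carrier G" "P g = P h" "Q g = Q h" "V g = V h"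
  shows "g = h"
  using assms coord inj_onD[of "\<lambda>g. (P g, Q g, V g)" "carrier G" g h]
  by (auto simp: bij_betw_def)

lemma el:
  shows el_closed [simp, intro]: "el a b v \<in> carrier G"
    and P_el [simp]: "P (el a b v) = a mod int p"
    and Q_el [simp]: "Q (el a b v) = b mod int q"
    and V_el [simp]: "V (el a b v) = v"
proof -
  have m: "(a mod int p, b mod int q, v) \<in> (\<lambda>g. (P g, Q g, V g)) ` carrier G"
    using coord by (auto simp: bij_betw_def)
  show "el a b v \<in> carrier G" unfolding el_def by (rule inv_into_into[OF m])
  have "(\<lambda>g. (P g, Q g, V g)) (el a b v) = (a mod int p, b mod int q, v)"
    unfolding el_def by (rule f_inv_into_f[OF m])
  then show "P (el a b v) = a mod int p" "Q (el a b v) = b mod int q" "V (el a b v) = v"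
    by auto
qed

lemma P_mod: "g \<in> carrier G \<Longrightarrow> P g mod int p = P g"
  and Q_mod: "g \<in> carrier G \<Longrightarrow> Q g mod int q = Q g"
  using range by auto

lemma el_coords: "g \<in> carrier G \<Longrightarrow> el (P g) (Q g) (V g) = g"
  by (rule coords_eq) (auto simp: P_mod Q_mod)

lemma el_eqI: "g \<in> carrier G \<Longrightarrow> P g = a mod int p \<Longrightarrow> Q g = b mod int q \<Longrightarrow> V g = v \<Longrightarrow> g = el a b v"
  by (rule coords_eq) auto

lemma el_eq_iff: "el a b v = el a' b' v' \<longleftrightarrow> [a = a'] (mod int p) \<and> [b = b'] (mod int q) \<and> v = v'"
  by (metis P_el Q_el V_el cong_def el_closed el_eqI)

lemma el_mult: "el a b v \<otimes> el a' b' v' = el (a + a') (b + b') (v + v')"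
  by (rule el_eqI) (auto simp: P_mult Q_mult V_mult mod_add_eq)

lemma el_swap: "pq_group.el G q p Q P V b a v = el a b v"
  using pq_group.P_el[OF swap] pq_group.Q_el[OF swap] pq_group.V_el[OF swap]
    pq_group.el_closed[OF swap] by (intro el_eqI) auto

lemma one_coords [simp]: "P \<one> = 0" "Q \<one> = 0" "V \<one> = 0"
proof -
  have "el 0 0 0 \<otimes> el 0 0 0 = el 0 0 0" by (simp add: el_mult)
  then have "el 0 0 0 = \<one>" by (metis el_closed l_cancel_one')
  then show "P \<one> = 0" "Q \<one> = 0" "V \<one> = 0" using P_el[of 0 0 0] Q_el[of 0 0 0] V_el[of 0 0 0] by auto
qed

lemma el_0: "el 0 0 0 = \<one>"
  by (rule coords_eq) auto

lemma finite_G: "finite (carrier G)"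
  using bij_betw_finite[OF coord] by simp

lemma card_G: "card (carrier G) = 4 * p * q"
  using bij_betw_same_card[OF coord] by (simp add: card_cartesian_product card_klein)

lemma P_pow: "g \<in> carrier G \<Longrightarrow> P (g [^] (k :: nat)) = (int k * P g) mod int p"
proof (induction k)
  case (Suc k)
  then have "P (g [^] Suc k) = (int k * P g + P g) mod int p"
    by (simp add: P_mult mod_add_left_eq)
  then show ?case by (simp add: algebra_simps)
qed simp

lemma V_pow: "g \<in> carrier G \<Longrightarrow> V (g [^] (k :: nat)) = (if even k then 0 else V g)"
  by (induction k) (auto simp: V_mult)

end

lemma (in pq_group) Q_pow: "g \<in> carrier G \<Longrightarrow> Q (g [^] (k :: nat)) = (int k * Q g) mod int q"
  by (rule pq_group.P_pow[OF swap])

section \<open>Scaling one coordinate of a factor\<close>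

context pq_group
begin

definition scale :: "int \<Rightarrow> 'a \<Rightarrow> 'a" where
  "scale c g = el (c * P g) (Q g) (V g)"

lemma scale_coords [simp]:
  "scale c g \<in> carrier G" "P (scale c g) = c * P g mod int p" "V (scale c g) = V g"
  "g \<in> carrier G \<Longrightarrow> Q (scale c g) = Q g"
  by (auto simp: scale_def Q_mod)

text \<open>By the Chinese remainder theorem there is a multiplier \<open>k\<close> with \<open>k \<equiv> c\<close> modulo \<open>p\<close> and \<open>k \<equiv> 1\<close>
modulo \<open>2 q\<close>. The only primes that can divide \<open>card A\<close> are \<open>2\<close> and \<open>q\<close>, so \<open>k\<close> is coprime to \<open>card A\<close>.\<close>

lemma factorization_scale:
  assumes F: "factorization G A B" and np: "\<not> p dvd card A"
  shows "inj_on (scale c) A \<and> factorization G (scale c ` A) B"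
proof -
  have cop: "coprime p (2 * q)"
    using p q pq by (metis coprime_mult_right_iff odd_iff_mod_2_eq_one primes_coprime
        coprime_commute coprime_right_2_iff_odd)
  obtain k where k: "[k = nat (c mod int p)] (mod p)" "[k = 1] (mod 2 * q)"
    using binary_chinese_remainder_nat[OF cop] by blast
  have "q > 1" using q prime_gt_1_nat by auto
  then have k0: "k > 0" using k(2) by (cases "k = 0") (auto simp: cong_def)
  have odd: "odd k" and kq: "[k = 1] (mod q)"
    using k(2) cong_dvd_iff[of k 1 2] cong_modulus_mult_nat[of k 1 2 q]
      cong_modulus_mult_nat[of k 1 q 2] by (auto simp: mult.commute)
  have "coprime k (card A)"
  proof (rule ccontr)
    assume "\<not> coprime k (card A)"
    then obtain r where r: "prime r" "r dvd k" "r dvd card A"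
      by (metis coprime_def gcd_nat.bounded_iff is_unit_gcd not_coprimeE prime_factor_nat nat_dvd_1_iff_1 dvd_trans)
    have "r dvd 4 * p * q" using r(3) factorization_card[OF F] card_G by (metis dvd_mult2)
    then have "r dvd 2 \<or> r dvd p \<or> r dvd q"
      using r(1) prime_dvd_mult_iff[OF r(1)] by (metis numeral_Bit0 mult_2 mult_2_right numeral_times_numeral semiring_norm(12) semiring_norm(13))
    moreover have "\<not> r dvd 2" using r odd by (metis dvd_trans primes_dvd_imp_eq two_is_prime_nat)
    moreover have "\<not> r dvd p" using r np p primes_dvd_imp_eq by blast
    moreover have "\<not> r dvd q"
      using r q kq by (metis cong_dvd_iff nat_dvd_1_iff_1 not_prime_1 primes_dvd_imp_eq)
    ultimately show False by blast
  qed
  from factorization_power[OF finite_G F this k0]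
  have *: "inj_on (\<lambda>a. a [^] k) A" "factorization G ((\<lambda>a. a [^] k) ` A) B" by auto
  have "int k mod int p = c mod int p"
    using k(1) by (metis cong_def mod_mod_trivial nat_int of_nat_mod int_nat_eq p_pos(2) pos_mod_sign)
  moreover have "int k mod int q = 1 mod int q" using kq by (metis cong_def of_nat_1 of_nat_mod)
  ultimately have "g [^] k = scale c g" if "g \<in> carrier G" for g
    using that odd
    using mod_mult_cong[of "int k" "int p" c "P g" "P g"] mod_mult_cong[of "int k" "int q" 1 "Q g" "Q g"]
    by (intro coords_eq) (auto simp: P_pow V_pow Q_pow Q_mod)
  moreover have "A \<subseteq> carrier G" using F by (simp add: factorization_def)
  ultimately have "\<And>a. a \<in> A \<Longrightarrow> a [^] k = scale c a" by auto
  then show ?thesis using * by (simp cong: image_cong inj_on_cong)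
qed

text \<open>The equation \<open>c (P a - P a') = P b' - P b\<close> can be solved modulo \<open>p\<close> unless its left factor
vanishes and its right-hand side does not.\<close>

lemma scale_meet:
  assumes sub: "a \<in> carrier G" "a' \<in> carrier G" and P: "P a \<noteq> P a' \<or> P b = P b'"
  shows "\<exists>c. [c * P a + P b = c * P a' + P b'] (mod int p)"
proof -
  have "\<not> int p dvd P a - P a' \<or> P b' - P b = 0"
    using P by (metis P_mod mod_eq_dvd_iff sub(1) sub(2) diff_self)
  from cong_mult_solve[OF p(1) this] obtain c where "[c * (P a - P a') = P b' - P b] (mod int p)" .
  then have "[c * P a + P b = c * P a' + P b'] (mod int p)"
    by (simp add: cong_iff_dvd_diff algebra_simps)
  then show ?thesis by blast
qed

text \<open>With the multiplier of \<open>scale_meet\<close> the two sums become equal, and scaling keeps the factorization.\<close>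

lemma offset_P:
  assumes F: "factorization G A B" and np: "\<not> p dvd card A"
    and m: "a \<in> A" "a' \<in> A" "b \<in> B" "b' \<in> B"
    and Q: "[Q a + Q b = Q a' + Q b'] (mod int q)" and V: "V a + V b = V a' + V b'"
    and P: "P a \<noteq> P a' \<or> P b = P b'"
  shows "a = a' \<and> b = b'"
proof -
  have sub: "a \<in> carrier G" "a' \<in> carrier G" "b \<in> carrier G" "b' \<in> carrier G"
    using F m by (auto simp: factorization_def)
  obtain c where c: "[c * P a + P b = c * P a' + P b'] (mod int p)"
    using scale_meet[OF sub(1,2) P] by blast
  have *: "inj_on (scale c) A" "factorization G (scale c ` A) B"
    using factorization_scale[OF F np] by auto
  have "scale c a \<otimes> b = scale c a' \<otimes> b'"
    using sub Q V c
    by (intro coords_eq) (auto simp: P_mult Q_mult V_mult cong_def mod_add_left_eq)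
  then have "scale c a = scale c a' \<and> b = b'"
    by (intro factorization_unique[OF *(2)]) (use m in auto)
  then show ?thesis using inj_onD[OF *(1)] m by auto
qed

text \<open>This is the factorization that results from scaling by \<open>0\<close>.\<close>

lemma cover_P:
  assumes F: "factorization G A B" and np: "\<not> p dvd card A" and g: "g \<in> carrier G"
  obtains a b where "a \<in> A" "b \<in> B" "P b = P g" "Q g = (Q a + Q b) mod int q" "V g = V a + V b"
proof -
  have *: "factorization G (scale 0 ` A) B" using factorization_scale[OF F np] by auto
  obtain a b where ab: "a \<in> A" "b \<in> B" "g = scale 0 a \<otimes> b"
    using factorization_obtain[OF * g] by blast
  moreover have "a \<in> carrier G" "b \<in> carrier G" using ab F by (auto simp: factorization_def)
  ultimately show ?thesis by (intro that[of a b]) (auto simp: P_mult Q_mult V_mult P_mod)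
qed

end

context pq_group
begin

interpretation sw: pq_group G q p Q P V by (rule swap)

text \<open>Scaling is injective on \<open>A\<close>, so the scaled factor has the same order and its other odd coordinate can be
scaled next.\<close>

lemma offset_PQ:
  assumes F: "factorization G A B" and np: "\<not> p dvd card A" "\<not> q dvd card A"
    and m: "a \<in> A" "a' \<in> A" "b \<in> B" "b' \<in> B" and V: "V a + V b = V a' + V b'"
    and P: "P a \<noteq> P a' \<or> P b = P b'" and Q: "Q a \<noteq> Q a' \<or> Q b = Q b'"
  shows "a = a' \<and> b = b'"
proof -
  have sub: "a \<in> carrier G" "a' \<in> carrier G" "b \<in> carrier G" "b' \<in> carrier G"
    using F m by (auto simp: factorization_def)
  obtain c where c: "[c * P a + P b = c * P a' + P b'] (mod int p)"
    using scale_meet[OF sub(1,2) P] by blast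
  have *: "inj_on (scale c) A" "factorization G (scale c ` A) B"
    using factorization_scale[OF F np(1)] by auto
  have "card (scale c ` A) = card A" using *(1) by (rule card_image)
  then have "scale c a = scale c a' \<and> b = b'"
    using m sub V Q c np
    by (intro sw.offset_P[OF *(2)]) (auto simp: cong_def mod_add_left_eq)
  then show ?thesis using inj_onD[OF *(1)] m by auto
qed

lemma cover_PQ:
  assumes F: "factorization G A B" and np: "\<not> p dvd card A" "\<not> q dvd card A"
  obtains a b where "a \<in> A" "b \<in> B" "P b = x mod int p" "Q b = y mod int q" "V a + V b = v"
proof -
  have *: "inj_on (scale 0) A" "factorization G (scale 0 ` A) B"
    using factorization_scale[OF F np(1)] by auto
  have "card (scale 0 ` A) = card A" using *(1) by (rule card_image)
  then have "\<not> q dvd card (scale 0 ` A)" using np by simp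
  from sw.cover_P[OF *(2) this el_closed[of x y v]]
  obtain a' b where "a' \<in> scale 0 ` A" "b \<in> B" "Q b = Q (el x y v)"
     "P (el x y v) = (P a' + P b) mod int p" "V (el x y v) = V a' + V b" .
  then obtain a where ab: "a \<in> A" "b \<in> B" "Q b = Q (el x y v)"
     "P (el x y v) = (P (scale 0 a) + P b) mod int p" "V (el x y v) = V (scale 0 a) + V b"
    by auto
  moreover have "b \<in> carrier G" using ab F by (auto simp: factorization_def)
  ultimately show ?thesis by (intro that[of a b]) (auto simp: P_mod)
qed

text \<open>Here the two odd primes divide different factors, and each factor is scaled in the coordinate of
the prime that does not divide its order.\<close>

lemma offset_QP:
  assumes F: "factorization G A B" and np: "\<not> q dvd card A" "\<not> p dvd card B"
    and m: "a \<in> A" "a' \<in> A" "b \<in> B" "b' \<in> B" and V: "V a + V b = V a' + V b'"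
    and Q: "Q a \<noteq> Q a' \<or> Q b = Q b'" and P: "P b \<noteq> P b' \<or> P a = P a'"
  shows "a = a' \<and> b = b'"
proof -
  have sub: "a \<in> carrier G" "a' \<in> carrier G" "b \<in> carrier G" "b' \<in> carrier G"
    using F m by (auto simp: factorization_def)
  obtain c where "[c * P b + P a = c * P b' + P a'] (mod int p)"
    using scale_meet[OF sub(3,4) P] by blast
  then have c: "[P a + c * P b = P a' + c * P b'] (mod int p)" by (simp add: add.commute)
  have *: "inj_on (scale c) B" "factorization G A (scale c ` B)"
    using factorization_scale[OF factorization_commute[OF F] np(2)] factorization_commute by auto
  have "a = a' \<and> scale c b = scale c b'"
    using m sub V Q c np
    by (intro sw.offset_P[OF *(2)]) (auto simp: cong_def mod_add_right_eq)
  then show ?thesis using inj_onD[OF *(1)] m by auto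
qed

lemma cover_QP:
  assumes F: "factorization G A B" and np: "\<not> q dvd card A" "\<not> p dvd card B"
  obtains a b where "a \<in> A" "b \<in> B" "P a = x mod int p" "Q b = y mod int q" "V a + V b = v"
proof -
  have *: "factorization G A (scale 0 ` B)"
    using factorization_scale[OF factorization_commute[OF F] np(2)] factorization_commute by auto
  from sw.cover_P[OF * np(1) el_closed[of x y v]]
  obtain a b' where "a \<in> A" "b' \<in> scale 0 ` B" "Q b' = Q (el x y v)"
     "P (el x y v) = (P a + P b') mod int p" "V (el x y v) = V a + V b'" .
  then obtain b where ab: "a \<in> A" "b \<in> B" "Q (scale 0 b) = Q (el x y v)"
     "P (el x y v) = (P a + P (scale 0 b)) mod int p" "V (el x y v) = V a + V (scale 0 b)"
    by auto
  moreover have "a \<in> carrier G" "b \<in> carrier G" using ab F by (auto simp: factorization_def)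
  ultimately show ?thesis by (intro that[of a b]) (auto simp: P_mod)
qed

end

section \<open>Bases of the Klein four-group\<close>

definition basis :: "klein \<Rightarrow> klein \<Rightarrow> bool" where
  "basis e3 e4 \<longleftrightarrow> e3 \<noteq> 0 \<and> e4 \<noteq> 0 \<and> e3 \<noteq> e4"

definition mult2 :: "int \<Rightarrow> klein \<Rightarrow> klein" where
  "mult2 c e = (if even c then 0 else e)"

lemma mult2_0 [simp]: "mult2 0 e = 0" and mult2_1 [simp]: "mult2 1 e = e"
  by (auto simp: mult2_def)

lemma mult2_add: "mult2 (c + d) e = mult2 c e + mult2 d e"
  by (auto simp: mult2_def)

lemma basis_swap: "basis e3 e4 \<Longrightarrow> basis e4 e3"
  by (auto simp: basis_def)

lemma mult2_eq_iff:
  assumes "basis e3 e4"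
  shows "mult2 c e3 + mult2 d e4 = mult2 c' e3 + mult2 d' e4 \<longleftrightarrow> [c = c'] (mod 2) \<and> [d = d'] (mod 2)"
  using assms by (auto simp: mult2_def basis_def cong_iff_dvd_diff)

definition coord3 :: "klein \<Rightarrow> klein \<Rightarrow> klein \<Rightarrow> int" where
  "coord3 e3 e4 v = (if v = e3 \<or> v = e3 + e4 then 1 else 0)"

lemma basis_coords:
  assumes "basis e3 e4"
  shows "mult2 (coord3 e3 e4 v) e3 + mult2 (coord3 e4 e3 v) e4 = v"
  using assms klein_cases[of e3 e4 v] by (auto simp: basis_def coord3_def add.commute)

lemma coord3_0 [simp]: "basis e3 e4 \<Longrightarrow> coord3 e3 e4 0 = 0"
  using klein_add_eq_0[of e3 e4] by (auto simp: coord3_def basis_def)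

section \<open>Factorizations given by parameters\<close>

lemma cong_int_unique [simp]:
  "i < n \<Longrightarrow> j < n \<Longrightarrow> [int i = int j] (mod int n) \<longleftrightarrow> i = j"
  "i < 2 \<Longrightarrow> j < 2 \<Longrightarrow> [int i = int j] (mod 2) \<longleftrightarrow> i = j"
  using cong_int_iff[of i j n] cong_less_modulus_unique_nat[of i j n]
    cong_int_iff[of i j 2] cong_less_modulus_unique_nat[of i j 2] by auto

lemma factorization_image:
  fixes s :: "'i \<Rightarrow> 'a" and c :: "'j \<Rightarrow> 'a"
  assumes "group G" and fin: "finite (carrier G)"
    and s: "\<And>x. x \<in> X \<Longrightarrow> s x \<in> carrier G" and c: "\<And>y. y \<in> Y \<Longrightarrow> c y \<in> carrier G"
    and card: "card X * card Y = card (carrier G)"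
    and inj: "\<And>x x' y y'. x \<in> X \<Longrightarrow> x' \<in> X \<Longrightarrow> y \<in> Y \<Longrightarrow> y' \<in> Y \<Longrightarrow>
       s x \<otimes>\<^bsub>G\<^esub> c y = s x' \<otimes>\<^bsub>G\<^esub> c y' \<Longrightarrow> x = x' \<and> y = y'"
  shows "factorization G (s ` X) (c ` Y)"
proof -
  interpret group G by fact
  define m where "m = (\<lambda>(x, y). s x \<otimes>\<^bsub>G\<^esub> c y)"
  have injm: "inj_on m (X \<times> Y)"
  proof (rule inj_onI)
    fix z z' assume z: "z \<in> X \<times> Y" "z' \<in> X \<times> Y" "m z = m z'"
    obtain x y x' y' where "z = (x, y)" "z' = (x', y')" by (cases z; cases z')
    then show "z = z'" using z inj[of x x' y y'] by (simp add: m_def)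
  qed
  have sub: "m ` (X \<times> Y) \<subseteq> carrier G" using s c by (auto simp: m_def)
  have "card (m ` (X \<times> Y)) = card (carrier G)"
    using card_image[OF injm] card by (simp add: card_cartesian_product)
  then have im: "m ` (X \<times> Y) = carrier G" using card_subset_eq[OF fin sub] by simp
  have "bij_betw (\<lambda>(a, b). a \<otimes>\<^bsub>G\<^esub> b) (s ` X \<times> c ` Y) (carrier G)"
    unfolding bij_betw_def
  proof
    show "inj_on (\<lambda>(a, b). a \<otimes>\<^bsub>G\<^esub> b) (s ` X \<times> c ` Y)"
      using inj by (auto simp: inj_on_def)
    show "(\<lambda>(a, b). a \<otimes>\<^bsub>G\<^esub> b) ` (s ` X \<times> c ` Y) = carrier G"
      unfolding im[symmetric] by (force simp: m_def)
  qed
  then show ?thesis using s c by (auto simp: factorization_def)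
qed

text \<open>A factorization cannot be enlarged, so inclusions between two of them are equalities. In the
classification it is therefore enough to find the members of a normal form inside the given factors.\<close>

lemma (in pq_group) factorization_eqI:
  assumes F: "factorization G A B" and F': "factorization G A' B'" and "A' \<subseteq> A" "B' \<subseteq> B"
  shows "A = A' \<and> B = B'"
proof
  have fin: "finite A" "finite B"
    using F finite_G by (auto simp: factorization_def intro: finite_subset)
  obtain a0 b0 where ab: "a0 \<in> A'" "b0 \<in> B'" using factorization_obtain[OF F' one_closed] by metis
  show "A = A'"
  proof
    show "A \<subseteq> A'"
    proof
      fix a assume a: "a \<in> A"
      then have "a \<otimes> b0 \<in> carrier G" using F F' ab by (auto simp: factorization_def)
      then obtain a' b' where "a' \<in> A'" "b' \<in> B'" "a \<otimes> b0 = a' \<otimes> b'"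
        using factorization_obtain[OF F'] by metis
      then show "a \<in> A'" using factorization_unique[OF F a] assms ab by (metis subsetD)
    qed
  qed fact
  show "B = B'"
  proof
    show "B \<subseteq> B'"
    proof
      fix b assume b: "b \<in> B"
      then have "a0 \<otimes> b \<in> carrier G" using F F' ab by (auto simp: factorization_def)
      then obtain a' b' where "a' \<in> A'" "b' \<in> B'" "a0 \<otimes> b = a' \<otimes> b'"
        using factorization_obtain[OF F'] by metis
      then show "b \<in> B'" using factorization_unique[OF F _ _ b] assms ab by (metis subsetD)
    qed
  qed fact
qed

context pq_group
begin

definition lin :: "klein \<Rightarrow> klein \<Rightarrow> int \<Rightarrow> int \<Rightarrow> int \<Rightarrow> int \<Rightarrow> 'a" where
  "lin e3 e4 a b c d = el a b (mult2 c e3 + mult2 d e4)"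

lemma lin_mult: "lin e3 e4 a b c d \<otimes> lin e3 e4 a' b' c' d' = lin e3 e4 (a + a') (b + b') (c + c') (d + d')"
  by (simp add: lin_def el_mult mult2_add ac_simps)

lemma lin_eq_iff:
  assumes "basis e3 e4"
  shows "lin e3 e4 a b c d = lin e3 e4 a' b' c' d' \<longleftrightarrow>
    [a = a'] (mod int p) \<and> [b = b'] (mod int q) \<and> [c = c'] (mod 2) \<and> [d = d'] (mod 2)"
  using mult2_eq_iff[OF assms] by (auto simp: lin_def el_eq_iff)

lemma lin_closed [simp]: "lin e3 e4 a b c d \<in> carrier G"
  by (simp add: lin_def)

lemmas lin_eqs = lin_mult lin_eq_iff cong_add_lcancel cong_add_rcancel card_G

lemma factorization_22:
  assumes S: "S = {s i j | i j. i < a \<and> j < b}" and C: "C = {c i j | i j. i < m \<and> j < n}"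
    and "\<And>i j. s i j \<in> carrier G" "\<And>i j. c i j \<in> carrier G" "a * b * (m * n) = 4 * p * q"
    and "\<And>i j i' j' k l k' l'. i < a \<Longrightarrow> j < b \<Longrightarrow> i' < a \<Longrightarrow> j' < b \<Longrightarrow>
      k < m \<Longrightarrow> l < n \<Longrightarrow> k' < m \<Longrightarrow> l' < n \<Longrightarrow> s i j \<otimes> c k l = s i' j' \<otimes> c k' l' \<Longrightarrow>
      i = i' \<and> j = j' \<and> k = k' \<and> l = l'"
  shows "factorization G S C"
proof -
  have "factorization G ((\<lambda>(i, j). s i j) ` ({..<a} \<times> {..<b})) ((\<lambda>(i, j). c i j) ` ({..<m} \<times> {..<n}))"
  proof (rule factorization_image[OF is_group finite_G])
    fix x x' y y'
    assume "x \<in> {..<a} \<times> {..<b}" "x' \<in> {..<a} \<times> {..<b}" "y \<in> {..<m} \<times> {..<n}" "y' \<in> {..<m} \<times> {..<n}"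
      "(case x of (i, j) \<Rightarrow> s i j) \<otimes> (case y of (i, j) \<Rightarrow> c i j) =
       (case x' of (i, j) \<Rightarrow> s i j) \<otimes> (case y' of (i, j) \<Rightarrow> c i j)"
    then show "x = x' \<and> y = y'"
      using assms(6)[of "fst x" "snd x" "fst x'" "snd x'" "fst y" "snd y" "fst y'" "snd y'"]
      by (simp add: mem_Times_iff split_beta prod_eq_iff)
  qed (use assms(3-5) in \<open>simp_all add: card_cartesian_product card_G split_beta\<close>)
  moreover have "(\<lambda>(i, j). s i j) ` ({..<a} \<times> {..<b}) = S" "(\<lambda>(i, j). c i j) ` ({..<m} \<times> {..<n}) = C"
    unfolding S C by force+
  ultimately show ?thesis by simp
qed

lemma factorization_13:
  assumes S: "S = {s i | i. i < a}" and C: "C = {c i j k | i j k. i < l \<and> j < m \<and> k < n}"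
    and "\<And>i. s i \<in> carrier G" "\<And>i j k. c i j k \<in> carrier G" "a * (l * (m * n)) = 4 * p * q"
    and "\<And>i i' x y z x' y' z'. i < a \<Longrightarrow> i' < a \<Longrightarrow>
      x < l \<Longrightarrow> y < m \<Longrightarrow> z < n \<Longrightarrow> x' < l \<Longrightarrow> y' < m \<Longrightarrow> z' < n \<Longrightarrow> s i \<otimes> c x y z = s i' \<otimes> c x' y' z' \<Longrightarrow>
      i = i' \<and> x = x' \<and> y = y' \<and> z = z'"
  shows "factorization G S C"
proof -
  have "factorization G (s ` {..<a}) ((\<lambda>(i, j, k). c i j k) ` ({..<l} \<times> {..<m} \<times> {..<n}))"
  proof (rule factorization_image[OF is_group finite_G])
    fix x x' y y'
    assume "x \<in> {..<a}" "x' \<in> {..<a}" "y \<in> {..<l} \<times> {..<m} \<times> {..<n}" "y' \<in> {..<l} \<times> {..<m} \<times> {..<n}"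
      "s x \<otimes> (case y of (i, j, k) \<Rightarrow> c i j k) = s x' \<otimes> (case y' of (i, j, k) \<Rightarrow> c i j k)"
    then show "x = x' \<and> y = y'"
      using assms(6)[of x x' "fst y" "fst (snd y)" "snd (snd y)" "fst y'" "fst (snd y')" "snd (snd y')"]
      by (simp add: mem_Times_iff split_beta prod_eq_iff)
  qed (use assms(3-5) in \<open>simp_all add: card_cartesian_product card_G split_beta\<close>)
  moreover have "s ` {..<a} = S" "(\<lambda>(i, j, k). c i j k) ` ({..<l} \<times> {..<m} \<times> {..<n}) = C"
    unfolding S C by force+
  ultimately show ?thesis by simp
qed

lemma factorization_31:
  assumes S: "S = {s i j k | i j k. i < l \<and> j < m \<and> k < n}" and C: "C = {c i | i. i < a}"
    and "\<And>i. c i \<in> carrier G" "\<And>i j k. s i j k \<in> carrier G" "a * (l * (m * n)) = 4 * p * q"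
    and "\<And>i i' x y z x' y' z'. i < a \<Longrightarrow> i' < a \<Longrightarrow>
      x < l \<Longrightarrow> y < m \<Longrightarrow> z < n \<Longrightarrow> x' < l \<Longrightarrow> y' < m \<Longrightarrow> z' < n \<Longrightarrow> c i \<otimes> s x y z = c i' \<otimes> s x' y' z' \<Longrightarrow>
      i = i' \<and> x = x' \<and> y = y' \<and> z = z'"
  shows "factorization G S C"
  by (rule factorization_commute, rule factorization_13[OF C])
     (rule S, use assms(3-) in auto)

lemma factorization_31':
  assumes "S = {s i j k | i j k. i < l \<and> k < n \<and> j < m}" and "C = {c i | i. i < a}"
    and "\<And>i. c i \<in> carrier G" "\<And>i j k. s i j k \<in> carrier G" "a * (l * (m * n)) = 4 * p * q"
    and "\<And>i i' x y z x' y' z'. i < a \<Longrightarrow> i' < a \<Longrightarrow>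
      x < l \<Longrightarrow> y < m \<Longrightarrow> z < n \<Longrightarrow> x' < l \<Longrightarrow> y' < m \<Longrightarrow> z' < n \<Longrightarrow> c i \<otimes> s x y z = c i' \<otimes> s x' y' z' \<Longrightarrow>
      i = i' \<and> x = x' \<and> y = y' \<and> z = z'"
  shows "factorization G S C"
  by (rule factorization_31[of S s l m n, OF _ assms(2-)])
     (auto simp: assms(1))

section \<open>The normal forms\<close>

text \<open>The name of a normal form lists the four coordinates of prime order, with \<open>V\<close> for a coordinate
of order \<open>2\<close>. Blocks are separated by underscores and belong alternately to \<open>S\<close> and to \<open>C\<close>,
starting with \<open>S\<close>. The coordinates in its own blocks parametrize a factor freely; any other
coordinate is a function of the parameters in the factor's earlier blocks, and \<open>0\<close> if there are
none. So the blocks, read from left to right, give the order in which a sum \<open>s + c\<close> determines the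
parameters of \<open>s\<close> and of \<open>c\<close>.

Where one integer parameter occurs in two coordinates, these have coprime orders, so that the
parameter stands for an arbitrary pair of residues. Exchanging \<open>p\<close> and \<open>q\<close> gives the remaining forms.\<close>

definition tiling_q_pVV where
  "tiling_q_pVV e3 e4 \<alpha> \<beta> \<gamma> S C \<longleftrightarrow>
     S = {lin e3 e4 (\<alpha> i) (int i) (\<beta> i) (\<gamma> i) | i. i < q} \<and>
     C = {lin e3 e4 (int i) 0 (int j) (int k) | i j k. i < p \<and> j < 2 \<and> k < 2}"

definition tiling_q_VV_p where
  "tiling_q_VV_p e3 e4 \<alpha> \<beta> \<mu> S C \<longleftrightarrow>
     S = {lin e3 e4 (int j) (int i) (\<alpha> i) (\<beta> i) | i j. i < q \<and> j < p} \<and>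
     C = {lin e3 e4 (\<mu> i j) 0 (int i) (int j) | i j. i < 2 \<and> j < 2}"

definition tiling_q_V_p_V where
  "tiling_q_V_p_V e3 e4 \<alpha> \<beta> \<mu> S C \<longleftrightarrow>
     S = {lin e3 e4 (int j) (int i) (\<alpha> i j) (\<beta> i) | i j. i < q \<and> j < p} \<and>
     C = {lin e3 e4 (\<mu> i) 0 (int j) (int i) | i j. i < 2 \<and> j < 2}"

definition tiling_pq_VV where
  "tiling_pq_VV e3 e4 \<alpha> \<beta> S C \<longleftrightarrow>
     S = {lin e3 e4 (int i) (int j) (\<alpha> i j) (\<beta> i j) | i j. i < p \<and> j < q} \<and>
     C = {lin e3 e4 0 0 (int i) (int j) | i j. i < 2 \<and> j < 2}"

definition tiling_p_qV_V where
  "tiling_p_qV_V e3 e4 \<alpha> \<beta> \<mu> S C \<longleftrightarrow>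
     S = {lin e3 e4 (int i) (\<alpha> i) (int j) (\<beta> i) | i j. i < p \<and> j < 2} \<and>
     C = {lin e3 e4 0 (int i) (\<mu> i j) (int j) | i j. i < q \<and> j < 2}"

definition tiling_V_q_p_V where
  "tiling_V_q_p_V e3 e4 \<alpha> \<beta> \<mu> S C \<longleftrightarrow>
     S = {lin e3 e4 (int j) (\<alpha> i) (\<beta> i j) (int i) | i j. i < 2 \<and> j < p} \<and>
     C = {lin e3 e4 (\<mu> i) (int i) (int j) 0 | i j. i < q \<and> j < 2}"

definition tiling_p_q_V_V where
  "tiling_p_q_V_V e3 e4 \<alpha> \<beta> \<mu> S C \<longleftrightarrow>
     S = {lin e3 e4 (int i) (\<alpha> i) (\<beta> i j) (int j) | i j. i < p \<and> j < 2} \<and>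
     C = {lin e3 e4 0 (int i) (int j) (\<mu> i) | i j. i < q \<and> j < 2}"

definition tiling_p_V_V_q where
  "tiling_p_V_V_q e3 e4 \<alpha> \<beta> \<mu> S C \<longleftrightarrow>
     S = {lin e3 e4 (int i) (\<beta> i j) (int j) (\<alpha> i) | i j. i < p \<and> j < 2} \<and>
     C = {lin e3 e4 0 (int j) (\<mu> i) (int i) | i j. i < 2 \<and> j < q}"

definition tiling_pV_qV where
  "tiling_pV_qV e3 e4 \<alpha> S C \<longleftrightarrow>
     S = {lin e3 e4 (int i) (\<alpha> i j) (\<alpha> i j) (int j) | i j. i < p \<and> j < 2} \<and>
     C = {lin e3 e4 0 (int i) (int j) 0 | i j. i < q \<and> j < 2}"

definition tiling_V_pq_V where
  "tiling_V_pq_V e3 e4 \<alpha> \<beta> \<mu> S C \<longleftrightarrow>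
     S = {lin e3 e4 (\<alpha> i) (\<beta> i) (int j) (int i) | i j. i < 2 \<and> j < 2} \<and>
     C = {lin e3 e4 (int i) (int j) (\<mu> i j) 0 | i j. i < p \<and> j < q}"

definition tiling_V_q_V_p where
  "tiling_V_q_V_p e3 e4 \<alpha> \<beta> \<mu> S C \<longleftrightarrow>
     S = {lin e3 e4 (\<beta> i j) (\<alpha> i) (int j) (int i) | i j. i < 2 \<and> j < 2} \<and>
     C = {lin e3 e4 (int j) (int i) (\<mu> i) 0 | i j. i < q \<and> j < p}"

definition tiling_VV_pq where
  "tiling_VV_pq e3 e4 \<alpha> S C \<longleftrightarrow>
     S = {lin e3 e4 (\<alpha> i j) (\<alpha> i j) (int i) (int j) | i j. i < 2 \<and> j < 2} \<and>
     C = {lin e3 e4 (int i) (int j) 0 0 | i j. i < p \<and> j < q}"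

definition tiling_pq_V_V where
  "tiling_pq_V_V e3 e4 \<alpha> \<mu> S C \<longleftrightarrow>
     S = {lin e3 e4 (int i) (int j) (int k) (\<alpha> i j) | i j k. i < p \<and> j < q \<and> k < 2} \<and>
     C = {lin e3 e4 0 0 (\<mu> i) (int i) | i. i < 2}"

definition tiling_qV_V_p where
  "tiling_qV_V_p e3 e4 \<alpha> \<mu> S C \<longleftrightarrow>
     S = {lin e3 e4 (int k) (int i) (\<alpha> i j) (int j) | i j k. i < q \<and> j < 2 \<and> k < p} \<and>
     C = {lin e3 e4 (\<mu> i) 0 (int i) 0 | i. i < 2}"

definition tiling_q_V_pV where
  "tiling_q_V_pV e3 e4 \<alpha> \<mu> S C \<longleftrightarrow>
     S = {lin e3 e4 (int j) (int i) (int k) (\<alpha> i) | i j k. i < q \<and> j < p \<and> k < 2} \<and>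
     C = {lin e3 e4 (\<mu> i) 0 (\<mu> i) (int i) | i. i < 2}"

definition tiling_pqV_V where
  "tiling_pqV_V e3 e4 \<alpha> S C \<longleftrightarrow>
     S = {lin e3 e4 (int i) (int j) (\<alpha> i j k) (int k) | i j k. i < p \<and> j < q \<and> k < 2} \<and>
     C = {lin e3 e4 0 0 (int i) 0 | i. i < 2}"

definition tiling_pV_q_V where
  "tiling_pV_q_V e3 e4 \<alpha> \<mu> S C \<longleftrightarrow>
     S = {lin e3 e4 (int i) (\<alpha> i j) (int k) (int j) | i j k. i < p \<and> j < 2 \<and> k < 2} \<and>
     C = {lin e3 e4 0 (int i) (\<mu> i) 0 | i. i < q}"

definition tiling_VV_q_p where
  "tiling_VV_q_p e3 e4 \<alpha> \<mu> S C \<longleftrightarrow>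
     S = {lin e3 e4 (int k) (\<alpha> i j) (int i) (int j) | i j k. i < 2 \<and> j < 2 \<and> k < p} \<and>
     C = {lin e3 e4 (\<mu> i) (int i) 0 0 | i. i < q}"

definition tiling_p_q_VV where
  "tiling_p_q_VV e3 e4 \<alpha> \<mu> \<nu> S C \<longleftrightarrow>
     S = {lin e3 e4 (int i) (\<alpha> i) (int j) (int k) | i j k. i < p \<and> j < 2 \<and> k < 2} \<and>
     C = {lin e3 e4 0 (int i) (\<mu> i) (\<nu> i) | i. i < q}"

definition tiling_V_q_pV where
  "tiling_V_q_pV e3 e4 \<alpha> \<mu> S C \<longleftrightarrow>
     S = {lin e3 e4 (int j) (\<alpha> i) (int k) (int i) | i j k. i < 2 \<and> k < 2 \<and> j < p} \<and>
     C = {lin e3 e4 (\<mu> i) (int i) (\<mu> i) 0 | i. i < q}"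

definition tiling_pVV_q where
  "tiling_pVV_q e3 e4 \<alpha> S C \<longleftrightarrow>
     S = {lin e3 e4 (int i) (\<alpha> i j k) (int j) (int k) | i j k. i < p \<and> j < 2 \<and> k < 2} \<and>
     C = {lin e3 e4 0 (int i) 0 0 | i. i < q}"

text \<open>In all these proofs the simplifier compares the coordinates of two equal sums. Each comparison that
involves only known parameters identifies a new one and thereby makes the next comparison solvable.\<close>

lemma factorization_q_pVV:
  "basis e3 e4 \<Longrightarrow> tiling_q_pVV e3 e4 \<alpha> \<beta> \<gamma> S C \<Longrightarrow> factorization G S C"
  unfolding tiling_q_pVV_def
  by (erule conjE, rule factorization_13, assumption, assumption) (auto simp: lin_eqs)

lemma factorization_q_VV_p:
  "basis e3 e4 \<Longrightarrow> tiling_q_VV_p e3 e4 \<alpha> \<beta> \<mu> S C \<Longrightarrow> factorization G S C"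
  unfolding tiling_q_VV_p_def
  by (erule conjE, rule factorization_22, assumption, assumption) (auto simp: lin_eqs)

lemma factorization_q_V_p_V:
  "basis e3 e4 \<Longrightarrow> tiling_q_V_p_V e3 e4 \<alpha> \<beta> \<mu> S C \<Longrightarrow> factorization G S C"
  unfolding tiling_q_V_p_V_def
  by (erule conjE, rule factorization_22, assumption, assumption) (auto simp: lin_eqs)

lemma factorization_pq_VV:
  "basis e3 e4 \<Longrightarrow> tiling_pq_VV e3 e4 \<alpha> \<beta> S C \<Longrightarrow> factorization G S C"
  unfolding tiling_pq_VV_def
  by (erule conjE, rule factorization_22, assumption, assumption) (auto simp: lin_eqs)

lemma factorization_p_qV_V:
  "basis e3 e4 \<Longrightarrow> tiling_p_qV_V e3 e4 \<alpha> \<beta> \<mu> S C \<Longrightarrow> factorization G S C"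
  unfolding tiling_p_qV_V_def
  by (erule conjE, rule factorization_22, assumption, assumption) (auto simp: lin_eqs)

lemma factorization_V_q_p_V:
  "basis e3 e4 \<Longrightarrow> tiling_V_q_p_V e3 e4 \<alpha> \<beta> \<mu> S C \<Longrightarrow> factorization G S C"
  unfolding tiling_V_q_p_V_def
  by (erule conjE, rule factorization_22, assumption, assumption) (auto simp: lin_eqs)

lemma factorization_p_q_V_V:
  "basis e3 e4 \<Longrightarrow> tiling_p_q_V_V e3 e4 \<alpha> \<beta> \<mu> S C \<Longrightarrow> factorization G S C"
  unfolding tiling_p_q_V_V_def
  by (erule conjE, rule factorization_22, assumption, assumption) (auto simp: lin_eqs)

lemma factorization_p_V_V_q:
  "basis e3 e4 \<Longrightarrow> tiling_p_V_V_q e3 e4 \<alpha> \<beta> \<mu> S C \<Longrightarrow> factorization G S C"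
  unfolding tiling_p_V_V_q_def
  by (erule conjE, rule factorization_22, assumption, assumption) (auto simp: lin_eqs)

lemma factorization_pV_qV:
  "basis e3 e4 \<Longrightarrow> tiling_pV_qV e3 e4 \<alpha> S C \<Longrightarrow> factorization G S C"
  unfolding tiling_pV_qV_def
  by (erule conjE, rule factorization_22, assumption, assumption) (auto simp: lin_eqs)

lemma factorization_V_pq_V:
  "basis e3 e4 \<Longrightarrow> tiling_V_pq_V e3 e4 \<alpha> \<beta> \<mu> S C \<Longrightarrow> factorization G S C"
  unfolding tiling_V_pq_V_def
  by (erule conjE, rule factorization_22, assumption, assumption) (auto simp: lin_eqs)

lemma factorization_V_q_V_p:
  "basis e3 e4 \<Longrightarrow> tiling_V_q_V_p e3 e4 \<alpha> \<beta> \<mu> S C \<Longrightarrow> factorization G S C"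
  unfolding tiling_V_q_V_p_def
  by (erule conjE, rule factorization_22, assumption, assumption) (auto simp: lin_eqs)

lemma factorization_VV_pq:
  "basis e3 e4 \<Longrightarrow> tiling_VV_pq e3 e4 \<alpha> S C \<Longrightarrow> factorization G S C"
  unfolding tiling_VV_pq_def
  by (erule conjE, rule factorization_22, assumption, assumption) (auto simp: lin_eqs)

lemma factorization_pq_V_V:
  "basis e3 e4 \<Longrightarrow> tiling_pq_V_V e3 e4 \<alpha> \<mu> S C \<Longrightarrow> factorization G S C"
  unfolding tiling_pq_V_V_def
  by (erule conjE, rule factorization_31, assumption, assumption) (auto simp: lin_eqs)

lemma factorization_qV_V_p:
  "basis e3 e4 \<Longrightarrow> tiling_qV_V_p e3 e4 \<alpha> \<mu> S C \<Longrightarrow> factorization G S C"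
  unfolding tiling_qV_V_p_def
  by (erule conjE, rule factorization_31, assumption, assumption) (auto simp: lin_eqs)

lemma factorization_q_V_pV:
  "basis e3 e4 \<Longrightarrow> tiling_q_V_pV e3 e4 \<alpha> \<mu> S C \<Longrightarrow> factorization G S C"
  unfolding tiling_q_V_pV_def
  by (erule conjE, rule factorization_31, assumption, assumption) (auto simp: lin_eqs)

lemma factorization_pqV_V:
  "basis e3 e4 \<Longrightarrow> tiling_pqV_V e3 e4 \<alpha> S C \<Longrightarrow> factorization G S C"
  unfolding tiling_pqV_V_def
  by (erule conjE, rule factorization_31, assumption, assumption) (auto simp: lin_eqs)

lemma factorization_pV_q_V:
  "basis e3 e4 \<Longrightarrow> tiling_pV_q_V e3 e4 \<alpha> \<mu> S C \<Longrightarrow> factorization G S C"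
  unfolding tiling_pV_q_V_def
  by (erule conjE, rule factorization_31, assumption, assumption) (auto simp: lin_eqs)

lemma factorization_VV_q_p:
  "basis e3 e4 \<Longrightarrow> tiling_VV_q_p e3 e4 \<alpha> \<mu> S C \<Longrightarrow> factorization G S C"
  unfolding tiling_VV_q_p_def
  by (erule conjE, rule factorization_31, assumption, assumption) (auto simp: lin_eqs)

lemma factorization_p_q_VV:
  "basis e3 e4 \<Longrightarrow> tiling_p_q_VV e3 e4 \<alpha> \<mu> \<nu> S C \<Longrightarrow> factorization G S C"
  unfolding tiling_p_q_VV_def
  by (erule conjE, rule factorization_31, assumption, assumption) (auto simp: lin_eqs)

lemma factorization_V_q_pV:
  "basis e3 e4 \<Longrightarrow> tiling_V_q_pV e3 e4 \<alpha> \<mu> S C \<Longrightarrow> factorization G S C"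
  unfolding tiling_V_q_pV_def
  by (erule conjE, rule factorization_31', assumption, assumption) (auto simp: lin_eqs)

lemma factorization_pVV_q:
  "basis e3 e4 \<Longrightarrow> tiling_pVV_q e3 e4 \<alpha> S C \<Longrightarrow> factorization G S C"
  unfolding tiling_pVV_q_def
  by (erule conjE, rule factorization_31, assumption, assumption) (auto simp: lin_eqs)

lemma tiling_transfer:
  assumes F: "factorization G S C" and R: "\<And>S C. R S C \<Longrightarrow> factorization G S C"
    and R': "R S' C'" and sub: "S' \<subseteq> S" "C' \<subseteq> C"
  shows "R S C"
  using factorization_eqI[OF F R[OF R'] sub] R' by simp

lemma tiling_q_pVVI:
  assumes "factorization G S C" "basis e3 e4"
    and "\<And>i. lin e3 e4 (\<alpha> i) (int i) (\<beta> i) (\<gamma> i) \<in> S"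
    and "\<And>i j k. lin e3 e4 (int i) 0 (int j) (int k) \<in> C"
  shows "tiling_q_pVV e3 e4 \<alpha> \<beta> \<gamma> S C"
  by (rule tiling_transfer[where R = "tiling_q_pVV e3 e4 \<alpha> \<beta> \<gamma>",
        OF assms(1) factorization_q_pVV[OF assms(2)]], assumption,
      unfold tiling_q_pVV_def, rule conjI[OF refl refl]) (use assms(3,4) in blast)+

lemma tiling_q_VV_pI:
  assumes "factorization G S C" "basis e3 e4"
    and "\<And>i j. lin e3 e4 (int j) (int i) (\<alpha> i) (\<beta> i) \<in> S"
    and "\<And>i j. lin e3 e4 (\<mu> i j) 0 (int i) (int j) \<in> C"
  shows "tiling_q_VV_p e3 e4 \<alpha> \<beta> \<mu> S C"
  by (rule tiling_transfer[where R = "tiling_q_VV_p e3 e4 \<alpha> \<beta> \<mu>",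
        OF assms(1) factorization_q_VV_p[OF assms(2)]], assumption,
      unfold tiling_q_VV_p_def, rule conjI[OF refl refl]) (use assms(3,4) in blast)+

lemma tiling_q_V_p_VI:
  assumes "factorization G S C" "basis e3 e4"
    and "\<And>i j. lin e3 e4 (int j) (int i) (\<alpha> i j) (\<beta> i) \<in> S"
    and "\<And>i j. lin e3 e4 (\<mu> i) 0 (int j) (int i) \<in> C"
  shows "tiling_q_V_p_V e3 e4 \<alpha> \<beta> \<mu> S C"
  by (rule tiling_transfer[where R = "tiling_q_V_p_V e3 e4 \<alpha> \<beta> \<mu>",
        OF assms(1) factorization_q_V_p_V[OF assms(2)]], assumption,
      unfold tiling_q_V_p_V_def, rule conjI[OF refl refl]) (use assms(3,4) in blast)+

lemma tiling_pq_VVI: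
  assumes "factorization G S C" "basis e3 e4"
    and "\<And>i j. lin e3 e4 (int i) (int j) (\<alpha> i j) (\<beta> i j) \<in> S"
    and "\<And>i j. lin e3 e4 0 0 (int i) (int j) \<in> C"
  shows "tiling_pq_VV e3 e4 \<alpha> \<beta> S C"
  by (rule tiling_transfer[where R = "tiling_pq_VV e3 e4 \<alpha> \<beta>",
        OF assms(1) factorization_pq_VV[OF assms(2)]], assumption,
      unfold tiling_pq_VV_def, rule conjI[OF refl refl]) (use assms(3,4) in blast)+

lemma tiling_p_qV_VI:
  assumes "factorization G S C" "basis e3 e4"
    and "\<And>i j. lin e3 e4 (int i) (\<alpha> i) (int j) (\<beta> i) \<in> S"
    and "\<And>i j. lin e3 e4 0 (int i) (\<mu> i j) (int j) \<in> C"
  shows "tiling_p_qV_V e3 e4 \<alpha> \<beta> \<mu> S C"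
  by (rule tiling_transfer[where R = "tiling_p_qV_V e3 e4 \<alpha> \<beta> \<mu>",
        OF assms(1) factorization_p_qV_V[OF assms(2)]], assumption,
      unfold tiling_p_qV_V_def, rule conjI[OF refl refl]) (use assms(3,4) in blast)+

lemma tiling_V_q_p_VI:
  assumes "factorization G S C" "basis e3 e4"
    and "\<And>i j. lin e3 e4 (int j) (\<alpha> i) (\<beta> i j) (int i) \<in> S"
    and "\<And>i j. lin e3 e4 (\<mu> i) (int i) (int j) 0 \<in> C"
  shows "tiling_V_q_p_V e3 e4 \<alpha> \<beta> \<mu> S C"
  by (rule tiling_transfer[where R = "tiling_V_q_p_V e3 e4 \<alpha> \<beta> \<mu>",
        OF assms(1) factorization_V_q_p_V[OF assms(2)]], assumption,
      unfold tiling_V_q_p_V_def, rule conjI[OF refl refl]) (use assms(3,4) in blast)+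

lemma tiling_p_q_V_VI:
  assumes "factorization G S C" "basis e3 e4"
    and "\<And>i j. lin e3 e4 (int i) (\<alpha> i) (\<beta> i j) (int j) \<in> S"
    and "\<And>i j. lin e3 e4 0 (int i) (int j) (\<mu> i) \<in> C"
  shows "tiling_p_q_V_V e3 e4 \<alpha> \<beta> \<mu> S C"
  by (rule tiling_transfer[where R = "tiling_p_q_V_V e3 e4 \<alpha> \<beta> \<mu>",
        OF assms(1) factorization_p_q_V_V[OF assms(2)]], assumption,
      unfold tiling_p_q_V_V_def, rule conjI[OF refl refl]) (use assms(3,4) in blast)+

lemma tiling_pV_qVI:
  assumes "factorization G S C" "basis e3 e4"
    and "\<And>i j. lin e3 e4 (int i) (\<alpha> i j) (\<alpha> i j) (int j) \<in> S"
    and "\<And>i j. lin e3 e4 0 (int i) (int j) 0 \<in> C"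
  shows "tiling_pV_qV e3 e4 \<alpha> S C"
  by (rule tiling_transfer[where R = "tiling_pV_qV e3 e4 \<alpha>",
        OF assms(1) factorization_pV_qV[OF assms(2)]], assumption,
      unfold tiling_pV_qV_def, rule conjI[OF refl refl]) (use assms(3,4) in blast)+

lemma tiling_V_pq_VI:
  assumes "factorization G S C" "basis e3 e4"
    and "\<And>i j. lin e3 e4 (\<alpha> i) (\<beta> i) (int j) (int i) \<in> S"
    and "\<And>i j. lin e3 e4 (int i) (int j) (\<mu> i j) 0 \<in> C"
  shows "tiling_V_pq_V e3 e4 \<alpha> \<beta> \<mu> S C"
  by (rule tiling_transfer[where R = "tiling_V_pq_V e3 e4 \<alpha> \<beta> \<mu>",
        OF assms(1) factorization_V_pq_V[OF assms(2)]], assumption,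
      unfold tiling_V_pq_V_def, rule conjI[OF refl refl]) (use assms(3,4) in blast)+

lemma tiling_V_q_V_pI:
  assumes "factorization G S C" "basis e3 e4"
    and "\<And>i j. lin e3 e4 (\<beta> i j) (\<alpha> i) (int j) (int i) \<in> S"
    and "\<And>i j. lin e3 e4 (int j) (int i) (\<mu> i) 0 \<in> C"
  shows "tiling_V_q_V_p e3 e4 \<alpha> \<beta> \<mu> S C"
  by (rule tiling_transfer[where R = "tiling_V_q_V_p e3 e4 \<alpha> \<beta> \<mu>",
        OF assms(1) factorization_V_q_V_p[OF assms(2)]], assumption,
      unfold tiling_V_q_V_p_def, rule conjI[OF refl refl]) (use assms(3,4) in blast)+

lemma tiling_VV_pqI:
  assumes "factorization G S C" "basis e3 e4"
    and "\<And>i j. lin e3 e4 (\<alpha> i j) (\<alpha> i j) (int i) (int j) \<in> S"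
    and "\<And>i j. lin e3 e4 (int i) (int j) 0 0 \<in> C"
  shows "tiling_VV_pq e3 e4 \<alpha> S C"
  by (rule tiling_transfer[where R = "tiling_VV_pq e3 e4 \<alpha>",
        OF assms(1) factorization_VV_pq[OF assms(2)]], assumption,
      unfold tiling_VV_pq_def, rule conjI[OF refl refl]) (use assms(3,4) in blast)+

lemma tiling_qV_V_pI:
  assumes "factorization G S C" "basis e3 e4"
    and "\<And>i j k. lin e3 e4 (int k) (int i) (\<alpha> i j) (int j) \<in> S"
    and "\<And>i. lin e3 e4 (\<mu> i) 0 (int i) 0 \<in> C"
  shows "tiling_qV_V_p e3 e4 \<alpha> \<mu> S C"
  by (rule tiling_transfer[where R = "tiling_qV_V_p e3 e4 \<alpha> \<mu>",
        OF assms(1) factorization_qV_V_p[OF assms(2)]], assumption,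
      unfold tiling_qV_V_p_def, rule conjI[OF refl refl]) (use assms(3,4) in blast)+

lemma tiling_pqV_VI:
  assumes "factorization G S C" "basis e3 e4"
    and "\<And>i j k. lin e3 e4 (int i) (int j) (\<alpha> i j k) (int k) \<in> S"
    and "\<And>i. lin e3 e4 0 0 (int i) 0 \<in> C"
  shows "tiling_pqV_V e3 e4 \<alpha> S C"
  by (rule tiling_transfer[where R = "tiling_pqV_V e3 e4 \<alpha>",
        OF assms(1) factorization_pqV_V[OF assms(2)]], assumption,
      unfold tiling_pqV_V_def, rule conjI[OF refl refl]) (use assms(3,4) in blast)+

lemma tiling_pV_q_VI:
  assumes "factorization G S C" "basis e3 e4"
    and "\<And>i j k. lin e3 e4 (int i) (\<alpha> i j) (int k) (int j) \<in> S"
    and "\<And>i. lin e3 e4 0 (int i) (\<mu> i) 0 \<in> C"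
  shows "tiling_pV_q_V e3 e4 \<alpha> \<mu> S C"
  by (rule tiling_transfer[where R = "tiling_pV_q_V e3 e4 \<alpha> \<mu>",
        OF assms(1) factorization_pV_q_V[OF assms(2)]], assumption,
      unfold tiling_pV_q_V_def, rule conjI[OF refl refl]) (use assms(3,4) in blast)+

lemma tiling_VV_q_pI:
  assumes "factorization G S C" "basis e3 e4"
    and "\<And>i j k. lin e3 e4 (int k) (\<alpha> i j) (int i) (int j) \<in> S"
    and "\<And>i. lin e3 e4 (\<mu> i) (int i) 0 0 \<in> C"
  shows "tiling_VV_q_p e3 e4 \<alpha> \<mu> S C"
  by (rule tiling_transfer[where R = "tiling_VV_q_p e3 e4 \<alpha> \<mu>",
        OF assms(1) factorization_VV_q_p[OF assms(2)]], assumption,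
      unfold tiling_VV_q_p_def, rule conjI[OF refl refl]) (use assms(3,4) in blast)+

lemma tiling_p_q_VVI:
  assumes "factorization G S C" "basis e3 e4"
    and "\<And>i j k. lin e3 e4 (int i) (\<alpha> i) (int j) (int k) \<in> S"
    and "\<And>i. lin e3 e4 0 (int i) (\<mu> i) (\<nu> i) \<in> C"
  shows "tiling_p_q_VV e3 e4 \<alpha> \<mu> \<nu> S C"
  by (rule tiling_transfer[where R = "tiling_p_q_VV e3 e4 \<alpha> \<mu> \<nu>",
        OF assms(1) factorization_p_q_VV[OF assms(2)]], assumption,
      unfold tiling_p_q_VV_def, rule conjI[OF refl refl]) (use assms(3,4) in blast)+

lemma tiling_V_q_pVI:
  assumes "factorization G S C" "basis e3 e4"
    and "\<And>i j k. lin e3 e4 (int j) (\<alpha> i) (int k) (int i) \<in> S"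
    and "\<And>i. lin e3 e4 (\<mu> i) (int i) (\<mu> i) 0 \<in> C"
  shows "tiling_V_q_pV e3 e4 \<alpha> \<mu> S C"
  by (rule tiling_transfer[where R = "tiling_V_q_pV e3 e4 \<alpha> \<mu>",
        OF assms(1) factorization_V_q_pV[OF assms(2)]], assumption,
      unfold tiling_V_q_pV_def, rule conjI[OF refl refl]) (use assms(3,4) in blast)+

lemma tiling_pVV_qI:
  assumes "factorization G S C" "basis e3 e4"
    and "\<And>i j k. lin e3 e4 (int i) (\<alpha> i j k) (int j) (int k) \<in> S"
    and "\<And>i. lin e3 e4 0 (int i) 0 0 \<in> C"
  shows "tiling_pVV_q e3 e4 \<alpha> S C"
  by (rule tiling_transfer[where R = "tiling_pVV_q e3 e4 \<alpha>",
        OF assms(1) factorization_pVV_q[OF assms(2)]], assumption,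
      unfold tiling_pVV_q_def, rule conjI[OF refl refl]) (use assms(3,4) in blast)+

end

lemma basis_std: "basis (1, 0) (0, 1)"
  by (auto simp: basis_def zero_prod_def)

lemma basis_extend: "w \<noteq> 0 \<Longrightarrow> \<exists>w'. basis w w'"
  using klein_basis_ex[of w] by (auto simp: basis_def)

lemma coord3_line:
  assumes "basis e3 e4" "v = 0 \<or> v = e3"
  shows "mult2 (coord3 e3 e4 v) e3 = v"
  using assms by (auto simp: coord3_def basis_def)

lemma klein_subset_cases:
  fixes W :: "klein set"
  obtains "W \<subseteq> {0}" | w where "w \<noteq> 0" "w \<in> W" "W \<subseteq> {0, w}"
    | w w' where "w \<in> W" "w' \<in> W" "basis w w'"
  unfolding basis_def by blast

lemma invariant_mult2:
  assumes "\<And>v :: klein. f (v + e) = f v" shows "f (v + mult2 k e) = f v"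
  using assms by (simp add: mult2_def)

lemma klein_invariant_const:
  assumes "basis w w'" and "\<And>v. f (v + w) = f v" "\<And>v. f (v + w') = f v"
  shows "f v = f (0 :: klein)"
proof -
  have "v = 0 \<or> v = w \<or> v = w' \<or> v = w + w'"
    using klein_cases[of w w' v] assms(1) by (auto simp: basis_def)
  moreover have "f w = f 0" "f w' = f 0" using assms(2,3)[of 0] by simp_all
  moreover have "f (w + w') = f w" using assms(3) .
  ultimately show ?thesis by auto
qed

section \<open>A factor of prime order\<close>

context pq_group
begin

text \<open>What remains of generating the group: the set is contained neither in the kernel of an odd
coordinate nor in the preimage of a subgroup \<open>{0, w}\<close> of the Klein four-group.\<close>

definition spans :: "'a set \<Rightarrow> bool" where
  "spans S \<longleftrightarrow> (\<exists>a\<in>S. P a \<noteq> 0) \<and> (\<exists>a\<in>S. Q a \<noteq> 0) \<and> (\<forall>w. \<exists>a\<in>S. V a \<noteq> 0 \<and> V a \<noteq> w)"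

interpretation sw: pq_group G q p Q P V by (rule swap)

text \<open>As \<open>q\<close> does not divide \<open>card B\<close>, the \<open>\<int>\<^sub>q\<close>-coordinates of \<open>B\<close> can be scaled. Scaling by \<open>0\<close> shows that
\<open>A\<close> projects bijectively to \<open>\<int>\<^sub>q\<close> and \<open>B\<close> to the other coordinates, so \<open>B\<close> is the graph of some \<open>f\<close>.
For \<open>a \<in> A\<close> let \<open>b\<close> and \<open>b'\<close> be the points of \<open>B\<close> over \<open>(x, v)\<close> and over its shift by \<open>a\<close>. The sums
\<open>b + a\<close> and \<open>b' + 0\<close> would collide after scaling unless \<open>f\<close> takes the same value at both places. So \<open>f\<close> is invariant under the shift by \<open>a\<close>; since the
orders \<open>p\<close> and \<open>2\<close> of its two components are coprime, it is invariant under each of them.\<close>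

lemma prime_cofactor:
  assumes F: "factorization G A B" and A: "card A = q" and one: "\<one> \<in> A" "\<one> \<in> B"
  obtains f u w where
    "\<And>x v. el x (f x v) v \<in> B" "f 0 0 = 0" "\<And>b. b \<in> B \<Longrightarrow> Q b = f (P b) (V b)"
    "\<And>i. el (u i) i (w i) \<in> A" "u 0 = 0" "w 0 = 0" "\<And>a. a \<in> A \<Longrightarrow> u (Q a) = P a \<and> w (Q a) = V a"
    "\<And>a x v. a \<in> A \<Longrightarrow> f x (v + V a) = f x v"
    "\<And>a x x' v. a \<in> A \<Longrightarrow> P a \<noteq> 0 \<Longrightarrow> f x v = f x' v"
proof -
  have AG: "A \<subseteq> carrier G" and BG: "B \<subseteq> carrier G" using F by (auto simp: factorization_def)
  have "card B = 4 * p" using factorization_card[OF F] card_G A q_pos by auto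
  moreover have "\<not> q dvd 4 * p"
  proof
    assume "q dvd 4 * p"
    then have "q dvd 2 * 2 \<or> q dvd p" using prime_dvd_multD[OF q(1), of 4 p] by simp
    then have "q dvd 2 \<or> q dvd p" using prime_dvd_multD[OF q(1), of 2 2] by auto
    then show False using q p pq by (metis primes_dvd_imp_eq two_is_prime_nat dvd_refl)
  qed
  ultimately have nq: "\<not> q dvd card B" by simp
  note F' = factorization_commute[OF F]
  note offs = sw.offset_P[OF F' nq]
  have ex_a: "\<exists>a\<in>A. Q a = i mod int q" for i
    using sw.cover_P[OF F' nq el_closed[of 0 i 0]] by (metis Q_el)
  have "Q ` A = {0..<int q}"
  proof
    show "Q ` A \<subseteq> {0..<int q}" using Q_range AG by auto
    show "{0..<int q} \<subseteq> Q ` A"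
    proof
      fix i assume "i \<in> {0..<int q}"
      then show "i \<in> Q ` A" using ex_a[of i] by auto
    qed
  qed
  then have injQ: "inj_on Q A"
    using A q_pos by (intro eq_card_imp_inj_on card_ge_0_finite) auto
  have ex_b: "\<exists>b\<in>B. P b = x mod int p \<and> V b = v" for x v
  proof -
    obtain b a where ba: "b \<in> B" "a \<in> A" "Q a = Q (el x 0 v)"
      "P (el x 0 v) = (P b + P a) mod int p" "V (el x 0 v) = V b + V a"
      using sw.cover_P[OF F' nq el_closed[of x 0 v]] by metis
    have "a = \<one>" using inj_onD[OF injQ, of a \<one>] ba one by simp
    then show ?thesis using ba BG by (intro bexI[of _ b]) (simp_all add: P_mod subset_iff)
  qed
  define \<beta> where "\<beta> x v = (SOME b. b \<in> B \<and> P b = x mod int p \<and> V b = v)" for x v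
  have \<beta>: "\<beta> x v \<in> B" "P (\<beta> x v) = x mod int p" "V (\<beta> x v) = v" for x v
    using someI_ex[of "\<lambda>b. b \<in> B \<and> P b = x mod int p \<and> V b = v"] ex_b[of x v]
    unfolding \<beta>_def by auto
  have \<beta>G: "\<beta> x v \<in> carrier G" for x v using \<beta>(1) BG by blast
  define f where "f x v = Q (\<beta> x v)" for x v
  have per: "f x v = f x' v" if "[x = x'] (mod int p)" for x x' v
    using that by (simp add: f_def \<beta>_def cong_def)
  have inv0: "f (x + P a) (v + V a) = f x v" if a: "a \<in> A" for a x v
  proof (rule ccontr)
    assume ne: "f (x + P a) (v + V a) \<noteq> f x v"
    have "\<beta> x v = \<beta> (x + P a) (v + V a) \<and> a = \<one>"
    proof (rule offs[OF \<beta>(1) \<beta>(1) a one(1)])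
      show "[P (\<beta> x v) + P a = P (\<beta> (x + P a) (v + V a)) + P \<one>] (mod int p)"
        by (simp add: \<beta> cong_def mod_add_left_eq)
      show "Q (\<beta> x v) \<noteq> Q (\<beta> (x + P a) (v + V a)) \<or> Q a = Q \<one>" using ne by (simp add: f_def)
    qed (simp add: \<beta>)
    then have "f x v = f (x + P a) (v + V a)" unfolding f_def by (rule arg_cong[OF conjunct1])
    then show False using ne[symmetric] by contradiction
  qed
  \<comment> \<open>at \<open>n = p\<close> the \<open>\<int>\<^sub>p\<close>-component of the shift disappears and its \<open>V\<close>-component stays, as \<open>p\<close> is odd\<close>
  have invn: "f (x + int n * P a) (v + (if even n then 0 else V a)) = f x v" if a: "a \<in> A" for a x v n
  proof (induction n)
    case (Suc n)
    have "f (x + int n * P a + P a) (v + (if even n then 0 else V a) + V a)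
        = f (x + int n * P a) (v + (if even n then 0 else V a))" by (rule inv0[OF a])
    then show ?case using Suc by (auto simp: algebra_simps split: if_splits)
  qed simp
  have invV: "f x (v + V a) = f x v" if a: "a \<in> A" for a x v
    using invn[OF a, of x p v] per[of "x + int p * P a" x] p(2) by (simp add: cong_iff_dvd_diff)
  have invP: "f x v = f x' v" if a: "a \<in> A" "P a \<noteq> 0" for a x x' v
  proof -
    have one: "f (x + P a) v = f x v" for x using inv0[OF a(1), of x v] invV[OF a(1)] by simp
    have many: "f (x + int n * P a) v = f x v" for n
      by (induction n) (use one[of "x + int _ * P a"] in \<open>auto simp: algebra_simps\<close>)
    have "\<not> int p dvd P a"
      using a AG by (metis P_mod dvd_imp_mod_0 subsetD)
    then obtain c where c: "[c * P a = x' - x] (mod int p)"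
      using cong_mult_solve[OF p(1)] by blast
    define n where "n = nat (c mod int p)"
    have "[int n * P a = c * P a] (mod int p)"
      by (simp add: n_def cong_def mod_mult_left_eq)
    then have "[int n * P a = x' - x] (mod int p)" using c cong_trans by blast
    then have "[x + int n * P a = x'] (mod int p)"
      by (simp add: cong_iff_dvd_diff algebra_simps)
    from per[OF this, of v] show ?thesis using many[of n] by simp
  qed
  define \<alpha> where "\<alpha> i = (SOME a. a \<in> A \<and> Q a = i mod int q)" for i
  have \<alpha>: "\<alpha> i \<in> A" "Q (\<alpha> i) = i mod int q" for i
    using someI_ex[of "\<lambda>a. a \<in> A \<and> Q a = i mod int q"] ex_a[of i]
    unfolding \<alpha>_def by auto
  have \<alpha>Q: "\<alpha> (Q a) = a" if "a \<in> A" for a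
    using inj_onD[OF injQ, of "\<alpha> (Q a)" a] \<alpha>[of "Q a"] that AG by (auto simp: Q_mod)
  have \<alpha>0: "\<alpha> 0 = \<one>" using \<alpha>Q[OF one(1)] by simp
  have f_eq: "Q b = f (P b) (V b)" if b: "b \<in> B" for b
  proof -
    have bG: "b \<in> carrier G" using b BG by auto
    have "b = \<beta> (P b) (V b)"
      using offs[of b "\<beta> (P b) (V b)" \<one> \<one>] \<beta>[of "P b" "V b"] b one bG by (auto simp: P_mod)
    then show ?thesis by (simp add: f_def)
  qed
  show ?thesis
  proof (rule that[of f "\<lambda>i. P (\<alpha> i)" "\<lambda>i. V (\<alpha> i)"])
    show "el x (f x v) v \<in> B" for x v
      using el_eqI[of "\<beta> x v" x "f x v" v] \<beta>[of x v] \<beta>G[of x v] by (simp add: f_def Q_mod)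
    show "f 0 0 = 0" using f_eq[OF one(2)] by simp
    show "el (P (\<alpha> i)) i (V (\<alpha> i)) \<in> A" for i
      using el_eqI[of "\<alpha> i" "P (\<alpha> i)" i "V (\<alpha> i)"] \<alpha>[of i] AG by (auto simp: P_mod)
    show "Q b = f (P b) (V b)" if "b \<in> B" for b using f_eq[OF that] .
    show "P (\<alpha> 0) = 0" "V (\<alpha> 0) = 0" using \<alpha>0 by simp_all
    show "P (\<alpha> (Q a)) = P a \<and> V (\<alpha> (Q a)) = V a" if "a \<in> A" for a using \<alpha>Q[OF that] by simp
    show "f x (v + V a) = f x v" if "a \<in> A" for a x v using invV[OF that] .
    show "f x v = f x' v" if "a \<in> A" "P a \<noteq> 0" for a x x' v using invP[OF that] .
  qed
qed

text \<open>Since \<open>S\<close> spans, the function of \<open>prime_cofactor\<close> is invariant in all directions and hence zero.\<close>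

lemma tilings_card_S_q:
  assumes F: "factorization G S C" and card: "card S = q" and one: "\<one> \<in> S" "\<one> \<in> C" and S: "spans S"
  shows "\<exists>e3 e4 \<alpha> \<beta> \<gamma>. basis e3 e4 \<and> \<alpha> 0 = 0 \<and> \<beta> 0 = 0 \<and> \<gamma> 0 = 0 \<and> tiling_q_pVV e3 e4 \<alpha> \<beta> \<gamma> S C"
proof -
  obtain f u w where f: "\<And>x v. el x (f x v) v \<in> C" "f 0 0 = 0" "\<And>b. b \<in> C \<Longrightarrow> Q b = f (P b) (V b)"
    and uw: "\<And>i. el (u i) i (w i) \<in> S" "u 0 = 0" "w 0 = 0"
      "\<And>a. a \<in> S \<Longrightarrow> u (Q a) = P a \<and> w (Q a) = V a"
    and inv: "\<And>a x v. a \<in> S \<Longrightarrow> f x (v + V a) = f x v"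
    and invP: "\<And>a x x' v. a \<in> S \<Longrightarrow> P a \<noteq> 0 \<Longrightarrow> f x v = f x' v"
    by (rule prime_cofactor[OF F card one], rule that; assumption)
  obtain a1 a2 where a: "a1 \<in> S" "a2 \<in> S" and b: "basis (V a1) (V a2)"
    using S unfolding spans_def basis_def by metis
  have f0: "f x v = 0" for x v
  proof -
    have "f x v = f 0 v" using S invP unfolding spans_def by metis
    also have "\<dots> = f 0 0" by (rule klein_invariant_const[OF b]) (use inv a in auto)
    finally show ?thesis using f by simp
  qed
  define e3 e4 where "e3 = V a1" "e4 = V a2"
  define \<alpha> where "\<alpha> i = u (int i)" for i :: nat
  define \<beta> where "\<beta> i = coord3 e3 e4 (w (int i))" for i :: nat
  define \<gamma> where "\<gamma> i = coord3 e4 e3 (w (int i))" for i :: nat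
  note b' = b [folded e3_e4_def]
  have "tiling_q_pVV e3 e4 \<alpha> \<beta> \<gamma> S C"
  proof (rule tiling_q_pVVI[OF F b'])
    show "lin e3 e4 (\<alpha> i) (int i) (\<beta> i) (\<gamma> i) \<in> S" for i
      using uw(1)[of "int i"] by (simp add: lin_def \<alpha>_def \<beta>_def \<gamma>_def basis_coords[OF b'])
    show "lin e3 e4 (int i) 0 (int j) (int k) \<in> C" for i j k
      using f(1)[of "int i" "mult2 (int j) e3 + mult2 (int k) e4"] by (simp add: lin_def f0)
  qed
  moreover have "\<alpha> 0 = 0" "\<beta> 0 = 0" "\<gamma> 0 = 0"
    using uw b' basis_swap[OF b'] by (simp_all add: \<alpha>_def \<beta>_def \<gamma>_def)
  ultimately show ?thesis using b' by blast
qed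

text \<open>Two questions decide which form occurs: whether \<open>C\<close> has a nonzero \<open>\<int>\<^sub>p\<close>-coordinate, and whether the
\<open>V\<close>-coordinates of \<open>C\<close> span \<open>0\<close>, a line or the whole Klein group. If \<open>C\<close> moves in
the \<open>\<int>\<^sub>p\<close>-direction and in the whole Klein group, the function vanishes and \<open>S\<close> does not span.\<close>

lemma tilings_card_C_q:
  assumes F: "factorization G S C" and card: "card C = q" and one: "\<one> \<in> S" "\<one> \<in> C" and S: "spans S"
  shows "(\<exists>e3 e4 \<alpha>. basis e3 e4 \<and> \<alpha> 0 0 0 = 0 \<and> tiling_pVV_q e3 e4 \<alpha> S C) \<or>
    (\<exists>e3 e4 \<alpha> \<mu>. basis e3 e4 \<and> \<alpha> 0 0 = 0 \<and> \<mu> 0 = 0 \<and> tiling_pV_q_V e3 e4 \<alpha> \<mu> S C) \<or>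
    (\<exists>e3 e4 \<alpha> \<mu> \<nu>. basis e3 e4 \<and> \<alpha> 0 = 0 \<and> \<mu> 0 = 0 \<and> \<nu> 0 = 0 \<and> tiling_p_q_VV e3 e4 \<alpha> \<mu> \<nu> S C) \<or>
    (\<exists>e3 e4 \<alpha> \<mu>. basis e3 e4 \<and> \<alpha> 0 0 = 0 \<and> \<mu> 0 = 0 \<and> tiling_VV_q_p e3 e4 \<alpha> \<mu> S C) \<or>
    (\<exists>e3 e4 \<alpha> \<mu>. basis e3 e4 \<and> \<alpha> 0 = 0 \<and> \<mu> 0 = 0 \<and> tiling_V_q_pV e3 e4 \<alpha> \<mu> S C)"
proof -
  obtain f u w where f: "\<And>x v. el x (f x v) v \<in> S" "f 0 0 = 0" "\<And>b. b \<in> S \<Longrightarrow> Q b = f (P b) (V b)"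
    and uw: "\<And>i. el (u i) i (w i) \<in> C" "u 0 = 0" "w 0 = 0"
      "\<And>a. a \<in> C \<Longrightarrow> u (Q a) = P a \<and> w (Q a) = V a"
    and inv: "\<And>a x v. a \<in> C \<Longrightarrow> f x (v + V a) = f x v"
    and invP: "\<And>a x x' v. a \<in> C \<Longrightarrow> P a \<noteq> 0 \<Longrightarrow> f x v = f x' v"
    by (rule prime_cofactor[OF factorization_commute[OF F] card one(2,1)], rule that; assumption)
  have wV: "w i \<in> V ` C" for i using uw(1)[of i] by (metis V_el image_eqI)
  note b0 = basis_std
  show ?thesis
  proof (cases "\<exists>a\<in>C. P a \<noteq> 0")
    case False
    then have u0: "[u i = 0] (mod int p)" for i using uw(1)[of i] by (metis P_el cong_0_iff dvd_eq_mod_eq_0)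
    then have uw0: "el 0 i (w i) \<in> C" for i using uw(1)[of i] el_eq_iff by (metis cong_refl)
    show ?thesis
    proof (rule klein_subset_cases[of "V ` C"])
      assume "V ` C \<subseteq> {0}"
      then have w0: "w i = 0" for i using wV by blast
      define \<alpha> where "\<alpha> i j k = f (int i) (mult2 (int j) (1, 0) + mult2 (int k) (0, 1))" for i j k :: nat
      have "tiling_pVV_q (1, 0) (0, 1) \<alpha> S C"
      proof (rule tiling_pVV_qI[OF F b0])
        show "lin (1, 0) (0, 1) (int i) (\<alpha> i j k) (int j) (int k) \<in> S" for i j k
          unfolding lin_def \<alpha>_def by (rule f(1))
        show "lin (1, 0) (0, 1) 0 (int i) 0 0 \<in> C" for i
          using uw0[of "int i"] by (simp add: lin_def w0)
      qed
      moreover have "\<alpha> 0 0 0 = 0" using f by (simp add: \<alpha>_def)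
      ultimately show ?thesis using b0 by blast
    next
      fix e3 assume e3: "e3 \<noteq> 0" "e3 \<in> V ` C" "V ` C \<subseteq> {0, e3}"
      obtain e4 where b: "basis e3 e4" using basis_extend[OF e3(1)] by blast
      have i3: "f x (v + mult2 k e3) = f x v" for x v k
        by (rule invariant_mult2) (use e3 inv in auto)
      have w3: "mult2 (coord3 e3 e4 (w i)) e3 = w i" for i
        using coord3_line[OF b] wV e3 by blast
      define \<alpha> where "\<alpha> i j = f (int i) (mult2 (int j) e4)" for i j :: nat
      define \<mu> where "\<mu> i = coord3 e3 e4 (w (int i))" for i :: nat
      have "tiling_pV_q_V e3 e4 \<alpha> \<mu> S C"
      proof (rule tiling_pV_q_VI[OF F b])
        show "lin e3 e4 (int i) (\<alpha> i j) (int k) (int j) \<in> S" for i j k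
          using f(1)[of "int i" "mult2 (int j) e4 + mult2 (int k) e3"] by (simp add: lin_def \<alpha>_def i3 add.commute)
        show "lin e3 e4 0 (int i) (\<mu> i) 0 \<in> C" for i
          using uw0[of "int i"] by (simp add: lin_def \<mu>_def w3)
      qed
      moreover have "\<alpha> 0 0 = 0" "\<mu> 0 = 0" using f uw b by (simp_all add: \<alpha>_def \<mu>_def)
      ultimately show ?thesis using b by blast
    next
      fix e3 e4 assume e: "e3 \<in> V ` C" "e4 \<in> V ` C" and b: "basis e3 e4"
      have fV: "f x v = f x 0" for x v
        by (rule klein_invariant_const[OF b]) (use e inv in auto)
      define \<alpha> where "\<alpha> i = f (int i) 0" for i :: nat
      define \<mu> where "\<mu> i = coord3 e3 e4 (w (int i))" for i :: nat
      define \<nu> where "\<nu> i = coord3 e4 e3 (w (int i))" for i :: nat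
      have "tiling_p_q_VV e3 e4 \<alpha> \<mu> \<nu> S C"
      proof (rule tiling_p_q_VVI[OF F b])
        show "lin e3 e4 (int i) (\<alpha> i) (int j) (int k) \<in> S" for i j k
          using f(1)[of "int i" "mult2 (int j) e3 + mult2 (int k) e4"]
            fV[of "int i" "mult2 (int j) e3 + mult2 (int k) e4"] by (simp add: lin_def \<alpha>_def)
        show "lin e3 e4 0 (int i) (\<mu> i) (\<nu> i) \<in> C" for i
          using uw0[of "int i"] by (simp add: lin_def \<mu>_def \<nu>_def basis_coords[OF b])
      qed
      moreover have "\<alpha> 0 = 0" "\<mu> 0 = 0" "\<nu> 0 = 0"
        using f uw b basis_swap[OF b] by (simp_all add: \<alpha>_def \<mu>_def \<nu>_def)
      ultimately show ?thesis using b by blast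
    qed
  next
    case True
    then have fP: "f x v = f 0 v" for x v using invP by metis
    show ?thesis
    proof (rule klein_subset_cases[of "V ` C"])
      assume "V ` C \<subseteq> {0}"
      then have w0: "w i = 0" for i using wV by blast
      define \<alpha> where "\<alpha> i j = f 0 (mult2 (int i) (1, 0) + mult2 (int j) (0, 1))" for i j :: nat
      define \<mu> where "\<mu> i = u (int i)" for i :: nat
      have "tiling_VV_q_p (1, 0) (0, 1) \<alpha> \<mu> S C"
      proof (rule tiling_VV_q_pI[OF F b0])
        show "lin (1, 0) (0, 1) (int k) (\<alpha> i j) (int i) (int j) \<in> S" for i j k
          using f(1)[of "int k"] unfolding lin_def \<alpha>_def fP[of "int k"] by blast
        show "lin (1, 0) (0, 1) (\<mu> i) (int i) 0 0 \<in> C" for i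
          using uw(1)[of "int i"] by (simp add: lin_def \<mu>_def w0)
      qed
      moreover have "\<alpha> 0 0 = 0" "\<mu> 0 = 0" using f uw by (simp_all add: \<alpha>_def \<mu>_def)
      ultimately show ?thesis using b0 by blast
    next
      fix e3 assume e3: "e3 \<noteq> 0" "e3 \<in> V ` C" "V ` C \<subseteq> {0, e3}"
      obtain e4 where b: "basis e3 e4" using basis_extend[OF e3(1)] by blast
      have i3: "f x (v + mult2 k e3) = f x v" for x v k
        by (rule invariant_mult2) (use e3 inv in auto)
      define \<alpha> where "\<alpha> i = f 0 (mult2 (int i) e4)" for i :: nat
      define c where "c i = coord3 e3 e4 (w (int i))" for i
      \<comment> \<open>as \<open>p\<close> is odd, this is \<open>u\<close> modulo \<open>p\<close> and \<open>c\<close> modulo \<open>2\<close>, and it is \<open>0\<close> if both are\<close>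
      define \<mu> where "\<mu> i = u (int i) + int p * (u (int i) + c i)" for i
      have "mult2 (c i) e3 = w (int i)" for i
        unfolding c_def using coord3_line[OF b] wV e3 by blast
      moreover have "mult2 (\<mu> i) e3 = mult2 (c i) e3" for i
        using p by (auto simp: \<mu>_def mult2_def)
      moreover have "[\<mu> i = u (int i)] (mod int p)" for i by (simp add: \<mu>_def cong_iff_dvd_diff)
      ultimately have lin\<mu>: "lin e3 e4 (\<mu> i) (int i) (\<mu> i) 0 = el (u (int i)) (int i) (w (int i))" for i
        by (simp add: lin_def el_eq_iff)
      have "tiling_V_q_pV e3 e4 \<alpha> \<mu> S C"
      proof (rule tiling_V_q_pVI[OF F b])
        show "lin e3 e4 (int j) (\<alpha> i) (int k) (int i) \<in> S" for i j k
          using f(1)[of "int j" "mult2 (int i) e4 + mult2 (int k) e3"] fP[of "int j"]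
          by (simp add: lin_def \<alpha>_def i3 add.commute)
        show "lin e3 e4 (\<mu> i) (int i) (\<mu> i) 0 \<in> C" for i
          unfolding lin\<mu> by (rule uw(1))
      qed
      moreover have "\<alpha> 0 = 0" "\<mu> 0 = 0" using f uw b by (simp_all add: \<alpha>_def \<mu>_def c_def)
      ultimately show ?thesis using b by blast
    next
      fix e3 e4 assume e: "e3 \<in> V ` C" "e4 \<in> V ` C" and b: "basis e3 e4"
      have "f x v = 0" for x v
        using klein_invariant_const[OF b, of "f 0" v] inv e f fP[of x v] by auto
      then show ?thesis using S f(3) unfolding spans_def by metis
    qed
  qed
qed

end

section \<open>A factor of order four\<close>

lemma coord3_add_other: "basis e3 e4 \<Longrightarrow> coord3 e4 e3 (v + e3) = coord3 e4 e3 v"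
  using klein_cases[of e3 e4 v] by (auto simp: coord3_def basis_def add.commute add.assoc)

lemma klein_sandwich:
  fixes u w a b :: klein
  assumes "a = 0 \<or> a = w" "b = 0 \<or> b = w"
  shows "a + u + b = u \<or> a + u + b = w + u"
  using assms by (elim disjE) (simp_all add: ac_simps)

text \<open>A nonconstant function on the Klein group has at most one nonzero period. So all nonzero differences
of \<open>f\<close> in the first variable are one element \<open>w\<close>, and all those in the second variable are one element \<open>w'\<close>. If
both kinds occur with \<open>w \<noteq> w'\<close>, some difference of \<open>f\<close> is \<open>w + w'\<close>; then \<open>g\<close>, which has period \<open>w\<close>, takes
equal values at \<open>0\<close> and \<open>w'\<close>, or \<open>h\<close> does so at \<open>0\<close> and \<open>w\<close>, and is constant after all.\<close>

lemma graph_rigidity: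
  fixes f :: "'x \<Rightarrow> 'y \<Rightarrow> klein" and g :: "klein \<Rightarrow> 'b" and h :: "klein \<Rightarrow> 'c"
  assumes f0: "f x0 y0 = 0"
    and sx: "\<And>x x' y v. f x y \<noteq> f x' y \<Longrightarrow> g (v + (f x y + f x' y)) = g v"
    and sy: "\<And>x y y' v. f x y \<noteq> f x y' \<Longrightarrow> h (v + (f x y + f x y')) = h v"
    and sxy: "\<And>x y x' y' v. f x y \<noteq> f x' y' \<Longrightarrow>
      g (v + (f x y + f x' y')) = g v \<or> h (v + (f x y + f x' y')) = h v"
    and g: "\<exists>v. g v \<noteq> g 0" and h: "\<exists>v. h v \<noteq> h 0"
  shows "(\<forall>x y. f x y = 0) \<or>
    (\<exists>w. w \<noteq> 0 \<and> (\<forall>x y. f x y = 0 \<or> f x y = w) \<and>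
      ((\<forall>v. g (v + w) = g v) \<and> (\<forall>v. h (v + w) = h v) \<or>
       (\<forall>x y. f x y = f x0 y) \<and> (\<forall>v. h (v + w) = h v) \<or>
       (\<forall>x y. f x y = f x y0) \<and> (\<forall>v. g (v + w) = g v)))"
proof -
  have ug: "w = w'" if "\<And>v. g (v + w) = g v" "\<And>v. g (v + w') = g v" "w \<noteq> 0" "w' \<noteq> 0" for w w'
    using klein_invariant_const[of w w' g] that g unfolding basis_def by metis
  have uh: "w = w'" if "\<And>v. h (v + w) = h v" "\<And>v. h (v + w') = h v" "w \<noteq> 0" "w' \<noteq> 0" for w w'
    using klein_invariant_const[of w w' h] that h unfolding basis_def by metis
  have col: "f x y + f x' y = 0 \<or> f x y + f x' y = w" if "\<And>v. g (v + w) = g v" "w \<noteq> 0" for x x' y w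
    using ug[of w "f x y + f x' y"] that sx[of x y x'] klein_add_eq_0 by metis
  have row: "f x y + f x y' = 0 \<or> f x y + f x y' = w" if "\<And>v. h (v + w) = h v" "w \<noteq> 0" for x y y' w
    using uh[of w "f x y + f x y'"] that sy[of x y y'] klein_add_eq_0 by metis
  show ?thesis
  proof (cases "\<exists>x x' y. f x y \<noteq> f x' y")
    case False
    then have fx: "f x y = f x0 y" for x y by metis
    show ?thesis
    proof (cases "\<exists>x y y'. f x y \<noteq> f x y'")
      case False
      then show ?thesis using fx f0 by metis
    next
      case True
      then obtain x1 y1 y2 where ne: "f x1 y1 \<noteq> f x1 y2" by blast
      define w where "w = f x1 y1 + f x1 y2"
      have w: "w \<noteq> 0" "\<And>v. h (v + w) = h v" using ne sy by (auto simp: w_def)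
      have "f x y = 0 \<or> f x y = w" for x y
        using row[OF w(2,1), of x0 y y0] f0 fx[of x y] by simp
      then show ?thesis using w fx by blast
    qed
  next
    case True
    then obtain x1 x2 y1 where ne: "f x1 y1 \<noteq> f x2 y1" by blast
    define w where "w = f x1 y1 + f x2 y1"
    have w: "w \<noteq> 0" "\<And>v. g (v + w) = g v" using ne sx by (auto simp: w_def)
    show ?thesis
    proof (cases "\<exists>x y y'. f x y \<noteq> f x y'")
      case False
      then have fy: "f x y = f x y0" for x y by metis
      have "f x y = 0 \<or> f x y = w" for x y
        using col[OF w(2,1), of x y0 x0] f0 fy[of x y] by simp
      then show ?thesis using w fy by blast
    next
      case True
      then obtain x3 y3 y4 where ne': "f x3 y3 \<noteq> f x3 y4" by blast
      define w' where "w' = f x3 y3 + f x3 y4"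
      have w': "w' \<noteq> 0" "\<And>v. h (v + w') = h v" using ne' sy by (auto simp: w'_def)
      show ?thesis
      proof (cases "w = w'")
        case True
        have "f x y = 0 \<or> f x y = w" for x y
        proof -
          have "f x y + f x0 y = 0 \<or> f x y + f x0 y = w" using col[OF w(2,1)] .
          moreover have "f x0 y = 0 \<or> f x0 y = w" using row[OF w'(2,1), of x0 y y0] f0 True by simp
          moreover have "f x y = (f x y + f x0 y) + f x0 y" by (simp add: add.assoc)
          ultimately show ?thesis by (metis add.right_neutral klein_self add.left_neutral)
        qed
        then show ?thesis using w w' True by blast
      next
        case False
        define d where "d = f x1 y3 + f x2 y4"
        \<comment> \<open>column differences do not leave the coset of \<open>{0, w}\<close>, and the middle step is \<open>w'\<close>\<close>
        have "d = (f x1 y3 + f x3 y3) + w' + (f x3 y4 + f x2 y4)"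
          by (simp add: d_def w'_def add.assoc)
        then have 1: "d = w' \<or> d = w + w'"
          using klein_sandwich[OF col[OF w(2,1), of x1 y3 x3] col[OF w(2,1), of x3 y4 x2], of w'] by simp
        \<comment> \<open>row differences do not leave the coset of \<open>{0, w'}\<close>, and the middle step is \<open>w\<close>\<close>
        have "d = (f x1 y3 + f x1 y1) + w + (f x2 y1 + f x2 y4)"
          by (simp add: d_def w_def add.assoc)
        then have 2: "d = w \<or> d = w + w'"
          using klein_sandwich[OF row[OF w'(2,1), of x1 y3 y1] row[OF w'(2,1), of x2 y1 y4], of w]
          by (simp add: add.commute)
        have d: "d = w + w'" using 1 2 False by blast
        have b: "basis w w'" using w w' False by (simp add: basis_def)
        have "f x1 y3 \<noteq> f x2 y4" using d False klein_add_eq_0 unfolding d_def by metis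
        from sxy[OF this, of 0] have "g (0 + d) = g 0 \<or> h (0 + d) = h 0"
          unfolding d_def .
        moreover have "g (0 + d) = g w'" using w(2)[of w'] d by (simp add: add.commute)
        moreover have "h (0 + d) = h w" using w'(2)[of w] d by simp
        ultimately have "g w' = g 0 \<or> h w = h 0" by simp
        then show ?thesis
        proof
          assume "g w' = g 0"
          then have "g v = g 0" for v
            using klein_cases[of w w' v] w(1) w'(1) False w(2)[of 0] w(2)[of w'] \<open>g w' = g 0\<close>
            by (metis add.commute add.left_neutral)
          then show ?thesis using g by blast
        next
          assume "h w = h 0"
          then have "h v = h 0" for v
            using klein_cases[of w w' v] w(1) w'(1) False w'(2)[of 0] w'(2)[of w] \<open>h w = h 0\<close>
            by (metis add.left_neutral)
          then show ?thesis using h by blast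
        qed
      qed
    qed
  qed
qed

context pq_group
begin

interpretation sw: pq_group G q p Q P V by (rule swap)

lemma not_dvd_pow2: "\<not> p dvd 2" "\<not> p dvd 4" "\<not> q dvd 2" "\<not> q dvd 4"
proof -
  have "\<not> r dvd 2 \<and> \<not> r dvd 4" if "prime r" "odd r" for r :: nat
  proof -
    have "\<not> r dvd 2" using that by (metis primes_dvd_imp_eq two_is_prime_nat dvd_refl)
    moreover have "r dvd 2 * 2 \<Longrightarrow> r dvd 2" using prime_dvd_multD[OF that(1), of 2 2] by auto
    ultimately show ?thesis by auto
  qed
  then show "\<not> p dvd 2" "\<not> p dvd 4" "\<not> q dvd 2" "\<not> q dvd 4" using p q by auto
qed

text \<open>Both odd coordinates of \<open>A\<close> can be scaled, even to \<open>0\<close>, so \<open>A\<close> projects bijectively to the Klein group and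
\<open>B\<close> to the odd coordinates. The periods are \<open>offset_PQ\<close> applied to two elements of \<open>B\<close> and to the elements
of \<open>A\<close> over \<open>v\<close> and \<open>v + w\<close>, where \<open>w\<close> is the difference of the values of \<open>f\<close>.\<close>

lemma cofactor_card_4:
  assumes F: "factorization G A B" and A: "card A = 4" and one: "\<one> \<in> A" "\<one> \<in> B"
  obtains f g h where
    "\<And>v. el (g v) (h v) v \<in> A" "g 0 = 0" "h 0 = 0" "\<And>a. a \<in> A \<Longrightarrow> g (V a) = P a \<and> h (V a) = Q a"
    "\<And>x y. el x y (f x y) \<in> B" "f 0 0 = 0" "\<And>b. b \<in> B \<Longrightarrow> V b = f (P b) (Q b)"
    "\<And>x x' y v. f x y \<noteq> f x' y \<Longrightarrow> g (v + (f x y + f x' y)) = g v"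
    "\<And>x y y' v. f x y \<noteq> f x y' \<Longrightarrow> h (v + (f x y + f x y')) = h v"
    "\<And>x y x' y' v. f x y \<noteq> f x' y' \<Longrightarrow>
      g (v + (f x y + f x' y')) = g v \<or> h (v + (f x y + f x' y')) = h v"
proof -
  have AG: "A \<subseteq> carrier G" and BG: "B \<subseteq> carrier G" using F by (auto simp: factorization_def)
  have np: "\<not> p dvd card A" "\<not> q dvd card A" using A not_dvd_pow2 by auto
  note offs = offset_PQ[OF F np]
  have injV: "inj_on V A"
    by (rule inj_onI) (use offs[OF _ _ one(2) one(2)] in simp)
  have VA: "V ` A = UNIV"
    by (rule card_subset_eq) (simp_all add: card_image[OF injV] A card_klein)
  define \<alpha> where "\<alpha> v = (SOME a. a \<in> A \<and> V a = v)" for v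
  have \<alpha>: "\<alpha> v \<in> A" "V (\<alpha> v) = v" for v
  proof -
    have "\<exists>a. a \<in> A \<and> V a = v" using VA by (metis UNIV_I imageE)
    from someI_ex[OF this] show "\<alpha> v \<in> A" "V (\<alpha> v) = v" by (simp_all only: \<alpha>_def)
  qed
  have \<alpha>V: "\<alpha> (V a) = a" if "a \<in> A" for a
    by (rule inj_onD[OF injV \<alpha>(2) \<alpha>(1) that])
  have \<alpha>0: "\<alpha> 0 = \<one>" using \<alpha>V[OF one(1)] by simp
  have \<alpha>G: "\<alpha> v \<in> carrier G" for v using \<alpha>(1) AG by blast
  have ex_b: "\<exists>b\<in>B. P b = x mod int p \<and> Q b = y mod int q" for x y
    using cover_PQ[OF F np] by metis
  define \<beta> where "\<beta> x y = (SOME b. b \<in> B \<and> P b = x mod int p \<and> Q b = y mod int q)" for x y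
  have \<beta>: "\<beta> x y \<in> B" "P (\<beta> x y) = x mod int p" "Q (\<beta> x y) = y mod int q" for x y
  proof -
    have "\<exists>b. b \<in> B \<and> P b = x mod int p \<and> Q b = y mod int q" using ex_b[of x y] by blast
    from someI_ex[OF this] show "\<beta> x y \<in> B" "P (\<beta> x y) = x mod int p" "Q (\<beta> x y) = y mod int q"
      by (simp_all only: \<beta>_def)
  qed
  have \<beta>G: "\<beta> x y \<in> carrier G" for x y using \<beta>(1) BG by blast
  have \<beta>b: "\<beta> (P b) (Q b) = b" if b: "b \<in> B" for b
  proof -
    have bG: "b \<in> carrier G" using b BG by auto
    have "\<alpha> (V b) = \<alpha> (V (\<beta> (P b) (Q b))) \<and> \<beta> (P b) (Q b) = b"
      by (rule offs[OF \<alpha>(1) \<alpha>(1) \<beta>(1) b]) (simp_all add: \<alpha> \<beta> P_mod[OF bG] Q_mod[OF bG] add.commute)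
    then show ?thesis by simp
  qed
  define f where "f x y = V (\<beta> x y)" for x y
  define g where "g v = P (\<alpha> v)" for v
  define h where "h v = Q (\<alpha> v)" for v
  have sep: False
    if "f x y \<noteq> f x' y'" and "g v \<noteq> g (v + (f x y + f x' y')) \<or> x = x'"
      and "h v \<noteq> h (v + (f x y + f x' y')) \<or> y = y'" for x y x' y' v
  proof -
    let ?w = "f x y + f x' y'"
    have "\<alpha> v = \<alpha> (v + ?w) \<and> \<beta> x y = \<beta> x' y'"
    proof (rule offs[OF \<alpha>(1) \<alpha>(1) \<beta>(1) \<beta>(1)])
      show "V (\<alpha> v) + V (\<beta> x y) = V (\<alpha> (v + ?w)) + V (\<beta> x' y')"
        by (simp add: \<alpha> f_def[symmetric] add.assoc)
    qed (use that in \<open>auto simp: \<beta> g_def h_def\<close>)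
    then show False using \<open>f x y \<noteq> f x' y'\<close> by (simp add: f_def)
  qed
  show ?thesis
  proof (rule that[of g h f])
    show "el (g v) (h v) v \<in> A" for v
      using el_coords[OF \<alpha>G[of v]] \<alpha>[of v] by (simp add: g_def h_def)
    show "g 0 = 0" "h 0 = 0" using \<alpha>0 by (simp_all add: g_def h_def)
    show "g (V a) = P a \<and> h (V a) = Q a" if "a \<in> A" for a using \<alpha>V[OF that] by (simp add: g_def h_def)
    show "el x y (f x y) \<in> B" for x y
      using el_eqI[of "\<beta> x y" x y "f x y"] \<beta>[of x y] \<beta>G[of x y] by (simp add: f_def)
    show "f 0 0 = 0" using \<beta>b[OF one(2)] by (simp add: f_def)
    show "V b = f (P b) (Q b)" if "b \<in> B" for b using \<beta>b[OF that] by (simp add: f_def)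
    show "g (v + (f x y + f x' y)) = g v" if "f x y \<noteq> f x' y" for x x' y v
      using sep[OF that, of v] by metis
    show "h (v + (f x y + f x y')) = h v" if "f x y \<noteq> f x y'" for x y y' v
      using sep[OF that, of v] by metis
    show "g (v + (f x y + f x' y')) = g v \<or> h (v + (f x y + f x' y')) = h v" if "f x y \<noteq> f x' y'" for x y x' y' v
      using sep[OF that, of v] by metis
  qed
qed

lemma chinese_combination:
  obtains u v where "\<And>a b. [a * u + b * v = a] (mod int p)" "\<And>a b. [a * u + b * v = b] (mod int q)"
proof -
  have "coprime (int p) (int q)" using p q pq primes_coprime by auto
  then obtain u v where u: "[u = 1] (mod int p)" "[u = 0] (mod int q)"
    and v: "[v = 0] (mod int p)" "[v = 1] (mod int q)"
    using binary_chinese_remainder_int[of "int p" "int q"] by metis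
  show ?thesis
  proof (rule that[of u v])
    show "[a * u + b * v = a] (mod int p)" for a b
      using cong_add[OF cong_scalar_left[OF u(1), of a] cong_scalar_left[OF v(1), of b]] by simp
    show "[a * u + b * v = b] (mod int q)" for a b
      using cong_add[OF cong_scalar_left[OF u(2), of a] cong_scalar_left[OF v(2), of b]] by simp
  qed
qed

text \<open>As \<open>S\<close> spans, neither \<open>g\<close> nor \<open>h\<close> is constant, so the four outcomes of \<open>graph_rigidity\<close> apply. Each
gives a normal form; a period that occurs in it serves as \<open>e3\<close>.\<close>

lemma tilings_card_S_4:
  assumes F: "factorization G S C" and card: "card S = 4" and one: "\<one> \<in> S" "\<one> \<in> C" and S: "spans S"
  shows "(\<exists>e3 e4 \<alpha> \<beta> \<mu>. basis e3 e4 \<and> \<alpha> 0 = 0 \<and> \<beta> 0 = 0 \<and> \<mu> 0 0 = 0 \<and> tiling_V_pq_V e3 e4 \<alpha> \<beta> \<mu> S C) \<or>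
    (\<exists>e3 e4 \<alpha> \<beta> \<mu>. basis e3 e4 \<and> \<alpha> 0 = 0 \<and> \<beta> 0 0 = 0 \<and> \<mu> 0 = 0 \<and> tiling_V_q_V_p e3 e4 \<alpha> \<beta> \<mu> S C) \<or>
    (\<exists>e3 e4 \<alpha> \<beta> \<mu>. basis e3 e4 \<and> \<alpha> 0 = 0 \<and> \<beta> 0 0 = 0 \<and> \<mu> 0 = 0 \<and> sw.tiling_V_q_V_p e3 e4 \<alpha> \<beta> \<mu> S C) \<or>
    (\<exists>e3 e4 \<alpha>. basis e3 e4 \<and> \<alpha> 0 0 = 0 \<and> tiling_VV_pq e3 e4 \<alpha> S C)"
proof -
  obtain f g h where
    gh: "\<And>v. el (g v) (h v) v \<in> S" "g 0 = 0" "h 0 = 0" "\<And>a. a \<in> S \<Longrightarrow> g (V a) = P a \<and> h (V a) = Q a"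
    and f: "\<And>x y. el x y (f x y) \<in> C" "f 0 0 = 0" "\<And>b. b \<in> C \<Longrightarrow> V b = f (P b) (Q b)"
    and sep: "\<And>x x' y v. f x y \<noteq> f x' y \<Longrightarrow> g (v + (f x y + f x' y)) = g v"
      "\<And>x y y' v. f x y \<noteq> f x y' \<Longrightarrow> h (v + (f x y + f x y')) = h v"
      "\<And>x y x' y' v. f x y \<noteq> f x' y' \<Longrightarrow>
        g (v + (f x y + f x' y')) = g v \<or> h (v + (f x y + f x' y')) = h v"
    by (rule cofactor_card_4[OF F card one], rule that; assumption)
  have vary: "\<exists>v. g v \<noteq> g 0" "\<exists>v. h v \<noteq> h 0"
    using S gh(2-4) unfolding spans_def by metis+
  from graph_rigidity[of f, OF f(2) sep vary]
  consider (zero) "\<And>x y. f x y = 0"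
    | (pq) w where "w \<noteq> 0" "\<And>x y. f x y = 0 \<or> f x y = w" "\<And>v. g (v + w) = g v" "\<And>v. h (v + w) = h v"
    | (q) w where "w \<noteq> 0" "\<And>x y. f x y = 0 \<or> f x y = w" "\<And>x y. f x y = f 0 y" "\<And>v. h (v + w) = h v"
    | (p) w where "w \<noteq> 0" "\<And>x y. f x y = 0 \<or> f x y = w" "\<And>x y. f x y = f x 0" "\<And>v. g (v + w) = g v"
    by blast
  then show ?thesis
  proof cases
    case zero
    note b = basis_std
    obtain c d where cd: "\<And>a b. [a * c + b * d = a] (mod int p)" "\<And>a b. [a * c + b * d = b] (mod int q)"
      by (rule chinese_combination, rule that; assumption)
    define v where "v i j = mult2 (int i) (1, 0) + mult2 (int j) (0, 1)" for i j :: nat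
    define \<alpha> where "\<alpha> i j = g (v i j) * c + h (v i j) * d" for i j
    have "tiling_VV_pq (1, 0) (0, 1) \<alpha> S C"
    proof (rule tiling_VV_pqI[OF F b])
      show "lin (1, 0) (0, 1) (\<alpha> i j) (\<alpha> i j) (int i) (int j) \<in> S" for i j
      proof -
        have "lin (1, 0) (0, 1) (\<alpha> i j) (\<alpha> i j) (int i) (int j) = el (g (v i j)) (h (v i j)) (v i j)"
          unfolding lin_def el_eq_iff using cd by (simp add: \<alpha>_def v_def)
        then show ?thesis using gh(1) by simp
      qed
      show "lin (1, 0) (0, 1) (int i) (int j) 0 0 \<in> C" for i j
        using f(1)[of "int i" "int j"] by (simp add: lin_def zero)
    qed
    moreover have "\<alpha> 0 0 = 0" by (simp add: \<alpha>_def v_def gh)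
    ultimately show ?thesis using b by blast
  next
    case (pq e3)
    obtain e4 where b: "basis e3 e4" using basis_extend[OF pq(1)] by blast
    have i3: "g (v + mult2 k e3) = g v" "h (v + mult2 k e3) = h v" for v k
      using invariant_mult2[of g e3] invariant_mult2[of h e3] pq by auto
    define \<alpha> where "\<alpha> i = g (mult2 (int i) e4)" for i :: nat
    define \<beta> where "\<beta> i = h (mult2 (int i) e4)" for i :: nat
    define \<mu> where "\<mu> i j = coord3 e3 e4 (f (int i) (int j))" for i j :: nat
    have "tiling_V_pq_V e3 e4 \<alpha> \<beta> \<mu> S C"
    proof (rule tiling_V_pq_VI[OF F b])
      show "lin e3 e4 (\<alpha> i) (\<beta> i) (int j) (int i) \<in> S" for i j
        using gh(1)[of "mult2 (int i) e4 + mult2 (int j) e3"] by (simp add: lin_def \<alpha>_def \<beta>_def i3 add.commute)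
      show "lin e3 e4 (int i) (int j) (\<mu> i j) 0 \<in> C" for i j
        using f(1)[of "int i" "int j"] coord3_line[OF b pq(2)] by (simp add: lin_def \<mu>_def)
    qed
    moreover have "\<alpha> 0 = 0" "\<beta> 0 = 0" "\<mu> 0 0 = 0" using b by (simp_all add: \<alpha>_def \<beta>_def \<mu>_def gh f)
    ultimately show ?thesis using b by blast
  next
    case (q e3)
    obtain e4 where b: "basis e3 e4" using basis_extend[OF q(1)] by blast
    have i3: "h (v + mult2 k e3) = h v" for v k
      using invariant_mult2[of h e3] q by auto
    define \<alpha> where "\<alpha> i = h (mult2 (int i) e4)" for i :: nat
    define \<beta> where "\<beta> i j = g (mult2 (int i) e4 + mult2 (int j) e3)" for i j :: nat
    define \<mu> where "\<mu> i = coord3 e3 e4 (f 0 (int i))" for i :: nat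
    have "tiling_V_q_V_p e3 e4 \<alpha> \<beta> \<mu> S C"
    proof (rule tiling_V_q_V_pI[OF F b])
      show "lin e3 e4 (\<beta> i j) (\<alpha> i) (int j) (int i) \<in> S" for i j
        using gh(1)[of "mult2 (int i) e4 + mult2 (int j) e3"] by (simp add: lin_def \<alpha>_def \<beta>_def i3 add.commute)
      show "lin e3 e4 (int j) (int i) (\<mu> i) 0 \<in> C" for i j
        using f(1)[of "int j" "int i"] coord3_line[OF b q(2)] q(3)[of "int j" "int i"] by (simp add: lin_def \<mu>_def)
    qed
    moreover have "\<alpha> 0 = 0" "\<beta> 0 0 = 0" "\<mu> 0 = 0" using b by (simp_all add: \<alpha>_def \<beta>_def \<mu>_def gh f)
    ultimately show ?thesis using b by blast
  next
    case (p e3)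
    obtain e4 where b: "basis e3 e4" using basis_extend[OF p(1)] by blast
    have i3: "g (v + mult2 k e3) = g v" for v k
      using invariant_mult2[of g e3] p by auto
    define \<alpha> where "\<alpha> i = g (mult2 (int i) e4)" for i :: nat
    define \<beta> where "\<beta> i j = h (mult2 (int i) e4 + mult2 (int j) e3)" for i j :: nat
    define \<mu> where "\<mu> i = coord3 e3 e4 (f (int i) 0)" for i :: nat
    have "sw.tiling_V_q_V_p e3 e4 \<alpha> \<beta> \<mu> S C"
    proof (rule sw.tiling_V_q_V_pI[OF F b])
      show "sw.lin e3 e4 (\<beta> i j) (\<alpha> i) (int j) (int i) \<in> S" for i j
        using gh(1)[of "mult2 (int i) e4 + mult2 (int j) e3"] by (simp add: sw.lin_def el_swap \<alpha>_def \<beta>_def i3 add.commute)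
      show "sw.lin e3 e4 (int j) (int i) (\<mu> i) 0 \<in> C" for i j
        using f(1)[of "int i" "int j"] coord3_line[OF b p(2)] p(3)[of "int i" "int j"]
        by (simp add: sw.lin_def el_swap \<mu>_def)
    qed
    moreover have "\<alpha> 0 = 0" "\<beta> 0 0 = 0" "\<mu> 0 = 0" using b by (simp_all add: \<alpha>_def \<beta>_def \<mu>_def gh f)
    ultimately show ?thesis using b by blast
  qed
qed

text \<open>If \<open>C\<close> moved in both odd directions, \<open>graph_rigidity\<close> would put the \<open>V\<close>-coordinates of \<open>S\<close> into a line,
and \<open>S\<close> would not span. So \<open>h\<close> vanishes, and the form depends on whether \<open>g\<close> has a nonzero period.\<close>

lemma tilings_card_C_4:
  assumes F: "factorization G S C" and card: "card C = 4" and one: "\<one> \<in> S" "\<one> \<in> C" and S: "spans S"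
    and nP: "\<exists>c\<in>C. P c \<noteq> 0"
  shows "(\<exists>e3 e4 \<alpha> \<beta> \<mu>. basis e3 e4 \<and> \<alpha> 0 = 0 \<and> \<beta> 0 = 0 \<and> \<mu> 0 0 = 0 \<and> tiling_q_VV_p e3 e4 \<alpha> \<beta> \<mu> S C) \<or>
    (\<exists>e3 e4 \<alpha> \<beta> \<mu>. basis e3 e4 \<and> \<alpha> 0 0 = 0 \<and> \<beta> 0 = 0 \<and> \<mu> 0 = 0 \<and> tiling_q_V_p_V e3 e4 \<alpha> \<beta> \<mu> S C)"
proof -
  obtain f g h where
    gh: "\<And>v. el (g v) (h v) v \<in> C" "g 0 = 0" "h 0 = 0" "\<And>a. a \<in> C \<Longrightarrow> g (V a) = P a \<and> h (V a) = Q a"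
    and f: "\<And>x y. el x y (f x y) \<in> S" "f 0 0 = 0" "\<And>b. b \<in> S \<Longrightarrow> V b = f (P b) (Q b)"
    and sep: "\<And>x x' y v. f x y \<noteq> f x' y \<Longrightarrow> g (v + (f x y + f x' y)) = g v"
      "\<And>x y y' v. f x y \<noteq> f x y' \<Longrightarrow> h (v + (f x y + f x y')) = h v"
      "\<And>x y x' y' v. f x y \<noteq> f x' y' \<Longrightarrow>
        g (v + (f x y + f x' y')) = g v \<or> h (v + (f x y + f x' y')) = h v"
    by (rule cofactor_card_4[OF factorization_commute[OF F] card one(2,1)], rule that; assumption)
  have vary: "\<exists>v. g v \<noteq> g 0" using nP gh(2,4) by metis
  have h0: "h v = 0" for v
  proof (rule ccontr)
    assume "h v \<noteq> 0"
    then have "\<exists>v. h v \<noteq> h 0" using gh(3) by metis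
    from graph_rigidity[of f, OF f(2) sep vary this]
    have "(\<forall>x y. f x y = 0) \<or> (\<exists>w. \<forall>x y. f x y = 0 \<or> f x y = w)" by blast
    then show False using S f(3) unfolding spans_def by metis
  qed
  show ?thesis
  proof (cases "\<exists>w. w \<noteq> 0 \<and> (\<forall>v. g (v + w) = g v)")
    case True
    then obtain e3 where e3: "e3 \<noteq> 0" "\<And>v. g (v + e3) = g v" by blast
    obtain e4 where b: "basis e3 e4" using basis_extend[OF e3(1)] by blast
    have i3: "g (v + mult2 k e3) = g v" for v k
      using invariant_mult2[of g e3] e3 by auto
    have only: "w = e3" if "\<And>v. g (v + w) = g v" "w \<noteq> 0" for w
      using klein_invariant_const[of e3 w g] that e3 vary unfolding basis_def by metis
    have fx: "coord3 e4 e3 (f x y) = coord3 e4 e3 (f 0 y)" for x y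
    proof (cases "f x y = f 0 y")
      case False
      then have "f x y + f 0 y = e3" using only[of "f x y + f 0 y"] sep(1)[of x y 0] by simp
      then have "f x y = f 0 y + e3" by (metis klein_self_left add.commute)
      then show ?thesis using coord3_add_other[OF b] by simp
    qed simp
    define \<alpha> where "\<alpha> i j = coord3 e3 e4 (f (int j) (int i))" for i j :: nat
    define \<beta> where "\<beta> i = coord3 e4 e3 (f 0 (int i))" for i :: nat
    define \<mu> where "\<mu> i = g (mult2 (int i) e4)" for i :: nat
    have "tiling_q_V_p_V e3 e4 \<alpha> \<beta> \<mu> S C"
    proof (rule tiling_q_V_p_VI[OF F b])
      show "lin e3 e4 (int j) (int i) (\<alpha> i j) (\<beta> i) \<in> S" for i j
        using f(1)[of "int j" "int i"] basis_coords[OF b, of "f (int j) (int i)"] fx[of "int j" "int i"]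
        by (simp add: lin_def \<alpha>_def \<beta>_def)
      show "lin e3 e4 (\<mu> i) 0 (int j) (int i) \<in> C" for i j
        using gh(1)[of "mult2 (int i) e4 + mult2 (int j) e3"] by (simp add: lin_def \<mu>_def i3 h0 add.commute)
    qed
    moreover have "\<alpha> 0 0 = 0" "\<beta> 0 = 0" "\<mu> 0 = 0" using b basis_swap[OF b] by (simp_all add: \<alpha>_def \<beta>_def \<mu>_def gh f)
    ultimately show ?thesis using b by blast
  next
    case False
    have fx: "f x y = f 0 y" for x y
      using False sep(1)[of x y 0] klein_add_eq_0 by metis
    define \<alpha> where "\<alpha> i = coord3 (1, 0) (0, 1) (f 0 (int i))" for i :: nat
    define \<beta> where "\<beta> i = coord3 (0, 1) (1, 0) (f 0 (int i))" for i :: nat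
    define \<mu> where "\<mu> i j = g (mult2 (int i) (1, 0) + mult2 (int j) (0, 1))" for i j :: nat
    note b = basis_std
    have "tiling_q_VV_p (1, 0) (0, 1) \<alpha> \<beta> \<mu> S C"
    proof (rule tiling_q_VV_pI[OF F b])
      show "lin (1, 0) (0, 1) (int j) (int i) (\<alpha> i) (\<beta> i) \<in> S" for i j
        using f(1)[of "int j" "int i"] fx[of "int j" "int i"]
        by (simp add: lin_def \<alpha>_def \<beta>_def basis_coords[OF b])
      show "lin (1, 0) (0, 1) (\<mu> i j) 0 (int i) (int j) \<in> C" for i j
        using gh(1)[of "mult2 (int i) (1, 0) + mult2 (int j) (0, 1)"] by (simp add: lin_def \<mu>_def h0)
    qed
    moreover have "\<alpha> 0 = 0" "\<beta> 0 = 0" "\<mu> 0 0 = 0" using b basis_swap[OF b] by (simp_all add: \<alpha>_def \<beta>_def \<mu>_def gh f)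
    ultimately show ?thesis using b by blast
  qed
qed

lemma tilings_card_C_4_klein:
  assumes F: "factorization G S C" and card: "card C = 4" and one: "\<one> \<in> S" "\<one> \<in> C"
    and C0: "\<forall>c\<in>C. P c = 0" "\<forall>c\<in>C. Q c = 0"
  shows "\<exists>e3 e4 \<alpha> \<beta>. basis e3 e4 \<and> \<alpha> 0 0 = 0 \<and> \<beta> 0 0 = 0 \<and> tiling_pq_VV e3 e4 \<alpha> \<beta> S C"
proof -
  obtain f g h where
    gh: "\<And>v. el (g v) (h v) v \<in> C" "g 0 = 0" "h 0 = 0" "\<And>a. a \<in> C \<Longrightarrow> g (V a) = P a \<and> h (V a) = Q a"
    and f: "\<And>x y. el x y (f x y) \<in> S" "f 0 0 = 0" "\<And>b. b \<in> S \<Longrightarrow> V b = f (P b) (Q b)"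
    and sep: "\<And>x x' y v. f x y \<noteq> f x' y \<Longrightarrow> g (v + (f x y + f x' y)) = g v"
      "\<And>x y y' v. f x y \<noteq> f x y' \<Longrightarrow> h (v + (f x y + f x y')) = h v"
      "\<And>x y x' y' v. f x y \<noteq> f x' y' \<Longrightarrow>
        g (v + (f x y + f x' y')) = g v \<or> h (v + (f x y + f x' y')) = h v"
    by (rule cofactor_card_4[OF factorization_commute[OF F] card one(2,1)], rule that; assumption)
  have "g v = 0 \<and> h v = 0" for v
    using gh(4)[OF gh(1)[of v]] bspec[OF C0(1) gh(1)[of v]] bspec[OF C0(2) gh(1)[of v]] by simp
  then have C: "el 0 0 v \<in> C" for v using gh(1)[of v] by simp
  define \<alpha> where "\<alpha> i j = coord3 (1, 0) (0, 1) (f (int i) (int j))" for i j :: nat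
  define \<beta> where "\<beta> i j = coord3 (0, 1) (1, 0) (f (int i) (int j))" for i j :: nat
  note b = basis_std
  have "tiling_pq_VV (1, 0) (0, 1) \<alpha> \<beta> S C"
  proof (rule tiling_pq_VVI[OF F b])
    show "lin (1, 0) (0, 1) (int i) (int j) (\<alpha> i j) (\<beta> i j) \<in> S" for i j
      using f(1)[of "int i" "int j"] by (simp add: lin_def \<alpha>_def \<beta>_def basis_coords[OF b])
    show "lin (1, 0) (0, 1) 0 0 (int i) (int j) \<in> C" for i j
      using C by (simp add: lin_def)
  qed
  moreover have "\<alpha> 0 0 = 0" "\<beta> 0 0 = 0" using b basis_swap[OF b] by (simp_all add: \<alpha>_def \<beta>_def f)
  ultimately show ?thesis using b by blast
qed

section \<open>A code with two elements\<close>

text \<open>After scaling both odd coordinates of \<open>c\<close> by \<open>0\<close> the translate of \<open>S\<close> by the \<open>V\<close>-coordinate of \<open>c\<close> is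
the complement of \<open>S\<close>. The last statement is \<open>offset_PQ\<close> for the two elements of \<open>C\<close>.\<close>

lemma card_2_halving:
  assumes F: "factorization G S C" and card: "card C = 2" and one: "\<one> \<in> S" "\<one> \<in> C"
  obtains c where "c \<in> C" "c \<noteq> \<one>" "C = {\<one>, c}" "V c \<noteq> 0" "\<And>x y v. el x y v \<in> S \<or> el x y (v + V c) \<in> S"
    "\<And>b b'. b \<in> S \<Longrightarrow> b' \<in> S \<Longrightarrow> V b' = V b + V c \<Longrightarrow> P c \<noteq> 0 \<or> P b = P b' \<Longrightarrow> Q c \<noteq> 0 \<or> Q b = Q b' \<Longrightarrow> False"
proof -
  obtain c where c: "C = {\<one>, c}" "c \<noteq> \<one>"
    using card one(2) by (metis card_2_iff doubleton_eq_iff insertE singletonD)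
  have np: "\<not> p dvd card C" "\<not> q dvd card C" using card not_dvd_pow2 by auto
  note F' = factorization_commute[OF F]
  have sep: False if "b \<in> S" "b' \<in> S" "V b' = V b + V c" "P c \<noteq> 0 \<or> P b = P b'" "Q c \<noteq> 0 \<or> Q b = Q b'" for b b'
    using offset_PQ[OF F' np, of c \<one> b b'] that c by (auto simp: add.commute)
  show ?thesis
  proof (rule that[of c])
    show "V c \<noteq> 0" using sep[OF one(1) one(1)] by auto
    show "el x y v \<in> S \<or> el x y (v + V c) \<in> S" for x y v
    proof -
      obtain a b where ab: "a \<in> C" "b \<in> S" "P b = x mod int p" "Q b = y mod int q" "V a + V b = v"
        using cover_PQ[OF F' np] by metis
      have "b \<in> carrier G" using F ab by (auto simp: factorization_def)
      then have "b = el x y (V b)" using ab by (intro el_eqI) auto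
      moreover have "V b = v \<or> V b = v + V c" using ab(1,5) c by (auto simp: ac_simps)
      ultimately show ?thesis using ab(2) by metis
    qed
  qed (use c sep in auto)
qed

text \<open>If \<open>c\<close> moves in an odd direction, \<open>card_2_halving\<close> makes \<open>S\<close> periodic in that direction. If it
moved in both, \<open>S\<close> would be the preimage of a two-element subgroup of the Klein group and would not span.\<close>

lemma tilings_card_C_2:
  assumes F: "factorization G S C" and card: "card C = 2" and one: "\<one> \<in> S" "\<one> \<in> C" and S: "spans S"
    and nP: "\<exists>c\<in>C. P c \<noteq> 0"
  shows "\<exists>e3 e4 \<alpha> \<mu>. basis e3 e4 \<and> \<alpha> 0 0 = 0 \<and> \<mu> 0 = 0 \<and> tiling_qV_V_p e3 e4 \<alpha> \<mu> S C"
proof -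
  obtain c where c: "c \<in> C" "c \<noteq> \<one>" "C = {\<one>, c}" "V c \<noteq> 0"
    and half: "\<And>x y v. el x y v \<in> S \<or> el x y (v + V c) \<in> S"
    and sep: "\<And>b b'. b \<in> S \<Longrightarrow> b' \<in> S \<Longrightarrow> V b' = V b + V c \<Longrightarrow> P c \<noteq> 0 \<or> P b = P b' \<Longrightarrow> Q c \<noteq> 0 \<or> Q b = Q b' \<Longrightarrow> False"
    by (rule card_2_halving[OF F card one], rule that; assumption)
  have Pc: "P c \<noteq> 0" using nP c(3) by auto
  define e3 where "e3 = V c"
  obtain e4 where b: "basis e3 e4" using basis_extend c(4) unfolding e3_def by blast
  have Qc: "Q c = 0"
  proof (rule ccontr)
    assume Qc: "Q c \<noteq> 0"
    obtain v1 where v1: "el 0 0 v1 \<in> S" "v1 = e4 \<or> v1 = e4 + e3" using half[of 0 0 e4] e3_def by blast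
    have b1: "basis e3 v1" using v1(2) b by (auto simp: basis_def klein_add_eq_0)
    obtain s where s: "s \<in> S" "V s \<noteq> 0" "V s \<noteq> v1" using S unfolding spans_def by metis
    then have "V s = 0 + e3 \<or> V s = v1 + e3"
      using klein_cases[of e3 v1 "V s"] b1 by (auto simp: basis_def add.commute)
    then show False
      using sep[OF one(1) s(1)] sep[OF v1(1) s(1)] Pc Qc by (auto simp: e3_def)
  qed
  have invP: "el x' y v \<in> S" if "el x y v \<in> S" for x x' y v
    using half[of x' y v] sep[OF that, of "el x' y (v + V c)"] Pc by auto
  define \<alpha> where "\<alpha> i j = (if el 0 (int i) (mult2 (int j) e4) \<in> S then 0 else 1 :: int)" for i j :: nat
  define \<mu> where "\<mu> i = (if even i then 0 else P c)" for i :: nat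
  have "tiling_qV_V_p e3 e4 \<alpha> \<mu> S C"
  proof (rule tiling_qV_V_pI[OF F b])
    show "lin e3 e4 (int k) (int i) (\<alpha> i j) (int j) \<in> S" for i j k
      using half[of 0 "int i" "mult2 (int j) e4"] invP[of 0 "int i" "mult2 (int j) e4" "int k"]
        invP[of 0 "int i" "mult2 (int j) e4 + V c" "int k"]
      by (auto simp: lin_def \<alpha>_def e3_def add.commute)
    show "lin e3 e4 (\<mu> i) 0 (int i) 0 \<in> C" for i
      using c el_eqI[of c "P c" 0 "V c"] F Qc
      by (auto simp: lin_def \<mu>_def mult2_def e3_def el_0 factorization_def P_mod)
  qed
  moreover have "\<alpha> 0 0 = 0" "\<mu> 0 = 0" using one by (simp_all add: \<alpha>_def \<mu>_def el_0)
  ultimately show ?thesis using b by blast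
qed

lemma tilings_card_C_2_klein:
  assumes F: "factorization G S C" and card: "card C = 2" and one: "\<one> \<in> S" "\<one> \<in> C"
    and C0: "\<forall>c\<in>C. P c = 0" "\<forall>c\<in>C. Q c = 0"
  shows "\<exists>e3 e4 \<alpha>. basis e3 e4 \<and> \<alpha> 0 0 0 = 0 \<and> tiling_pqV_V e3 e4 \<alpha> S C"
proof -
  obtain c where c: "c \<in> C" "c \<noteq> \<one>" "C = {\<one>, c}" "V c \<noteq> 0"
    and half: "\<And>x y v. el x y v \<in> S \<or> el x y (v + V c) \<in> S"
    and sep: "\<And>b b'. b \<in> S \<Longrightarrow> b' \<in> S \<Longrightarrow> V b' = V b + V c \<Longrightarrow> P c \<noteq> 0 \<or> P b = P b' \<Longrightarrow> Q c \<noteq> 0 \<or> Q b = Q b' \<Longrightarrow> False"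
    by (rule card_2_halving[OF F card one], rule that; assumption)
  define e3 where "e3 = V c"
  obtain e4 where b: "basis e3 e4" using basis_extend c(4) unfolding e3_def by blast
  define \<alpha> where "\<alpha> i j k = (if el (int i) (int j) (mult2 (int k) e4) \<in> S then 0 else 1 :: int)" for i j k :: nat
  have "tiling_pqV_V e3 e4 \<alpha> S C"
  proof (rule tiling_pqV_VI[OF F b])
    show "lin e3 e4 (int i) (int j) (\<alpha> i j k) (int k) \<in> S" for i j k
      using half[of "int i" "int j" "mult2 (int k) e4"]
      by (auto simp: lin_def \<alpha>_def e3_def add.commute)
    show "lin e3 e4 0 0 (int i) 0 \<in> C" for i
      using c el_eqI[of c 0 0 "V c"] F C0
      by (auto simp: lin_def mult2_def e3_def el_0 factorization_def)
  qed
  moreover have "\<alpha> 0 0 0 = 0" using one by (simp add: \<alpha>_def el_0)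
  ultimately show ?thesis using b by blast
qed

end

section \<open>Factors of orders 2p and 2q\<close>

context pq_group
begin

definition slice :: "'a set \<Rightarrow> int \<Rightarrow> klein set" where
  "slice A x = V ` {a \<in> A. P a = x mod int p}"

lemma slice_iff: "v \<in> slice A x \<longleftrightarrow> (\<exists>a\<in>A. P a = x mod int p \<and> V a = v)"
  by (auto simp: slice_def)

lemma slice_zero: "\<one> \<in> A \<Longrightarrow> 0 \<in> slice A 0"
  unfolding slice_iff by (rule bexI[of _ \<one>]) auto

lemma slice_section:
  assumes "A \<subseteq> carrier G" "\<one> \<in> A" and "\<And>a a'. a \<in> A \<Longrightarrow> a' \<in> A \<Longrightarrow> P a = P a' \<Longrightarrow> Q a = Q a'"
  obtains g where "g 0 = 0" "\<And>x v. v \<in> slice A x \<Longrightarrow> el x (g x) v \<in> A"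
proof (rule that)
  let ?g = "\<lambda>x. Q (SOME a. a \<in> A \<and> P a = x mod int p)"
  have g: "?g x = Q a" if "a \<in> A" "P a = x mod int p" for x a
  proof -
    have "(SOME a. a \<in> A \<and> P a = x mod int p) \<in> A \<and> P (SOME a. a \<in> A \<and> P a = x mod int p) = x mod int p"
      by (rule someI[of "\<lambda>a. a \<in> A \<and> P a = x mod int p" a]) (use that in simp)
    then show ?thesis using assms(3) that by metis
  qed
  show "?g 0 = 0" using g[OF assms(2), of 0] by simp
  show "el x (?g x) v \<in> A" if v: "v \<in> slice A x" for x v
  proof -
    obtain a where a: "a \<in> A" "P a = x mod int p" "V a = v" using v unfolding slice_iff by blast
    moreover have "a \<in> carrier G" using a assms(1) by blast
    ultimately have "a = el x (?g x) v" using g[OF a(1,2)] by (intro el_eqI) (auto simp: Q_mod)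
    then show ?thesis using a by metis
  qed
qed

end

context pq_group
begin

interpretation sw: pq_group G q p Q P V by (rule swap)

lemma not_dvd_double: "\<not> q dvd 2 * p" "\<not> p dvd 2 * q"
  using prime_dvd_mult_iff[OF p(1), of 2 q] prime_dvd_mult_iff[OF q(1), of 2 p]
    not_dvd_pow2 p q pq primes_dvd_imp_eq by auto

text \<open>Scaling by \<open>0\<close> shows that a slice of \<open>A\<close> over \<open>\<int>\<^sub>p\<close> and a slice of \<open>B\<close> over \<open>\<int>\<^sub>q\<close> form a factorization
of the Klein group, so the product of their orders is \<open>4\<close>. Hence all slices of \<open>A\<close> have the same order, which
is \<open>card A\<close> divided by \<open>p\<close>.\<close>

lemma card_slice:
  assumes F: "factorization G A B" and A: "card A = 2 * p" and B: "card B = 2 * q"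
  shows "card (slice A x) = 2"
proof -
  have nA: "\<not> q dvd card A" and nB: "\<not> p dvd card B"
    using A B not_dvd_double by auto
  note offs = offset_QP[OF F nA nB]
  have "bij_betw (\<lambda>(v, w). v + w) (slice A x \<times> sw.slice B 0) UNIV" for x
    unfolding bij_betw_def
  proof
    show "inj_on (\<lambda>(v, w). v + w) (slice A x \<times> sw.slice B 0)"
    proof (rule inj_onI, clarify)
      fix v w v' w'
      assume "v \<in> slice A x" "w \<in> sw.slice B 0" "v' \<in> slice A x" "w' \<in> sw.slice B 0" and eq: "v + w = v' + w'"
      then obtain a b a' b' where "a \<in> A" "b \<in> B" "a' \<in> A" "b' \<in> B" "V a = v" "V b = w" "V a' = v'" "V b' = w'"
        "P a = P a'" "Q b = Q b'"
        unfolding slice_def sw.slice_def by auto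
      then show "v = v' \<and> w = w'" using offs[of a a' b b'] eq by auto
    qed
    have "v \<in> (\<lambda>(v, w). v + w) ` (slice A x \<times> sw.slice B 0)" for v
    proof -
      obtain a b where "a \<in> A" "b \<in> B" "P a = x mod int p" "Q b = 0 mod int q" "V a + V b = v"
        using cover_QP[OF F nA nB] by metis
      then show ?thesis by (intro image_eqI[of _ _ "(V a, V b)"]) (auto simp: slice_def sw.slice_def)
    qed
    then show "(\<lambda>(v, w). v + w) ` (slice A x \<times> sw.slice B 0) = UNIV" by blast
  qed
  then have 4: "card (slice A x) * card (sw.slice B 0) = 4" for x
    using bij_betw_same_card card_klein by (metis card_cartesian_product)
  have same: "card (slice A x) = card (slice A 0)" for x
    using 4[of x] 4[of 0] by (metis mult_cancel2 zero_neq_numeral mult_0_right)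
  have AG: "A \<subseteq> carrier G" using F by (simp add: factorization_def)
  have finA: "finite A" using AG finite_G finite_subset by blast
  have ex_b: "\<exists>b. b \<in> B" using cover_QP[OF F nA nB] by metis
  have cA: "card {a \<in> A. P a = x} = card (slice A 0)" if "x \<in> {0..<int p}" for x
  proof -
    have "inj_on V {a \<in> A. P a = x}"
      using offs ex_b by (intro inj_onI) (metis (mono_tags, lifting) mem_Collect_eq)
    then have "card {a \<in> A. P a = x} = card (slice A x)"
      using that by (simp add: slice_def card_image)
    then show ?thesis using same by simp
  qed
  have "A = (\<Union>x\<in>{0..<int p}. {a \<in> A. P a = x})" using P_range AG by auto
  then have "card A = card (\<Union>x\<in>{0..<int p}. {a \<in> A. P a = x})" by simp
  also have "\<dots> = (\<Sum>x\<in>{0..<int p}. card {a \<in> A. P a = x})"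
    by (rule card_UN_disjoint) (use finA in auto)
  also have "\<dots> = p * card (slice A 0)" using cA by simp
  finally have "card (slice A 0) = 2" using A p_pos by simp
  then show ?thesis using same by simp
qed

end

context pq_group
begin

interpretation sw: pq_group G q p Q P V by (rule swap)

text \<open>Let \<open>a\<close> and \<open>a'\<close> be two elements of the same slice with different \<open>\<int>\<^sub>q\<close>-coordinates. By
\<open>offset_QP\<close> no two elements of \<open>B\<close>, from whatever slices, have the same \<open>V\<close>-difference as \<open>a\<close> and \<open>a'\<close>.
This leaves only two values for the \<open>V\<close>-coordinates of \<open>B\<close>.\<close>

lemma slice_rigid:
  assumes F: "factorization G A B" and A: "card A = 2 * p" and B: "card B = 2 * q" and one: "\<one> \<in> A" "\<one> \<in> B"
  shows "(\<exists>w. w \<noteq> 0 \<and> (\<forall>y. sw.slice B y = {0, w})) \<or> (\<forall>a\<in>A. \<forall>a'\<in>A. P a = P a' \<longrightarrow> Q a = Q a')"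
proof (rule disjCI)
  assume "\<not> (\<forall>a\<in>A. \<forall>a'\<in>A. P a = P a' \<longrightarrow> Q a = Q a')"
  then obtain a a' where a: "a \<in> A" "a' \<in> A" "P a = P a'" "Q a \<noteq> Q a'" by blast
  have nA: "\<not> q dvd card A" and nB: "\<not> p dvd card B"
    using A B not_dvd_double by auto
  note offs = offset_QP[OF F nA nB]
  note card2 = sw.card_slice[OF factorization_commute[OF F] B A]
  define s where "s = V a + V a'"
  have s: "V b' \<noteq> V b + s" if "b \<in> B" "b' \<in> B" for b b'
    using offs[of a a' b b'] a that by (auto simp: s_def ac_simps)
  have s0: "s \<noteq> 0" using s[OF one(2) one(2)] by auto
  obtain w where w: "sw.slice B 0 = {0, w}" "w \<noteq> 0"
    using card2[of 0] sw.slice_zero[OF one(2)] by (metis card_2_iff doubleton_eq_iff insertE singletonD)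
  obtain b where b: "b \<in> B" "V b = w" using w(1) sw.slice_iff by (metis insertI1 insertI2)
  have "w \<noteq> s" using s[OF one(2) b(1)] b(2) by simp
  then have V: "V c = 0 \<or> V c = w" if "c \<in> B" for c
    using klein_cases[of s w "V c"] s0 w(2) s[OF one(2) that] s[OF b(1) that] b(2) by (auto simp: add.commute)
  have "sw.slice B y = {0, w}" for y
  proof (rule card_subset_eq)
    show "sw.slice B y \<subseteq> {0, w}" using V unfolding sw.slice_def by blast
    show "card (sw.slice B y) = card {0, w}" using card2 w(2) by simp
  qed simp
  then show "\<exists>w. w \<noteq> 0 \<and> (\<forall>y. sw.slice B y = {0, w})" using w(2) by blast
qed

text \<open>A slice of \<open>A\<close> and a slice of \<open>B\<close> never have the same direction, as they factorize the Klein group. With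
only three nonzero elements available, all slices of \<open>A\<close> or all slices of \<open>B\<close> have one direction.\<close>

lemma slice_directions:
  assumes F: "factorization G A B" and A: "card A = 2 * p" and B: "card B = 2 * q"
  obtains w where "w \<noteq> 0" "\<And>x v. v \<in> slice A x \<Longrightarrow> v + w \<in> slice A x"
    | w where "w \<noteq> 0" "\<And>y v. v \<in> sw.slice B y \<Longrightarrow> v + w \<in> sw.slice B y"
proof -
  have nA: "\<not> q dvd card A" and nB: "\<not> p dvd card B"
    using A B not_dvd_double by auto
  note offs = offset_QP[OF F nA nB]
  have pair: "\<exists>s. s \<noteq> 0 \<and> (\<exists>v. X = {v, v + s})" if "card X = 2" for X :: "klein set"
  proof -
    obtain v v' where "X = {v, v'}" "v \<noteq> v'" using \<open>card X = 2\<close> card_2_iff by metis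
    then show ?thesis by (intro exI[of _ "v + v'"] conjI exI[of _ v]) simp_all
  qed
  obtain s where s: "\<And>x. s x \<noteq> 0 \<and> (\<exists>v. slice A x = {v, v + s x})"
    using pair[OF card_slice[OF F A B]] by metis
  obtain t where t: "\<And>y. t y \<noteq> 0 \<and> (\<exists>v. sw.slice B y = {v, v + t y})"
    using pair[OF sw.card_slice[OF factorization_commute[OF F] B A]] by metis
  have st: "s x \<noteq> t y" for x y
  proof
    assume eq: "s x = t y"
    obtain v w where v: "slice A x = {v, v + s x}" and w: "sw.slice B y = {w, w + s x}"
      using s[of x] t[of y] eq by auto
    obtain a where a: "a \<in> A" "P a = x mod int p" "V a = v" using v slice_iff by (metis insertI1)
    obtain a' where a': "a' \<in> A" "P a' = x mod int p" "V a' = v + s x" using v slice_iff by (metis insertI1 insertI2)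
    obtain b where b: "b \<in> B" "Q b = y mod int q" "V b = w" using w sw.slice_iff by (metis insertI1)
    obtain b' where b': "b' \<in> B" "Q b' = y mod int q" "V b' = w + s x" using w sw.slice_iff by (metis insertI1 insertI2)
    have "a = a' \<and> b = b'" by (rule offs) (use a a' b b' in \<open>auto simp: ac_simps\<close>)
    then show False using a a' s[of x] by auto
  qed
  have Acl: "v + s x \<in> slice A x" if "v \<in> slice A x" for x v
  proof -
    obtain u where u: "slice A x = {u, u + s x}" using s by blast
    then have "v = u \<or> v = u + s x" using that by blast
    then show ?thesis unfolding u by (elim disjE) (simp_all add: add.assoc)
  qed
  have Bcl: "v + t y \<in> sw.slice B y" if "v \<in> sw.slice B y" for y v
  proof -
    obtain u where u: "sw.slice B y = {u, u + t y}" using t by blast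
    then have "v = u \<or> v = u + t y" using that by blast
    then show ?thesis unfolding u by (elim disjE) (simp_all add: add.assoc)
  qed
  show ?thesis
  proof (cases "\<forall>x. s x = s 0")
    case True
    then show ?thesis using that(1)[of "s 0"] s Acl by metis
  next
    case False
    then obtain x where x: "s x \<noteq> s 0" by blast
    have "t y = s x + s 0" for y
      using klein_cases[of "s x" "s 0" "t y"] x s t[of y] st[of x y] st[of 0 y] by auto
    then show ?thesis using that(2)[of "s x + s 0"] Bcl t by metis
  qed
qed

end

context pq_group
begin

interpretation sw: pq_group G q p Q P V by (rule swap)

text \<open>Since \<open>S\<close> spans, \<open>slice_rigid\<close> with exchanged roles makes the \<open>\<int>\<^sub>p\<close>-coordinate of \<open>C\<close> a function of
its \<open>\<int>\<^sub>q\<close>-coordinate. If also the \<open>\<int>\<^sub>q\<close>-coordinate of \<open>S\<close> is a function of its \<open>\<int>\<^sub>p\<close>-coordinate, the former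
function is zero: otherwise there are \<open>s \<in> S\<close> with nonzero \<open>\<int>\<^sub>q\<close>-coordinate and \<open>c \<in> C\<close> with nonzero
\<open>\<int>\<^sub>p\<close>-coordinate whose \<open>V\<close>-coordinates cancel, and \<open>s + c\<close> collides with \<open>0 + 0\<close> after scaling. Then
\<open>slice_directions\<close> distinguishes two forms. If not, all slices of \<open>C\<close> are the same subgroup \<open>{0, e3}\<close>, and either \<open>C\<close>
has no \<open>\<int>\<^sub>p\<close>-coordinates or the \<open>\<int>\<^sub>q\<close>-coordinate of \<open>S\<close> depends on the class modulo \<open>e3\<close> only.\<close>

lemma tilings_card_S_2p:
  assumes F: "factorization G S C" and card: "card S = 2 * p" and one: "\<one> \<in> S" "\<one> \<in> C" and S: "spans S"
  shows "(\<exists>e3 e4 \<alpha> \<beta> \<mu>. basis e3 e4 \<and> \<alpha> 0 = 0 \<and> \<beta> 0 = 0 \<and> \<mu> 0 0 = 0 \<and> tiling_p_qV_V e3 e4 \<alpha> \<beta> \<mu> S C) \<or>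
    (\<exists>e3 e4 \<alpha> \<beta> \<mu>. basis e3 e4 \<and> \<alpha> 0 = 0 \<and> \<beta> 0 0 = 0 \<and> \<mu> 0 = 0 \<and> tiling_V_q_p_V e3 e4 \<alpha> \<beta> \<mu> S C) \<or>
    (\<exists>e3 e4 \<alpha> \<beta> \<mu>. basis e3 e4 \<and> \<alpha> 0 = 0 \<and> \<beta> 0 0 = 0 \<and> \<mu> 0 = 0 \<and> tiling_p_q_V_V e3 e4 \<alpha> \<beta> \<mu> S C) \<or>
    (\<exists>e3 e4 \<alpha>. basis e3 e4 \<and> \<alpha> 0 0 = 0 \<and> tiling_pV_qV e3 e4 \<alpha> S C)"
proof -
  have C: "card C = 2 * q"
    using factorization_card[OF F] card_G card p_pos(1) by auto
  have SG: "S \<subseteq> carrier G" and CG: "C \<subseteq> carrier G" using F by (auto simp: factorization_def)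
  have nS: "\<not> q dvd card S" and nC: "\<not> p dvd card C"
    using card C not_dvd_double by auto
  note offs = offset_QP[OF F nS nC]
  have cov: "\<exists>u\<in>slice S x. \<exists>u'\<in>sw.slice C y. u + u' = v" for x y v
  proof -
    obtain a b where "a \<in> S" "b \<in> C" "P a = x mod int p" "Q b = y mod int q" "V a + V b = v"
      using cover_QP[OF F nS nC] by metis
    then show ?thesis by (auto simp: slice_def sw.slice_def)
  qed
  have zero: "0 \<in> slice S 0" "0 \<in> sw.slice C 0" using slice_zero[OF one(1)] sw.slice_zero[OF one(2)] by auto
  have "\<not> (\<forall>x. slice S x = {0, w})" for w
  proof
    assume w: "\<forall>x. slice S x = {0, w}"
    obtain a where a: "a \<in> S" "V a \<noteq> 0" "V a \<noteq> w" using S unfolding spans_def by blast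
    then have "V a \<in> slice S (P a)" using SG by (auto simp: slice_def P_mod)
    then show False using w a by auto
  qed
  then have "\<And>a a'. a \<in> C \<Longrightarrow> a' \<in> C \<Longrightarrow> Q a = Q a' \<Longrightarrow> P a = P a'"
    using sw.slice_rigid[OF factorization_commute[OF F] C card one(2,1)] by blast
  from sw.slice_section[OF CG one(2) this]
  obtain h where h: "h 0 = 0" "\<And>y v. v \<in> sw.slice C y \<Longrightarrow> el (h y) y v \<in> C"
    unfolding el_swap by metis
  show ?thesis
  proof (cases "\<forall>a\<in>S. \<forall>a'\<in>S. P a = P a' \<longrightarrow> Q a = Q a'")
    case True
    then obtain g where g: "g 0 = 0" "\<And>x v. v \<in> slice S x \<Longrightarrow> el x (g x) v \<in> S"
      using slice_section[OF SG one(1)] by metis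
    have PC: "P c = 0" if c: "c \<in> C" for c
    proof (rule ccontr)
      assume Pc: "P c \<noteq> 0"
      obtain a where a: "a \<in> S" "Q a \<noteq> 0" using S unfolding spans_def by blast
      obtain a1 b1 where ab: "a1 \<in> S" "b1 \<in> C" "P a1 = P a mod int p" "Q b1 = Q c mod int q" "V a1 + V b1 = 0"
        using cover_QP[OF F nS nC] by metis
      have "P a1 = P a" "Q b1 = Q c" using ab a c SG CG by (auto simp: P_mod Q_mod subset_iff)
      then have "Q a1 = Q a" "P b1 = P c" using True ab a c \<open>\<And>a a'. a \<in> C \<Longrightarrow> a' \<in> C \<Longrightarrow> Q a = Q a' \<Longrightarrow> P a = P a'\<close> by blast+
      then have "a1 = \<one> \<and> b1 = \<one>" using offs[OF ab(1) one(1) ab(2) one(2)] ab(5) a Pc by simp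
      then show False using \<open>Q a1 = Q a\<close> a by simp
    qed
    have C0: "el 0 y v \<in> C" if "v \<in> sw.slice C y" for y v
    proof -
      obtain c where c: "c \<in> C" "Q c = y mod int q" "V c = v" using \<open>v \<in> sw.slice C y\<close> by (auto simp: sw.slice_iff)
      then have "c = el 0 y v" using CG PC[OF c(1)] by (intro el_eqI) auto
      then show ?thesis using c by simp
    qed
    show ?thesis
    proof (rule slice_directions[OF F card C])
      fix e3 assume e3: "e3 \<noteq> 0" "\<And>x v. v \<in> slice S x \<Longrightarrow> v + e3 \<in> slice S x"
      obtain e4 where b: "basis e3 e4" using basis_extend[OF e3(1)] by blast
      have S0: "slice S 0 = {0, e3}"
        by (rule card_subset_eq[symmetric]) (use e3(2)[OF zero(1)] zero e3(1) card_slice[OF F card C] in auto)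
      have half: "v \<in> sw.slice C y \<or> v + e3 \<in> sw.slice C y" for y v
        using cov[of 0 y v] unfolding S0 by (auto simp: ac_simps)
      have "\<exists>k :: int. mult2 k e4 \<in> slice S x \<and> (x = 0 \<longrightarrow> k = 0)" for x
      proof (cases "x = 0")
        case True then show ?thesis using zero by (intro exI[of _ 0]) simp
      next
        case False
        obtain u where u: "u \<in> slice S x" using cov[of x 0 0] by blast
        have "mult2 (coord3 e4 e3 u) e4 = u + mult2 (coord3 e3 e4 u) e3"
          using basis_coords[OF b, of u] by (metis add.commute klein_self_left)
        moreover have "u + mult2 (coord3 e3 e4 u) e3 \<in> slice S x" using u e3(2) by (simp add: mult2_def)
        ultimately show ?thesis using False by (intro exI[of _ "coord3 e4 e3 u"]) simp
      qed
      then obtain \<kappa> :: "int \<Rightarrow> int" where \<kappa>: "\<And>x. mult2 (\<kappa> x) e4 \<in> slice S x" "\<kappa> 0 = 0" by metis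
      define \<alpha> where "\<alpha> i = g (int i)" for i :: nat
      define \<beta> where "\<beta> i = \<kappa> (int i)" for i :: nat
      define \<mu> where "\<mu> i j = (if mult2 (int j) e4 \<in> sw.slice C (int i) then 0 else 1 :: int)" for i j :: nat
      have "tiling_p_qV_V e3 e4 \<alpha> \<beta> \<mu> S C"
      proof (rule tiling_p_qV_VI[OF F b])
        show "lin e3 e4 (int i) (\<alpha> i) (int j) (\<beta> i) \<in> S" for i j
          unfolding lin_def \<alpha>_def \<beta>_def
          by (rule g(2)) (use \<kappa>(1)[of "int i"] e3(2)[OF \<kappa>(1), of "int i"] in \<open>auto simp: mult2_def add.commute\<close>)
        show "lin e3 e4 0 (int i) (\<mu> i j) (int j) \<in> C" for i j
          unfolding lin_def
          by (rule C0) (use half[of "mult2 (int j) e4" "int i"] in \<open>auto simp: \<mu>_def add.commute\<close>)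
      qed
      moreover have "\<alpha> 0 = 0" "\<beta> 0 = 0" "\<mu> 0 0 = 0" using g \<kappa> zero by (simp_all add: \<alpha>_def \<beta>_def \<mu>_def)
      ultimately show ?thesis using b by blast
    next
      fix e3 assume e3: "e3 \<noteq> 0" "\<And>x v. v \<in> sw.slice C x \<Longrightarrow> v + e3 \<in> sw.slice C x"
      obtain e4 where b: "basis e3 e4" using basis_extend[OF e3(1)] by blast
      have S0: "sw.slice C 0 = {0, e3}"
        by (rule card_subset_eq[symmetric])
           (use e3(2)[OF zero(2)] zero e3(1) sw.card_slice[OF factorization_commute[OF F] C card] in auto)
      have half: "v \<in> slice S x \<or> v + e3 \<in> slice S x" for x v
        using cov[of x 0 v] unfolding S0 by (auto simp: ac_simps)
      have "\<exists>k :: int. mult2 k e4 \<in> sw.slice C x \<and> (x = 0 \<longrightarrow> k = 0)" for x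
      proof (cases "x = 0")
        case True then show ?thesis using zero by (intro exI[of _ 0]) simp
      next
        case False
        obtain u where u: "u \<in> sw.slice C x" using cov[of 0 x 0] by blast
        have "mult2 (coord3 e4 e3 u) e4 = u + mult2 (coord3 e3 e4 u) e3"
          using basis_coords[OF b, of u] by (metis add.commute klein_self_left)
        moreover have "u + mult2 (coord3 e3 e4 u) e3 \<in> sw.slice C x" using u e3(2) by (simp add: mult2_def)
        ultimately show ?thesis using False by (intro exI[of _ "coord3 e4 e3 u"]) simp
      qed
      then obtain \<kappa> :: "int \<Rightarrow> int" where \<kappa>: "\<And>x. mult2 (\<kappa> x) e4 \<in> sw.slice C x" "\<kappa> 0 = 0" by metis
      define \<alpha> where "\<alpha> i = g (int i)" for i :: nat
      define \<beta> where "\<beta> i j = (if mult2 (int j) e4 \<in> slice S (int i) then 0 else 1 :: int)" for i j :: nat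
      define \<mu> where "\<mu> i = \<kappa> (int i)" for i :: nat
      have "tiling_p_q_V_V e3 e4 \<alpha> \<beta> \<mu> S C"
      proof (rule tiling_p_q_V_VI[OF F b])
        show "lin e3 e4 (int i) (\<alpha> i) (\<beta> i j) (int j) \<in> S" for i j
          unfolding lin_def \<alpha>_def
          by (rule g(2)) (use half[of "mult2 (int j) e4" "int i"] in \<open>auto simp: \<beta>_def add.commute\<close>)
        show "lin e3 e4 0 (int i) (int j) (\<mu> i) \<in> C" for i j
          unfolding lin_def \<mu>_def
          by (rule C0) (use \<kappa>(1)[of "int i"] e3(2)[OF \<kappa>(1), of "int i"] in \<open>auto simp: mult2_def add.commute\<close>)
      qed
      moreover have "\<alpha> 0 = 0" "\<beta> 0 0 = 0" "\<mu> 0 = 0" using g \<kappa> zero by (simp_all add: \<alpha>_def \<beta>_def \<mu>_def)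
      ultimately show ?thesis using b by blast
    qed
  next
    case False
    with slice_rigid[OF F card C one]
    obtain e3 where e3: "e3 \<noteq> 0" "\<And>y. sw.slice C y = {0, e3}" by blast
    obtain e4 where b: "basis e3 e4" using basis_extend[OF e3(1)] by blast
    have half: "v \<in> slice S x \<or> v + e3 \<in> slice S x" for x v
      using cov[of x 0 v] unfolding e3(2) by (auto simp: ac_simps)
    have line: "mult2 k e3 \<in> sw.slice C y" for k y by (simp add: e3 mult2_def)
    show ?thesis
    proof (cases "\<forall>c\<in>C. P c = 0")
      case True
      have C0: "el 0 y v \<in> C" if "v \<in> sw.slice C y" for y v
        using h(2)[OF that] True P_el[of "h y" y v] by (metis el_eq_iff cong_def mod_0 cong_refl)
      have "\<exists>m. lin e3 e4 (int i) m m (int j) \<in> S" for i j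
      proof -
        obtain v where v: "v \<in> slice S (int i)" "v = mult2 (int j) e4 \<or> v = mult2 (int j) e4 + e3"
          using half[of "mult2 (int j) e4" "int i"] by blast
        define k where "k = (if v = mult2 (int j) e4 then 0 else 1 :: int)"
        have k: "v = mult2 k e3 + mult2 (int j) e4" using v by (auto simp: k_def add.commute)
        obtain a where a: "a \<in> S" "P a = int i mod int p" "V a = v" using v(1) by (auto simp: slice_iff)
        \<comment> \<open>as \<open>q\<close> is odd, this is \<open>Q a\<close> modulo \<open>q\<close> and \<open>k\<close> modulo \<open>2\<close>\<close>
        define m where "m = Q a + int q * (Q a + k)"
        have "mult2 m e3 = mult2 k e3" using q by (auto simp: m_def mult2_def)
        then have "a = lin e3 e4 (int i) m m (int j)"
          unfolding lin_def using a SG k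
          by (intro el_eqI) (auto simp: m_def Q_mod)
        then show ?thesis using a by metis
      qed
      then obtain m where m: "\<And>i j. lin e3 e4 (int i) (m i j) (m i j) (int j) \<in> S" by metis
      define \<alpha> where "\<alpha> i j = (if i = 0 \<and> j = 0 then 0 else m i j)" for i j
      have "tiling_pV_qV e3 e4 \<alpha> S C"
      proof (rule tiling_pV_qVI[OF F b])
        show "lin e3 e4 (int i) (\<alpha> i j) (\<alpha> i j) (int j) \<in> S" for i j
          using m[of i j] one by (auto simp: \<alpha>_def lin_def el_0)
        show "lin e3 e4 0 (int i) (int j) 0 \<in> C" for i j
          unfolding lin_def by (rule C0) (simp add: line)
      qed
      moreover have "\<alpha> 0 0 = 0" by (simp add: \<alpha>_def)
      ultimately show ?thesis using b by blast
    next
      case False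
      then obtain c where c: "c \<in> C" "P c \<noteq> 0" by blast
      have Qconst: "Q a = Q a'" if a: "a \<in> S" "a' \<in> S" "V a + V a' = 0 \<or> V a + V a' = e3" for a a'
      proof (rule ccontr)
        assume ne: "Q a \<noteq> Q a'"
        have "V a + V a' \<in> sw.slice C (Q c)" using a e3 by auto
        then obtain b' where b': "b' \<in> C" "Q b' = Q c mod int q" "V b' = V a + V a'"
          by (auto simp: sw.slice_iff)
        have "P b' = P c" using b' c CG \<open>\<And>a a'. a \<in> C \<Longrightarrow> a' \<in> C \<Longrightarrow> Q a = Q a' \<Longrightarrow> P a = P a'\<close>
          by (metis Q_mod subsetD)
        then have "a = a'" using offs[OF a(1,2) one(2) b'(1)] b' c ne by (auto simp: ac_simps)
        then show False using ne by simp
      qed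
      define near where "near i a \<longleftrightarrow> a \<in> S \<and> (V a = mult2 (int i) e4 \<or> V a = mult2 (int i) e4 + e3)" for i :: nat and a
      define \<alpha> where "\<alpha> i = Q (SOME a. near i a)" for i
      have \<alpha>: "\<alpha> i = Q a" if "near i a" for i a
      proof -
        define b where "b = (SOME a. near i a)"
        have "near i b" unfolding b_def by (rule someI[of "near i", OF that])
        then have "V b + V a = 0 \<or> V b + V a = e3" "b \<in> S" "a \<in> S"
          using that unfolding near_def by (auto simp: ac_simps)
        then show ?thesis using Qconst unfolding \<alpha>_def b_def by metis
      qed
      define \<beta> where "\<beta> i j = (if mult2 (int i) e4 \<in> slice S (int j) then 0 else 1 :: int)" for i j :: nat
      define \<mu> where "\<mu> i = h (int i)" for i :: nat
      have "tiling_V_q_p_V e3 e4 \<alpha> \<beta> \<mu> S C"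
      proof (rule tiling_V_q_p_VI[OF F b])
        show "lin e3 e4 (int j) (\<alpha> i) (\<beta> i j) (int i) \<in> S" for i j
        proof -
          have "mult2 (\<beta> i j) e3 + mult2 (int i) e4 \<in> slice S (int j)"
            using half[of "mult2 (int i) e4" "int j"] by (auto simp: \<beta>_def add.commute)
          then obtain a where a: "a \<in> S" "P a = int j mod int p" "V a = mult2 (\<beta> i j) e3 + mult2 (int i) e4"
            by (auto simp: slice_iff)
          then have "near i a" by (auto simp: near_def \<beta>_def add.commute)
          then have "\<alpha> i = Q a" by (rule \<alpha>)
          then have "a = lin e3 e4 (int j) (\<alpha> i) (\<beta> i j) (int i)"
            unfolding lin_def using a subsetD[OF SG a(1)] by (intro el_eqI) (simp_all add: Q_mod)
          then show ?thesis using a by simp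
        qed
        show "lin e3 e4 (\<mu> i) (int i) (int j) 0 \<in> C" for i j
          unfolding lin_def \<mu>_def by (rule h(2)) (simp add: line)
      qed
      moreover have "\<alpha> 0 = 0" "\<beta> 0 0 = 0" "\<mu> 0 = 0"
        using \<alpha>[of 0 \<one>] one zero h by (simp_all add: near_def \<beta>_def \<mu>_def)
      ultimately show ?thesis using b by blast
    qed
  qed
qed

end

section \<open>Perfect codes, generators and coordinates\<close>

lemma (in comm_group) closed_out_nbhd_cayley:
  assumes "S \<subseteq> carrier G" "c \<in> carrier G"
  shows "closed_out_nbhd (cayley_digraph G S) c = (\<lambda>s. s \<otimes> c) ` insert \<one> S"
proof -
  have "{v. (c, v) \<in> parcs (cayley_digraph G S)} = (\<lambda>s. s \<otimes> c) ` S"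
  proof
    show "{v. (c, v) \<in> parcs (cayley_digraph G S)} \<subseteq> (\<lambda>s. s \<otimes> c) ` S"
    proof
      fix v assume "v \<in> {v. (c, v) \<in> parcs (cayley_digraph G S)}"
      then have v: "v \<in> carrier G" "v \<otimes> inv c \<in> S" by (auto simp: cayley_digraph_def)
      then have "v = (v \<otimes> inv c) \<otimes> c" using assms by (simp add: m_assoc)
      then show "v \<in> (\<lambda>s. s \<otimes> c) ` S" using v by blast
    qed
    show "(\<lambda>s. s \<otimes> c) ` S \<subseteq> {v. (c, v) \<in> parcs (cayley_digraph G S)}"
      using assms by (auto simp: cayley_digraph_def m_assoc subset_iff)
  qed
  then show ?thesis using assms by (simp add: closed_out_nbhd_def)
qed

text \<open>The closed out-neighbourhood of \<open>c\<close> is the translate of \<open>S\<^sub>0\<close> by \<open>c\<close>.\<close>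

lemma (in comm_group) perfect_code_iff_factorization:
  assumes S: "S \<subseteq> carrier G" and C: "C \<subseteq> carrier G"
  shows "perfect_code (cayley_digraph G S) C \<longleftrightarrow> factorization G (insert \<one> S) C"
proof -
  let ?S = "insert \<one> S" and ?N = "closed_out_nbhd (cayley_digraph G S)"
  have SG: "?S \<subseteq> carrier G" using S by auto
  have N: "?N c = (\<lambda>s. s \<otimes> c) ` ?S" if "c \<in> C" for c
    using closed_out_nbhd_cayley[OF S] that C by blast
  have un: "(\<Union>c\<in>C. ?N c) = (\<lambda>(s, c). s \<otimes> c) ` (?S \<times> C)"
    using N by (auto simp del: insert_iff)
  have "disjoint_family_on ?N C \<longleftrightarrow> inj_on (\<lambda>(s, c). s \<otimes> c) (?S \<times> C)"
  proof
    assume d: "disjoint_family_on ?N C"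
    show "inj_on (\<lambda>(s, c). s \<otimes> c) (?S \<times> C)"
    proof (rule inj_onI, clarify)
      fix s c s' c' assume m: "s \<in> ?S" "c \<in> C" "s' \<in> ?S" "c' \<in> C" "s \<otimes> c = s' \<otimes> c'"
      then have "s \<otimes> c \<in> ?N c \<inter> ?N c'" using N by blast
      then have "c = c'" using d m by (auto simp: disjoint_family_on_def)
      moreover have "s \<in> carrier G" "s' \<in> carrier G" "c' \<in> carrier G" using m SG C by auto
      ultimately show "s = s' \<and> c = c'" using m by simp
    qed
  next
    assume i: "inj_on (\<lambda>(s, c). s \<otimes> c) (?S \<times> C)"
    show "disjoint_family_on ?N C"
      unfolding disjoint_family_on_def
    proof (intro ballI impI, rule ccontr)
      fix c c' assume m: "c \<in> C" "c' \<in> C" "c \<noteq> c'" "?N c \<inter> ?N c' \<noteq> {}"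
      then obtain v where "v \<in> ?N c" "v \<in> ?N c'" by blast
      then have v: "v \<in> (\<lambda>s. s \<otimes> c) ` ?S" "v \<in> (\<lambda>s. s \<otimes> c') ` ?S"
        unfolding N[OF m(1)] N[OF m(2)] .
      obtain s where s: "s \<in> ?S" "v = s \<otimes> c" using v(1) by (rule imageE)
      obtain s' where s': "s' \<in> ?S" "v = s' \<otimes> c'" using v(2) by (rule imageE)
      have "(s, c) = (s', c')" by (rule inj_onD[OF i]) (use s s' m(1,2) in simp_all)
      then show False using m(3) by simp
    qed
  qed
  then show ?thesis
    using SG C un by (auto simp: perfect_code_def factorization_def bij_betw_def cayley_digraph_def)
qed

context pq_group
begin

interpretation sw: pq_group G q p Q P V by (rule swap)

lemma sw_lin: "sw.lin e3 e4 b a c d = lin e3 e4 a b c d"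
  by (simp add: lin_def sw.lin_def el_swap)

lemma inv_el: "inv (el a b v) = el (- a) (- b) v"
  by (rule inv_equality) (simp_all add: el_mult el_0)

lemma el_nat_pow: "el a b v [^] (n :: nat) = el (int n * a) (int n * b) (mult2 (int n) v)"
proof (induction n)
  case (Suc n)
  then show ?case by (simp add: el_mult mult2_add algebra_simps)
qed (simp add: el_0)

lemma el_int_pow: "el a b v [^] (n :: int) = el (n * a) (n * b) (mult2 n v)"
proof (cases n rule: int_cases2)
  case (nonneg k)
  then show ?thesis using el_nat_pow[of a b v k] by (simp add: int_pow_int)
next
  case (nonpos k)
  then have "el a b v [^] n = inv (el a b v [^] k)" by (simp add: int_pow_neg_int)
  then show ?thesis using nonpos by (simp add: el_nat_pow inv_el mult2_def)
qed

lemma lincomb_el: "lincomb G (el 1 0 0) (el 0 1 0) (el 0 0 v) (el 0 0 w) = lin v w"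
  by (intro ext) (simp add: lincomb_def el_int_pow el_mult lin_def mult2_def)

lemma inv_coords:
  assumes "g \<in> carrier G"
  shows "P g = 0 \<Longrightarrow> P (inv g) = 0" "Q g = 0 \<Longrightarrow> Q (inv g) = 0" "V (inv g) = V g"
proof -
  have "inv g = el (- P g) (- Q g) (V g)"
    using inv_el[of "P g" "Q g" "V g"] el_coords[OF assms] by simp
  then show "P g = 0 \<Longrightarrow> P (inv g) = 0" "Q g = 0 \<Longrightarrow> Q (inv g) = 0" "V (inv g) = V g" by simp_all
qed

lemma subgroup_P: "subgroup {g \<in> carrier G. P g = 0} G"
  by unfold_locales (auto simp: P_mult inv_coords)

lemma subgroup_V: "subgroup {g \<in> carrier G. V g = 0 \<or> V g = w} G"
  by unfold_locales (auto simp: V_mult inv_coords)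

lemma subgroup_klein: "subgroup {g \<in> carrier G. P g = 0 \<and> Q g = 0} G"
  by unfold_locales (auto simp: P_mult Q_mult inv_coords)

lemma generate_P: "S \<subseteq> carrier G \<Longrightarrow> generate G S = carrier G \<Longrightarrow> \<exists>a\<in>S. P a \<noteq> 0"
proof (rule ccontr)
  assume S: "S \<subseteq> carrier G" and gen: "generate G S = carrier G" and "\<not> (\<exists>a\<in>S. P a \<noteq> 0)"
  then have "S \<subseteq> {g \<in> carrier G. P g = 0}" by auto
  from generate_subgroup_incl[OF this subgroup_P] gen have "P (el 1 0 0) = 0" by auto
  then show False using p(1) prime_gt_1_nat[of p] by simp
qed

text \<open>The basis \<open>e3\<close>, \<open>e4\<close> of the theorem ranges over pairs of group elements, and bases of the Klein
group are pairs of coordinates; this identifies the two.\<close>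

lemma generate_klein_iff:
  assumes "e3 \<in> carrier G" "e4 \<in> carrier G"
  shows "generate G {e3, e4} = {g \<in> carrier G. P g = 0 \<and> Q g = 0} \<longleftrightarrow>
    e3 = el 0 0 (V e3) \<and> e4 = el 0 0 (V e4) \<and> basis (V e3) (V e4)" (is "?gen = ?K \<longleftrightarrow> _")
proof
  assume gen: "?gen = ?K"
  have "e3 \<in> ?K" "e4 \<in> ?K" unfolding gen[symmetric] by (auto intro: generate.incl)
  then have e: "e3 = el 0 0 (V e3)" "e4 = el 0 0 (V e4)" by (auto intro: el_eqI)
  have "basis (V e3) (V e4)"
  proof (rule ccontr)
    assume "\<not> basis (V e3) (V e4)"
    then obtain w where w: "w \<noteq> 0" "V e3 = 0 \<or> V e3 = w" "V e4 = 0 \<or> V e4 = w"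
      using basis_std unfolding basis_def by metis
    obtain w' where w': "basis w w'" using basis_extend[OF w(1)] by blast
    have "el 0 0 w' \<in> ?gen" unfolding gen by simp
    moreover have "?gen \<subseteq> {g \<in> carrier G. V g = 0 \<or> V g = w}"
      by (rule generate_subgroup_incl[OF _ subgroup_V]) (use w assms in auto)
    ultimately show False using w' by (auto simp: basis_def)
  qed
  with e show "e3 = el 0 0 (V e3) \<and> e4 = el 0 0 (V e4) \<and> basis (V e3) (V e4)" by blast
next
  assume "e3 = el 0 0 (V e3) \<and> e4 = el 0 0 (V e4) \<and> basis (V e3) (V e4)"
  then have e: "e3 = el 0 0 (V e3)" "e4 = el 0 0 (V e4)" and b: "basis (V e3) (V e4)" by auto
  have PQ: "P e3 = 0" "P e4 = 0" "Q e3 = 0" "Q e4 = 0"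
    using P_el Q_el e by (metis mod_0)+
  show "?gen = ?K"
  proof
    show "?gen \<subseteq> ?K"
      by (rule generate_subgroup_incl[OF _ subgroup_klein]) (use PQ assms in auto)
    show "?K \<subseteq> ?gen"
    proof
      fix g assume "g \<in> ?K"
      then have g: "g = el 0 0 (V g)" by (auto intro: el_eqI)
      have m: "\<one> \<in> ?gen" "e3 \<in> ?gen" "e4 \<in> ?gen" "e3 \<otimes> e4 \<in> ?gen"
        by (auto intro: generate.intros)
      have "e3 \<otimes> e4 = el 0 0 (V e3 + V e4)" using e el_mult[of 0 0 "V e3" 0 0 "V e4"] by simp
      moreover have "V g = 0 \<or> V g = V e3 \<or> V g = V e4 \<or> V g = V e3 + V e4"
        using klein_cases b by (auto simp: basis_def)
      ultimately show "g \<in> ?gen" using g e m el_0 by metis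
    qed
  qed
qed

end

context pq_group
begin

interpretation sw: pq_group G q p Q P V by (rule swap)

lemma generate_spans:
  assumes S: "S \<subseteq> carrier G" and gen: "generate G S = carrier G"
  shows "spans (insert \<one> S)"
  unfolding spans_def
proof (intro conjI allI)
  show "\<exists>a\<in>insert \<one> S. P a \<noteq> 0" using generate_P[OF S gen] by blast
  show "\<exists>a\<in>insert \<one> S. Q a \<noteq> 0" using sw.generate_P[OF S gen] by blast
  show "\<exists>a\<in>insert \<one> S. V a \<noteq> 0 \<and> V a \<noteq> w" for w
  proof (rule ccontr)
    assume "\<not> ?thesis"
    then have "S \<subseteq> {g \<in> carrier G. V g = 0 \<or> V g = w}" using S by auto
    from generate_subgroup_incl[OF this subgroup_V] gen have "V (el 0 0 v) = 0 \<or> V (el 0 0 v) = w" for v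
      by auto
    then have "(UNIV :: klein set) \<subseteq> {0, w}" by auto
    then have "card (UNIV :: klein set) \<le> card {0, w}" by (rule card_mono[rotated]) simp
    then show False using card_klein by (auto simp: card_insert_if split: if_splits)
  qed
qed

lemma sw_spans: "spans S \<Longrightarrow> sw.spans S"
  by (auto simp: spans_def sw.spans_def)

text \<open>The order of \<open>S\<close> divides \<open>4 p q\<close>. Order \<open>1\<close> or \<open>2\<close> is impossible because \<open>S\<close> spans, and a singleton \<open>C\<close>
would force \<open>S\<close> to be everything.\<close>

lemma factor_cards:
  assumes F: "factorization G S C" and S: "spans S" "\<one> \<in> S" and C: "\<one> \<in> C" and ne: "S \<noteq> carrier G"
  shows "card S = p \<or> card S = q \<or> card C = p \<or> card C = q \<or> card S = 4 \<or> card C = 4 \<or> card C = 2 \<or>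
    card S = 2 * p \<or> card S = 2 * q"
proof -
  have m: "card S * card C = 4 * p * q" using factorization_card[OF F] card_G by simp
  have SG: "S \<subseteq> carrier G" and CG: "C \<subseteq> carrier G" using F by (auto simp: factorization_def)
  have "card S dvd 4 * (p * q)" using m by (metis dvd_triv_left mult.assoc)
  then obtain a b where ab: "card S = a * b" "a dvd 4" "b dvd p * q" using division_decomp by blast
  then obtain c d where cd: "b = c * d" "c dvd p" "d dvd q" using division_decomp by blast
  have c: "c = 1 \<or> c = p" and d: "d = 1 \<or> d = q"
    using cd p(1) q(1) by (auto simp: prime_nat_iff)
  have "a \<le> 4" using ab(2) by (rule dvd_imp_le) simp
  then have "a = 0 \<or> a = 1 \<or> a = 2 \<or> a = 3 \<or> a = 4" by arith
  then have a: "a = 1 \<or> a = 2 \<or> a = 4" using ab(2) by auto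
  have "card S \<noteq> 1"
  proof
    assume "card S = 1"
    then have "S = {\<one>}" using S(2) by (metis card_1_singletonE singletonD)
    then show False using S(1) by (auto simp: spans_def)
  qed
  moreover have "card S \<noteq> 2"
  proof
    assume "card S = 2"
    then obtain s where "S = {\<one>, s}" using S(2) by (metis card_2_iff doubleton_eq_iff insertE singletonD)
    then show False using S(1) by (auto simp: spans_def)
  qed
  moreover have "card C \<noteq> 1"
  proof
    assume "card C = 1"
    then have "card S = card (carrier G)" using m card_G by simp
    then show False using ne card_subset_eq[OF finite_G SG] by blast
  qed
  moreover have "card S = 1 \<or> card S = 2 \<or> card S = 4 \<or> card S = p \<or> card S = 2 * p \<or> card S = 4 * p \<or>
      card S = q \<or> card S = 2 * q \<or> card S = 4 * q \<or> card S = p * q \<or> card S = 2 * (p * q) \<or> card S = 4 * (p * q)"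
    unfolding ab(1) cd(1) using a c d by (elim disjE) simp_all
  moreover have "card S = 4 * p \<Longrightarrow> card C = q" "card S = 4 * q \<Longrightarrow> card C = p" "card S = p * q \<Longrightarrow> card C = 4"
      "card S = 2 * (p * q) \<Longrightarrow> card C = 2" "card S = 4 * (p * q) \<Longrightarrow> card C = 1"
    using m p_pos(1) q_pos(1) by simp_all
  ultimately show ?thesis by blast
qed

end

text \<open>The Klein group of the coordinates is a type, the components of the concrete group are the
integers \<open>0\<close> and \<open>1\<close>.\<close>

definition parity_bit :: "int \<Rightarrow> bit" where
  "parity_bit u = (if even u then 0 else 1)"

lemma parity_bit_add: "parity_bit ((u + v) mod 2) = parity_bit u + parity_bit v"
  by (auto simp: parity_bit_def)

lemma parity_bit_inj: "u \<in> {0..<2} \<Longrightarrow> v \<in> {0..<2} \<Longrightarrow> parity_bit u = parity_bit v \<Longrightarrow> u = v"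
  by (auto simp: parity_bit_def split: if_splits) presburger+

lemma parity_bit_surj: "\<exists>u\<in>{0..<2}. parity_bit u = b"
proof -
  have "b = 0 \<or> b = 1" by (cases b) auto
  moreover have "parity_bit 0 = 0" "parity_bit 1 = 1" by (auto simp: parity_bit_def)
  ultimately show ?thesis by (metis atLeastLessThan_iff less_numeral_extra(1) one_less_numeral_iff order_refl
        semiring_norm(76) zero_le_one zero_less_numeral)
qed

lemma pq_group_Zpq22:
  assumes "prime p" "prime q" "odd p" "odd q" "p \<noteq> q"
  shows "pq_group (Zpq22 p q) p q fst (\<lambda>g. fst (snd g))
    (\<lambda>g. (parity_bit (fst (snd (snd g))), parity_bit (snd (snd (snd g)))))"
proof -
  have pos: "p > 0" "q > 0" using assms prime_gt_0_nat by auto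
  have car: "carrier (Zpq22 p q) = {0..<int p} \<times> {0..<int q} \<times> {0..<2} \<times> {0..<2}"
    using pos by (simp add: Zpq22_def carrier_integer_mod_group)
  have mult: "x \<otimes>\<^bsub>Zpq22 p q\<^esub> y =
    ((fst x + fst y) mod int p, (fst (snd x) + fst (snd y)) mod int q,
     (fst (snd (snd x)) + fst (snd (snd y))) mod 2, (snd (snd (snd x)) + snd (snd (snd y))) mod 2)" for x y
    by (simp add: Zpq22_def mult_DirProd')
  have grp: "group (Zpq22 p q)"
    unfolding Zpq22_def by (intro DirProd_group group_integer_mod_group)
  have "comm_group (Zpq22 p q)"
    by (rule group.group_comm_groupI[OF grp]) (simp add: mult add.commute)
  then interpret comm_group "Zpq22 p q" .
  show ?thesis
  proof unfold_locales
    show "bij_betw (\<lambda>g. (fst g, fst (snd g), parity_bit (fst (snd (snd g))), parity_bit (snd (snd (snd g)))))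
      (carrier (Zpq22 p q)) ({0..<int p} \<times> {0..<int q} \<times> UNIV)"
      unfolding bij_betw_def
    proof
      show "inj_on (\<lambda>g. (fst g, fst (snd g), parity_bit (fst (snd (snd g))), parity_bit (snd (snd (snd g)))))
        (carrier (Zpq22 p q))"
        unfolding car by (rule inj_onI) (auto dest: parity_bit_inj)
      show "(\<lambda>g. (fst g, fst (snd g), parity_bit (fst (snd (snd g))), parity_bit (snd (snd (snd g))))) `
        carrier (Zpq22 p q) = {0..<int p} \<times> {0..<int q} \<times> UNIV"
      proof
        show "{0..<int p} \<times> {0..<int q} \<times> UNIV \<subseteq>
          (\<lambda>g. (fst g, fst (snd g), parity_bit (fst (snd (snd g))), parity_bit (snd (snd (snd g))))) ` carrier (Zpq22 p q)"
        proof clarify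
          fix a b c d assume ab: "a \<in> {0..<int p}" "b \<in> {0..<int q}"
          obtain u v where uv: "u \<in> {0..<2}" "v \<in> {0..<2}" "parity_bit u = c" "parity_bit v = d"
            using parity_bit_surj[of c] parity_bit_surj[of d] by blast
          then show "(a, b, c, d) \<in> (\<lambda>g. (fst g, fst (snd g), parity_bit (fst (snd (snd g))),
              parity_bit (snd (snd (snd g))))) ` carrier (Zpq22 p q)"
            using ab unfolding car by (intro image_eqI[of _ _ "(a, b, u, v)"]) auto
        qed
      qed (auto simp: car)
    qed
  qed (use assms in \<open>auto simp: mult parity_bit_add\<close>)
qed

section \<open>The classification\<close>

theorem theorem6p2:
  fixes p q :: nat and G :: "(int \<times> int \<times> int \<times> int) monoid"
    and S C :: "(int \<times> int \<times> int \<times> int) set"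
  assumes "prime p" and "prime q" and "odd p" and "odd q" and "p \<noteq> q"
    and "G = Zpq22 p q"
    and "S \<subset> carrier G - {\<one>\<^bsub>G\<^esub>}"
    and "generate G S = carrier G"
    and "\<one>\<^bsub>G\<^esub> \<in> C" and "C \<subseteq> carrier G"
  shows "perfect_code (cayley_digraph G S) C \<longleftrightarrow>
    (\<exists>e3 \<in> carrier G. \<exists>e4 \<in> carrier G.
      generate G {e3, e4} = {0} \<times> {0} \<times> {0, 1} \<times> {0, 1} \<and>
      (\<exists>(\<alpha>\<^sub>1 :: nat \<Rightarrow> int) (\<alpha>\<^sub>2 :: nat \<Rightarrow> nat \<Rightarrow> int) (\<alpha>\<^sub>3 :: nat \<Rightarrow> nat \<Rightarrow> nat \<Rightarrow> int)
         (\<beta>\<^sub>1 :: nat \<Rightarrow> int) (\<beta>\<^sub>2 :: nat \<Rightarrow> nat \<Rightarrow> int) (\<gamma>\<^sub>1 :: nat \<Rightarrow> int)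
         (\<Lambda>\<^sub>1 :: nat \<Rightarrow> int) (\<Lambda>\<^sub>2 :: nat \<Rightarrow> nat \<Rightarrow> int) (\<mu>\<^sub>1 :: nat \<Rightarrow> int).
        \<alpha>\<^sub>1 0 = 0 \<and> \<alpha>\<^sub>2 0 0 = 0 \<and> \<alpha>\<^sub>3 0 0 0 = 0 \<and> \<beta>\<^sub>1 0 = 0 \<and> \<beta>\<^sub>2 0 0 = 0 \<and> \<gamma>\<^sub>1 0 = 0 \<and>
        \<Lambda>\<^sub>1 0 = 0 \<and> \<Lambda>\<^sub>2 0 0 = 0 \<and> \<mu>\<^sub>1 0 = 0 \<and>
        (let S0 = insert \<one>\<^bsub>G\<^esub> S; L = lincomb G (1, 0, 0, 0) (0, 1, 0, 0) e3 e4 in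
          (S0 = {L (int i) (\<alpha>\<^sub>1 i) (\<beta>\<^sub>1 i) (\<gamma>\<^sub>1 i) | i. i < p} \<and>
            C = {L 0 (int i) (int j) (int k) | i j k. i < q \<and> j < 2 \<and> k < 2}) \<or>
          (S0 = {L (\<alpha>\<^sub>1 i) (int i) (\<beta>\<^sub>1 i) (\<gamma>\<^sub>1 i) | i. i < q} \<and>
            C = {L (int i) 0 (int j) (int k) | i j k. i < p \<and> j < 2 \<and> k < 2}) \<or>
          (S0 = {L (int j) (int i) (\<alpha>\<^sub>1 i) (\<beta>\<^sub>1 i) | i j. i < q \<and> j < p} \<and>
            C = {L (\<Lambda>\<^sub>2 i j) 0 (int i) (int j) | i j. i < 2 \<and> j < 2}) \<or>
          (S0 = {L (int i) (int j) (\<alpha>\<^sub>1 i) (\<beta>\<^sub>1 i) | i j. i < p \<and> j < q} \<and>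
            C = {L 0 (\<Lambda>\<^sub>2 i j) (int i) (int j) | i j. i < 2 \<and> j < 2}) \<or>
          (S0 = {L (int j) (int i) (\<alpha>\<^sub>2 i j) (\<alpha>\<^sub>1 i) | i j. i < q \<and> j < p} \<and>
            C = {L (\<Lambda>\<^sub>1 i) 0 (int j) (int i) | i j. i < 2 \<and> j < 2}) \<or>
          (S0 = {L (int i) (int j) (\<alpha>\<^sub>2 i j) (\<alpha>\<^sub>1 i) | i j. i < p \<and> j < q} \<and>
            C = {L 0 (\<Lambda>\<^sub>1 i) (int j) (int i) | i j. i < 2 \<and> j < 2}) \<or>
          (S0 = {L (int i) (int j) (\<alpha>\<^sub>2 i j) (\<beta>\<^sub>2 i j) | i j. i < p \<and> j < q} \<and>
            C = {L 0 0 (int i) (int j) | i j. i < 2 \<and> j < 2}) \<or>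
          (S0 = {L (int i) (\<alpha>\<^sub>1 i) (int j) (\<beta>\<^sub>1 i) | i j. i < p \<and> j < 2} \<and>
            C = {L 0 (int i) (\<Lambda>\<^sub>2 i j) (int j) | i j. i < q \<and> j < 2}) \<or>
          (S0 = {L (int j) (\<alpha>\<^sub>1 i) (\<alpha>\<^sub>2 i j) (int i) | i j. i < 2 \<and> j < p} \<and>
            C = {L (\<Lambda>\<^sub>1 i) (int i) (int j) 0 | i j. i < q \<and> j < 2}) \<or>
          (S0 = {L (int i) (\<alpha>\<^sub>1 i) (\<alpha>\<^sub>2 i j) (int j) | i j. i < p \<and> j < 2} \<and>
            C = {L 0 (int i) (int j) (\<Lambda>\<^sub>1 i) | i j. i < q \<and> j < 2}) \<or>
          (S0 = {L (int i) (\<alpha>\<^sub>2 i j) (int j) (\<alpha>\<^sub>1 i) | i j. i < p \<and> j < 2} \<and>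
            C = {L 0 (int j) (\<Lambda>\<^sub>1 i) (int i) | i j. i < 2 \<and> j < q}) \<or>
          (S0 = {L (int i) (\<alpha>\<^sub>2 i j) (\<alpha>\<^sub>2 i j) (int j) | i j. i < p \<and> j < 2} \<and>
            C = {L 0 (int i) (int j) 0 | i j. i < q \<and> j < 2}) \<or>
          (S0 = {L (\<alpha>\<^sub>1 i) (int i) (int j) (\<beta>\<^sub>1 i) | i j. i < q \<and> j < 2} \<and>
            C = {L (int i) 0 (\<Lambda>\<^sub>2 i j) (int j) | i j. i < p \<and> j < 2}) \<or>
          (S0 = {L (\<alpha>\<^sub>1 i) (int j) (\<alpha>\<^sub>2 i j) (int i) | i j. i < 2 \<and> j < q} \<and>
            C = {L (int i) (\<Lambda>\<^sub>1 i) (int j) 0 | i j. i < p \<and> j < 2}) \<or>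
          (S0 = {L (\<alpha>\<^sub>1 i) (int i) (\<alpha>\<^sub>2 i j) (int j) | i j. i < q \<and> j < 2} \<and>
            C = {L (int i) 0 (int j) (\<Lambda>\<^sub>1 i) | i j. i < p \<and> j < 2}) \<or>
          (S0 = {L (\<alpha>\<^sub>2 i j) (int i) (int j) (\<alpha>\<^sub>1 i) | i j. i < q \<and> j < 2} \<and>
            C = {L (int j) 0 (\<Lambda>\<^sub>1 i) (int i) | i j. i < 2 \<and> j < p}) \<or>
          (S0 = {L (\<alpha>\<^sub>2 i j) (int i) (\<alpha>\<^sub>2 i j) (int j) | i j. i < q \<and> j < 2} \<and>
            C = {L (int i) 0 (int j) 0 | i j. i < p \<and> j < 2}) \<or>
          (S0 = {L (\<alpha>\<^sub>1 i) (\<beta>\<^sub>1 i) (int j) (int i) | i j. i < 2 \<and> j < 2} \<and>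
            C = {L (int i) (int j) (\<Lambda>\<^sub>2 i j) 0 | i j. i < p \<and> j < q}) \<or>
          (S0 = {L (\<alpha>\<^sub>2 i j) (\<alpha>\<^sub>1 i) (int j) (int i) | i j. i < 2 \<and> j < 2} \<and>
            C = {L (int j) (int i) (\<Lambda>\<^sub>1 i) 0 | i j. i < q \<and> j < p}) \<or>
          (S0 = {L (\<alpha>\<^sub>1 i) (\<alpha>\<^sub>2 i j) (int j) (int i) | i j. i < 2 \<and> j < 2} \<and>
            C = {L (int i) (int j) (\<Lambda>\<^sub>1 i) 0 | i j. i < p \<and> j < q}) \<or>
          (S0 = {L (\<alpha>\<^sub>2 i j) (\<alpha>\<^sub>2 i j) (int i) (int j) | i j. i < 2 \<and> j < 2} \<and>
            C = {L (int i) (int j) 0 0 | i j. i < p \<and> j < q}) \<or>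
          (S0 = {L (int i) (int j) (int k) (\<alpha>\<^sub>2 i j) | i j k. i < p \<and> j < q \<and> k < 2} \<and>
            C = {L 0 0 (\<Lambda>\<^sub>1 i) (int i) | i. i < 2}) \<or>
          (S0 = {L (int k) (int i) (\<alpha>\<^sub>2 i j) (int j) | i j k. i < q \<and> j < 2 \<and> k < p} \<and>
            C = {L (\<Lambda>\<^sub>1 i) 0 (int i) 0 | i. i < 2}) \<or>
          (S0 = {L (int i) (int k) (\<alpha>\<^sub>2 i j) (int j) | i j k. i < p \<and> j < 2 \<and> k < q} \<and>
            C = {L 0 (\<Lambda>\<^sub>1 i) (int i) 0 | i. i < 2}) \<or>
          (S0 = {L (int j) (int i) (int k) (\<alpha>\<^sub>1 i) | i j k. i < q \<and> j < p \<and> k < 2} \<and>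
            C = {L (\<Lambda>\<^sub>1 i) 0 (\<Lambda>\<^sub>1 i) (int i) | i. i < 2}) \<or>
          (S0 = {L (int i) (int j) (int k) (\<alpha>\<^sub>1 i) | i j k. i < p \<and> j < q \<and> k < 2} \<and>
            C = {L 0 (\<Lambda>\<^sub>1 i) (\<Lambda>\<^sub>1 i) (int i) | i. i < 2}) \<or>
          (S0 = {L (int i) (int j) (\<alpha>\<^sub>3 i j k) (int k) | i j k. i < p \<and> j < q \<and> k < 2} \<and>
            C = {L 0 0 (int i) 0 | i. i < 2}) \<or>
          (S0 = {L (int i) (\<alpha>\<^sub>2 i j) (int k) (int j) | i j k. i < p \<and> j < 2 \<and> k < 2} \<and>
            C = {L 0 (int i) (\<Lambda>\<^sub>1 i) 0 | i. i < q}) \<or>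
          (S0 = {L (int k) (\<alpha>\<^sub>2 i j) (int i) (int j) | i j k. i < 2 \<and> j < 2 \<and> k < p} \<and>
            C = {L (\<Lambda>\<^sub>1 i) (int i) 0 0 | i. i < q}) \<or>
          (S0 = {L (int i) (\<alpha>\<^sub>1 i) (int j) (int k) | i j k. i < p \<and> j < 2 \<and> k < 2} \<and>
            C = {L 0 (int i) (\<Lambda>\<^sub>1 i) (\<mu>\<^sub>1 i) | i. i < q}) \<or>
          (S0 = {L (int j) (\<alpha>\<^sub>1 i) (int k) (int i) | i j k. i < 2 \<and> k < 2 \<and> j < p} \<and>
            C = {L (\<Lambda>\<^sub>1 i) (int i) (\<Lambda>\<^sub>1 i) 0 | i. i < q}) \<or>
          (S0 = {L (int i) (\<alpha>\<^sub>3 i j k) (int j) (int k) | i j k. i < p \<and> j < 2 \<and> k < 2} \<and>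
            C = {L 0 (int i) 0 0 | i. i < q}) \<or>
          (S0 = {L (\<alpha>\<^sub>2 i j) (int i) (int k) (int j) | i j k. i < q \<and> j < 2 \<and> k < 2} \<and>
            C = {L (int i) 0 (\<Lambda>\<^sub>1 i) 0 | i. i < p}) \<or>
          (S0 = {L (\<alpha>\<^sub>2 i j) (int k) (int i) (int j) | i j k. i < 2 \<and> j < 2 \<and> k < q} \<and>
            C = {L (int i) (\<Lambda>\<^sub>1 i) 0 0 | i. i < p}) \<or>
          (S0 = {L (\<alpha>\<^sub>1 i) (int i) (int j) (int k) | i j k. i < q \<and> j < 2 \<and> k < 2} \<and>
            C = {L (int i) 0 (\<Lambda>\<^sub>1 i) (\<mu>\<^sub>1 i) | i. i < p}) \<or>
          (S0 = {L (\<alpha>\<^sub>1 i) (int j) (int k) (int i) | i j k. i < 2 \<and> k < 2 \<and> j < q} \<and>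
            C = {L (int i) (\<Lambda>\<^sub>1 i) (\<Lambda>\<^sub>1 i) 0 | i. i < p}) \<or>
          (S0 = {L (\<alpha>\<^sub>3 i j k) (int i) (int j) (int k) | i j k. i < q \<and> j < 2 \<and> k < 2} \<and>
            C = {L (int i) 0 0 0 | i. i < p}))))"
    (is "_ \<longleftrightarrow> ?rhs"
     is "_ \<longleftrightarrow> (\<exists>e3 \<in> _. \<exists>e4 \<in> _. ?gen e3 e4 \<and>
       (\<exists>\<alpha>\<^sub>1 \<alpha>\<^sub>2 \<alpha>\<^sub>3 \<beta>\<^sub>1 \<beta>\<^sub>2 \<gamma>\<^sub>1 \<Lambda>\<^sub>1 \<Lambda>\<^sub>2 \<mu>\<^sub>1.
         \<alpha>\<^sub>1 0 = 0 \<and> \<alpha>\<^sub>2 0 0 = 0 \<and> \<alpha>\<^sub>3 0 0 0 = 0 \<and> \<beta>\<^sub>1 0 = 0 \<and> \<beta>\<^sub>2 0 0 = 0 \<and> \<gamma>\<^sub>1 0 = 0 \<and>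
         \<Lambda>\<^sub>1 0 = 0 \<and> \<Lambda>\<^sub>2 0 0 = 0 \<and> \<mu>\<^sub>1 0 = 0 \<and>
         (let S0 = _; L = lincomb G (1, 0, 0, 0) (0, 1, 0, 0) e3 e4 in
           ?D S0 L \<alpha>\<^sub>1 \<alpha>\<^sub>2 \<alpha>\<^sub>3 \<beta>\<^sub>1 \<beta>\<^sub>2 \<gamma>\<^sub>1 \<Lambda>\<^sub>1 \<Lambda>\<^sub>2 \<mu>\<^sub>1)))")
proof -
  define P Q :: "int \<times> int \<times> int \<times> int \<Rightarrow> int" where "P = fst" and "Q = (\<lambda>g. fst (snd g))"
  define V :: "int \<times> int \<times> int \<times> int \<Rightarrow> klein" where
    "V = (\<lambda>g. (parity_bit (fst (snd (snd g))), parity_bit (snd (snd (snd g)))))"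
  interpret pq_group G p q P Q V
    unfolding assms(6) P_def Q_def V_def using assms(1-5) by (rule pq_group_Zpq22)
  interpret sw: pq_group G q p Q P V by (rule swap)
  define S0 where "S0 = insert \<one>\<^bsub>G\<^esub> S"
  have SG: "S \<subseteq> carrier G" using assms(7) by blast
  have car: "carrier G = {0..<int p} \<times> {0..<int q} \<times> {0..<2} \<times> {0..<2}"
    by (simp add: assms(6) Zpq22_def carrier_integer_mod_group)
  have gt1: "p > 1" "q > 1" using p(1) q(1) prime_gt_1_nat by auto
  have unit: "(1, 0, 0, 0) = el 1 0 0" "(0, 1, 0, 0) = el 0 1 0"
  proof -
    have "P (1, 0, 0, 0) = 1" "Q (1, 0, 0, 0) = 0" "V (1, 0, 0, 0) = 0"
      "P (0, 1, 0, 0) = 0" "Q (0, 1, 0, 0) = 1" "V (0, 1, 0, 0) = 0"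
      by (simp_all add: P_def Q_def V_def parity_bit_def zero_prod_def)
    then show "(1, 0, 0, 0) = el 1 0 0" "(0, 1, 0, 0) = el 0 1 0"
      using gt1 by (auto intro!: el_eqI simp: car)
  qed
  have klein: "{0} \<times> {0} \<times> {0, 1} \<times> {0, 1} = {g \<in> carrier G. P g = 0 \<and> Q g = 0}"
  proof -
    have "{0..<2} = {0, 1 :: int}" by auto
    then show ?thesis unfolding car P_def Q_def using gt1 by fastforce
  qed
  have code: "perfect_code (cayley_digraph G S) C \<longleftrightarrow> factorization G S0 C"
    unfolding S0_def by (rule perfect_code_iff_factorization[OF SG assms(10)])
  show ?thesis
    unfolding code
  proof
    assume ?rhs
    then show "factorization G S0 C"
    proof (unfold Let_def S0_def [symmetric], elim bexE conjE exE)
      fix e3 e4 \<alpha>\<^sub>1 \<alpha>\<^sub>2 \<alpha>\<^sub>3 \<beta>\<^sub>1 \<beta>\<^sub>2 \<gamma>\<^sub>1 \<Lambda>\<^sub>1 \<Lambda>\<^sub>2 \<mu>\<^sub>1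
      assume e: "e3 \<in> carrier G" "e4 \<in> carrier G" "?gen e3 e4"
        and D: "?D S0 (lincomb G (1, 0, 0, 0) (0, 1, 0, 0) e3 e4) \<alpha>\<^sub>1 \<alpha>\<^sub>2 \<alpha>\<^sub>3 \<beta>\<^sub>1 \<beta>\<^sub>2 \<gamma>\<^sub>1 \<Lambda>\<^sub>1 \<Lambda>\<^sub>2 \<mu>\<^sub>1"
      from e(3) have e34: "e3 = el 0 0 (V e3)" "e4 = el 0 0 (V e4)" and b: "basis (V e3) (V e4)"
        unfolding klein generate_klein_iff[OF e(1,2)] by blast+
      have "lincomb G (1, 0, 0, 0) (0, 1, 0, 0) e3 e4 = lin (V e3) (V e4)"
        unfolding unit using lincomb_el[of "V e3" "V e4"] e34 by simp
      with D have D': "?D S0 (lin (V e3) (V e4)) \<alpha>\<^sub>1 \<alpha>\<^sub>2 \<alpha>\<^sub>3 \<beta>\<^sub>1 \<beta>\<^sub>2 \<gamma>\<^sub>1 \<Lambda>\<^sub>1 \<Lambda>\<^sub>2 \<mu>\<^sub>1" by simp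
      from D' show "factorization G S0 C"
        by (elim disjE)
          (erule sw.factorization_q_pVV[OF b, unfolded sw.tiling_q_pVV_def sw_lin],
           erule factorization_q_pVV[OF b, unfolded tiling_q_pVV_def],
           erule factorization_q_VV_p[OF b, unfolded tiling_q_VV_p_def],
           erule sw.factorization_q_VV_p[OF b, unfolded sw.tiling_q_VV_p_def sw_lin],
           erule factorization_q_V_p_V[OF b, unfolded tiling_q_V_p_V_def],
           erule sw.factorization_q_V_p_V[OF b, unfolded sw.tiling_q_V_p_V_def sw_lin],
           erule factorization_pq_VV[OF b, unfolded tiling_pq_VV_def],
           erule factorization_p_qV_V[OF b, unfolded tiling_p_qV_V_def],
           erule factorization_V_q_p_V[OF b, unfolded tiling_V_q_p_V_def],
           erule factorization_p_q_V_V[OF b, unfolded tiling_p_q_V_V_def],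
           erule factorization_p_V_V_q[OF b, unfolded tiling_p_V_V_q_def],
           erule factorization_pV_qV[OF b, unfolded tiling_pV_qV_def],
           erule sw.factorization_p_qV_V[OF b, unfolded sw.tiling_p_qV_V_def sw_lin],
           erule sw.factorization_V_q_p_V[OF b, unfolded sw.tiling_V_q_p_V_def sw_lin],
           erule sw.factorization_p_q_V_V[OF b, unfolded sw.tiling_p_q_V_V_def sw_lin],
           erule sw.factorization_p_V_V_q[OF b, unfolded sw.tiling_p_V_V_q_def sw_lin],
           erule sw.factorization_pV_qV[OF b, unfolded sw.tiling_pV_qV_def sw_lin],
           erule factorization_V_pq_V[OF b, unfolded tiling_V_pq_V_def],
           erule factorization_V_q_V_p[OF b, unfolded tiling_V_q_V_p_def],
           erule sw.factorization_V_q_V_p[OF b, unfolded sw.tiling_V_q_V_p_def sw_lin],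
           erule factorization_VV_pq[OF b, unfolded tiling_VV_pq_def],
           erule factorization_pq_V_V[OF b, unfolded tiling_pq_V_V_def],
           erule factorization_qV_V_p[OF b, unfolded tiling_qV_V_p_def],
           erule sw.factorization_qV_V_p[OF b, unfolded sw.tiling_qV_V_p_def sw_lin],
           erule factorization_q_V_pV[OF b, unfolded tiling_q_V_pV_def],
           erule sw.factorization_q_V_pV[OF b, unfolded sw.tiling_q_V_pV_def sw_lin],
           erule factorization_pqV_V[OF b, unfolded tiling_pqV_V_def],
           erule factorization_pV_q_V[OF b, unfolded tiling_pV_q_V_def],
           erule factorization_VV_q_p[OF b, unfolded tiling_VV_q_p_def],
           erule factorization_p_q_VV[OF b, unfolded tiling_p_q_VV_def],
           erule factorization_V_q_pV[OF b, unfolded tiling_V_q_pV_def],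
           erule factorization_pVV_q[OF b, unfolded tiling_pVV_q_def],
           erule sw.factorization_pV_q_V[OF b, unfolded sw.tiling_pV_q_V_def sw_lin],
           erule sw.factorization_VV_q_p[OF b, unfolded sw.tiling_VV_q_p_def sw_lin],
           erule sw.factorization_p_q_VV[OF b, unfolded sw.tiling_p_q_VV_def sw_lin],
           erule sw.factorization_V_q_pV[OF b, unfolded sw.tiling_V_q_pV_def sw_lin],
           erule sw.factorization_pVV_q[OF b, unfolded sw.tiling_pVV_q_def sw_lin])
    qed
  next
    assume F: "factorization G S0 C"
    have one: "\<one>\<^bsub>G\<^esub> \<in> S0" "\<one>\<^bsub>G\<^esub> \<in> C" using assms(9) by (auto simp: S0_def)
    have spans: "spans S0" unfolding S0_def by (rule generate_spans[OF SG assms(8)])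
    have "S0 \<noteq> carrier G" using assms(7) unfolding S0_def by blast
    note cards = factor_cards[OF F spans one this]
    \<comment> \<open>a pair in normal form uses some of the nine parameter families; the others are set to zero\<close>
    have rhsI: ?rhs
      if b: "basis e3 e4" and zero: "a1 0 = 0" "a2 0 0 = 0" "a3 0 0 0 = 0" "b1 0 = 0" "b2 0 0 = 0" "g1 0 = 0"
        "l1 0 = 0" "l2 0 0 = 0" "m1 0 = 0"
        and D: "?D S0 (lin e3 e4) a1 a2 a3 b1 b2 g1 l1 l2 m1"
      for e3 e4 a1 a2 a3 b1 b2 g1 l1 l2 m1
    proof -
      have gen: "?gen (el 0 0 e3) (el 0 0 e4)"
        unfolding klein generate_klein_iff[OF el_closed el_closed] using b by simp
      show ?rhs
        unfolding Let_def
        by (rule bexI[of _ "el 0 0 e3"], rule bexI[of _ "el 0 0 e4"], rule conjI, rule gen, rule exI[of _ a1],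
            rule exI[of _ a2], rule exI[of _ a3], rule exI[of _ b1], rule exI[of _ b2], rule exI[of _ g1],
            rule exI[of _ l1], rule exI[of _ l2], rule exI[of _ m1])
          (use zero D in \<open>simp_all only: unit lincomb_el S0_def el_closed simp_thms\<close>)
    qed
    let ?z1 = "\<lambda>_ :: nat. 0 :: int" and ?z2 = "\<lambda>_ _ :: nat. 0 :: int" and ?z3 = "\<lambda>_ _ _ :: nat. 0 :: int"

    have sw_q_pVV: ?rhs
      if "sw.tiling_q_pVV e3 e4 \<alpha> \<beta> \<gamma> S0 C" "basis e3 e4" "\<alpha> 0 = 0" "\<beta> 0 = 0" "\<gamma> 0 = 0" for e3 e4 \<alpha> \<beta> \<gamma>
      by (rule rhsI[of e3 e4 \<alpha> ?z2 ?z3 \<beta> ?z2 \<gamma> ?z1 ?z2 ?z1])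
        (use that in \<open>simp_all only: sw.tiling_q_pVV_def sw_lin simp_thms\<close>)

    have q_pVV: ?rhs
      if "tiling_q_pVV e3 e4 \<alpha> \<beta> \<gamma> S0 C" "basis e3 e4" "\<alpha> 0 = 0" "\<beta> 0 = 0" "\<gamma> 0 = 0" for e3 e4 \<alpha> \<beta> \<gamma>
      by (rule rhsI[of e3 e4 \<alpha> ?z2 ?z3 \<beta> ?z2 \<gamma> ?z1 ?z2 ?z1])
        (use that in \<open>simp_all only: tiling_q_pVV_def simp_thms\<close>)

    have q_VV_p: ?rhs
      if "tiling_q_VV_p e3 e4 \<alpha> \<beta> \<mu> S0 C" "basis e3 e4" "\<alpha> 0 = 0" "\<beta> 0 = 0" "\<mu> 0 0 = 0" for e3 e4 \<alpha> \<beta> \<mu>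
      by (rule rhsI[of e3 e4 \<alpha> ?z2 ?z3 \<beta> ?z2 ?z1 ?z1 \<mu> ?z1])
        (use that in \<open>simp_all only: tiling_q_VV_p_def simp_thms\<close>)

    have sw_q_VV_p: ?rhs
      if "sw.tiling_q_VV_p e3 e4 \<alpha> \<beta> \<mu> S0 C" "basis e3 e4" "\<alpha> 0 = 0" "\<beta> 0 = 0" "\<mu> 0 0 = 0" for e3 e4 \<alpha> \<beta> \<mu>
      by (rule rhsI[of e3 e4 \<alpha> ?z2 ?z3 \<beta> ?z2 ?z1 ?z1 \<mu> ?z1])
        (use that in \<open>simp_all only: sw.tiling_q_VV_p_def sw_lin simp_thms\<close>)

    have q_V_p_V: ?rhs
      if "tiling_q_V_p_V e3 e4 \<alpha> \<beta> \<mu> S0 C" "basis e3 e4" "\<alpha> 0 0 = 0" "\<beta> 0 = 0" "\<mu> 0 = 0" for e3 e4 \<alpha> \<beta> \<mu>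
      by (rule rhsI[of e3 e4 \<beta> \<alpha> ?z3 ?z1 ?z2 ?z1 \<mu> ?z2 ?z1])
        (use that in \<open>simp_all only: tiling_q_V_p_V_def simp_thms\<close>)

    have sw_q_V_p_V: ?rhs
      if "sw.tiling_q_V_p_V e3 e4 \<alpha> \<beta> \<mu> S0 C" "basis e3 e4" "\<alpha> 0 0 = 0" "\<beta> 0 = 0" "\<mu> 0 = 0" for e3 e4 \<alpha> \<beta> \<mu>
      by (rule rhsI[of e3 e4 \<beta> \<alpha> ?z3 ?z1 ?z2 ?z1 \<mu> ?z2 ?z1])
        (use that in \<open>simp_all only: sw.tiling_q_V_p_V_def sw_lin simp_thms\<close>)

    have pq_VV: ?rhs
      if "tiling_pq_VV e3 e4 \<alpha> \<beta> S0 C" "basis e3 e4" "\<alpha> 0 0 = 0" "\<beta> 0 0 = 0" for e3 e4 \<alpha> \<beta>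
      by (rule rhsI[of e3 e4 ?z1 \<alpha> ?z3 ?z1 \<beta> ?z1 ?z1 ?z2 ?z1])
        (use that in \<open>simp_all only: tiling_pq_VV_def simp_thms\<close>)

    have p_qV_V: ?rhs
      if "tiling_p_qV_V e3 e4 \<alpha> \<beta> \<mu> S0 C" "basis e3 e4" "\<alpha> 0 = 0" "\<beta> 0 = 0" "\<mu> 0 0 = 0" for e3 e4 \<alpha> \<beta> \<mu>
      by (rule rhsI[of e3 e4 \<alpha> ?z2 ?z3 \<beta> ?z2 ?z1 ?z1 \<mu> ?z1])
        (use that in \<open>simp_all only: tiling_p_qV_V_def simp_thms\<close>)

    have V_q_p_V: ?rhs
      if "tiling_V_q_p_V e3 e4 \<alpha> \<beta> \<mu> S0 C" "basis e3 e4" "\<alpha> 0 = 0" "\<beta> 0 0 = 0" "\<mu> 0 = 0" for e3 e4 \<alpha> \<beta> \<mu>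
      by (rule rhsI[of e3 e4 \<alpha> \<beta> ?z3 ?z1 ?z2 ?z1 \<mu> ?z2 ?z1])
        (use that in \<open>simp_all only: tiling_V_q_p_V_def simp_thms\<close>)

    have p_q_V_V: ?rhs
      if "tiling_p_q_V_V e3 e4 \<alpha> \<beta> \<mu> S0 C" "basis e3 e4" "\<alpha> 0 = 0" "\<beta> 0 0 = 0" "\<mu> 0 = 0" for e3 e4 \<alpha> \<beta> \<mu>
      by (rule rhsI[of e3 e4 \<alpha> \<beta> ?z3 ?z1 ?z2 ?z1 \<mu> ?z2 ?z1])
        (use that in \<open>simp_all only: tiling_p_q_V_V_def simp_thms\<close>)

    have pV_qV: ?rhs
      if "tiling_pV_qV e3 e4 \<alpha> S0 C" "basis e3 e4" "\<alpha> 0 0 = 0" for e3 e4 \<alpha>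
      by (rule rhsI[of e3 e4 ?z1 \<alpha> ?z3 ?z1 ?z2 ?z1 ?z1 ?z2 ?z1])
        (use that in \<open>simp_all only: tiling_pV_qV_def simp_thms\<close>)

    have sw_p_qV_V: ?rhs
      if "sw.tiling_p_qV_V e3 e4 \<alpha> \<beta> \<mu> S0 C" "basis e3 e4" "\<alpha> 0 = 0" "\<beta> 0 = 0" "\<mu> 0 0 = 0" for e3 e4 \<alpha> \<beta> \<mu>
      by (rule rhsI[of e3 e4 \<alpha> ?z2 ?z3 \<beta> ?z2 ?z1 ?z1 \<mu> ?z1])
        (use that in \<open>simp_all only: sw.tiling_p_qV_V_def sw_lin simp_thms\<close>)

    have sw_V_q_p_V: ?rhs
      if "sw.tiling_V_q_p_V e3 e4 \<alpha> \<beta> \<mu> S0 C" "basis e3 e4" "\<alpha> 0 = 0" "\<beta> 0 0 = 0" "\<mu> 0 = 0" for e3 e4 \<alpha> \<beta> \<mu>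
      by (rule rhsI[of e3 e4 \<alpha> \<beta> ?z3 ?z1 ?z2 ?z1 \<mu> ?z2 ?z1])
        (use that in \<open>simp_all only: sw.tiling_V_q_p_V_def sw_lin simp_thms\<close>)

    have sw_p_q_V_V: ?rhs
      if "sw.tiling_p_q_V_V e3 e4 \<alpha> \<beta> \<mu> S0 C" "basis e3 e4" "\<alpha> 0 = 0" "\<beta> 0 0 = 0" "\<mu> 0 = 0" for e3 e4 \<alpha> \<beta> \<mu>
      by (rule rhsI[of e3 e4 \<alpha> \<beta> ?z3 ?z1 ?z2 ?z1 \<mu> ?z2 ?z1])
        (use that in \<open>simp_all only: sw.tiling_p_q_V_V_def sw_lin simp_thms\<close>)

    have sw_pV_qV: ?rhs
      if "sw.tiling_pV_qV e3 e4 \<alpha> S0 C" "basis e3 e4" "\<alpha> 0 0 = 0" for e3 e4 \<alpha>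
      by (rule rhsI[of e3 e4 ?z1 \<alpha> ?z3 ?z1 ?z2 ?z1 ?z1 ?z2 ?z1])
        (use that in \<open>simp_all only: sw.tiling_pV_qV_def sw_lin simp_thms\<close>)

    have V_pq_V: ?rhs
      if "tiling_V_pq_V e3 e4 \<alpha> \<beta> \<mu> S0 C" "basis e3 e4" "\<alpha> 0 = 0" "\<beta> 0 = 0" "\<mu> 0 0 = 0" for e3 e4 \<alpha> \<beta> \<mu>
      by (rule rhsI[of e3 e4 \<alpha> ?z2 ?z3 \<beta> ?z2 ?z1 ?z1 \<mu> ?z1])
        (use that in \<open>simp_all only: tiling_V_pq_V_def simp_thms\<close>)

    have V_q_V_p: ?rhs
      if "tiling_V_q_V_p e3 e4 \<alpha> \<beta> \<mu> S0 C" "basis e3 e4" "\<alpha> 0 = 0" "\<beta> 0 0 = 0" "\<mu> 0 = 0" for e3 e4 \<alpha> \<beta> \<mu>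
      by (rule rhsI[of e3 e4 \<alpha> \<beta> ?z3 ?z1 ?z2 ?z1 \<mu> ?z2 ?z1])
        (use that in \<open>simp_all only: tiling_V_q_V_p_def simp_thms\<close>)

    have sw_V_q_V_p: ?rhs
      if "sw.tiling_V_q_V_p e3 e4 \<alpha> \<beta> \<mu> S0 C" "basis e3 e4" "\<alpha> 0 = 0" "\<beta> 0 0 = 0" "\<mu> 0 = 0" for e3 e4 \<alpha> \<beta> \<mu>
      by (rule rhsI[of e3 e4 \<alpha> \<beta> ?z3 ?z1 ?z2 ?z1 \<mu> ?z2 ?z1])
        (use that in \<open>simp_all only: sw.tiling_V_q_V_p_def sw_lin simp_thms\<close>)

    have VV_pq: ?rhs
      if "tiling_VV_pq e3 e4 \<alpha> S0 C" "basis e3 e4" "\<alpha> 0 0 = 0" for e3 e4 \<alpha>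
      by (rule rhsI[of e3 e4 ?z1 \<alpha> ?z3 ?z1 ?z2 ?z1 ?z1 ?z2 ?z1])
        (use that in \<open>simp_all only: tiling_VV_pq_def simp_thms\<close>)

    have qV_V_p: ?rhs
      if "tiling_qV_V_p e3 e4 \<alpha> \<mu> S0 C" "basis e3 e4" "\<alpha> 0 0 = 0" "\<mu> 0 = 0" for e3 e4 \<alpha> \<mu>
      by (rule rhsI[of e3 e4 ?z1 \<alpha> ?z3 ?z1 ?z2 ?z1 \<mu> ?z2 ?z1])
        (use that in \<open>simp_all only: tiling_qV_V_p_def simp_thms\<close>)

    have sw_qV_V_p: ?rhs
      if "sw.tiling_qV_V_p e3 e4 \<alpha> \<mu> S0 C" "basis e3 e4" "\<alpha> 0 0 = 0" "\<mu> 0 = 0" for e3 e4 \<alpha> \<mu>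
      by (rule rhsI[of e3 e4 ?z1 \<alpha> ?z3 ?z1 ?z2 ?z1 \<mu> ?z2 ?z1])
        (use that in \<open>simp_all only: sw.tiling_qV_V_p_def sw_lin simp_thms\<close>)

    have pqV_V: ?rhs
      if "tiling_pqV_V e3 e4 \<alpha> S0 C" "basis e3 e4" "\<alpha> 0 0 0 = 0" for e3 e4 \<alpha>
      by (rule rhsI[of e3 e4 ?z1 ?z2 \<alpha> ?z1 ?z2 ?z1 ?z1 ?z2 ?z1])
        (use that in \<open>simp_all only: tiling_pqV_V_def simp_thms\<close>)

    have pV_q_V: ?rhs
      if "tiling_pV_q_V e3 e4 \<alpha> \<mu> S0 C" "basis e3 e4" "\<alpha> 0 0 = 0" "\<mu> 0 = 0" for e3 e4 \<alpha> \<mu>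
      by (rule rhsI[of e3 e4 ?z1 \<alpha> ?z3 ?z1 ?z2 ?z1 \<mu> ?z2 ?z1])
        (use that in \<open>simp_all only: tiling_pV_q_V_def simp_thms\<close>)

    have VV_q_p: ?rhs
      if "tiling_VV_q_p e3 e4 \<alpha> \<mu> S0 C" "basis e3 e4" "\<alpha> 0 0 = 0" "\<mu> 0 = 0" for e3 e4 \<alpha> \<mu>
      by (rule rhsI[of e3 e4 ?z1 \<alpha> ?z3 ?z1 ?z2 ?z1 \<mu> ?z2 ?z1])
        (use that in \<open>simp_all only: tiling_VV_q_p_def simp_thms\<close>)

    have p_q_VV: ?rhs
      if "tiling_p_q_VV e3 e4 \<alpha> \<mu> \<nu> S0 C" "basis e3 e4" "\<alpha> 0 = 0" "\<mu> 0 = 0" "\<nu> 0 = 0" for e3 e4 \<alpha> \<mu> \<nu>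
      by (rule rhsI[of e3 e4 \<alpha> ?z2 ?z3 ?z1 ?z2 ?z1 \<mu> ?z2 \<nu>])
        (use that in \<open>simp_all only: tiling_p_q_VV_def simp_thms\<close>)

    have V_q_pV: ?rhs
      if "tiling_V_q_pV e3 e4 \<alpha> \<mu> S0 C" "basis e3 e4" "\<alpha> 0 = 0" "\<mu> 0 = 0" for e3 e4 \<alpha> \<mu>
      by (rule rhsI[of e3 e4 \<alpha> ?z2 ?z3 ?z1 ?z2 ?z1 \<mu> ?z2 ?z1])
        (use that in \<open>simp_all only: tiling_V_q_pV_def simp_thms\<close>)

    have pVV_q: ?rhs
      if "tiling_pVV_q e3 e4 \<alpha> S0 C" "basis e3 e4" "\<alpha> 0 0 0 = 0" for e3 e4 \<alpha>
      by (rule rhsI[of e3 e4 ?z1 ?z2 \<alpha> ?z1 ?z2 ?z1 ?z1 ?z2 ?z1])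
        (use that in \<open>simp_all only: tiling_pVV_q_def simp_thms\<close>)

    have sw_pV_q_V: ?rhs
      if "sw.tiling_pV_q_V e3 e4 \<alpha> \<mu> S0 C" "basis e3 e4" "\<alpha> 0 0 = 0" "\<mu> 0 = 0" for e3 e4 \<alpha> \<mu>
      by (rule rhsI[of e3 e4 ?z1 \<alpha> ?z3 ?z1 ?z2 ?z1 \<mu> ?z2 ?z1])
        (use that in \<open>simp_all only: sw.tiling_pV_q_V_def sw_lin simp_thms\<close>)

    have sw_VV_q_p: ?rhs
      if "sw.tiling_VV_q_p e3 e4 \<alpha> \<mu> S0 C" "basis e3 e4" "\<alpha> 0 0 = 0" "\<mu> 0 = 0" for e3 e4 \<alpha> \<mu>
      by (rule rhsI[of e3 e4 ?z1 \<alpha> ?z3 ?z1 ?z2 ?z1 \<mu> ?z2 ?z1])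
        (use that in \<open>simp_all only: sw.tiling_VV_q_p_def sw_lin simp_thms\<close>)

    have sw_p_q_VV: ?rhs
      if "sw.tiling_p_q_VV e3 e4 \<alpha> \<mu> \<nu> S0 C" "basis e3 e4" "\<alpha> 0 = 0" "\<mu> 0 = 0" "\<nu> 0 = 0" for e3 e4 \<alpha> \<mu> \<nu>
      by (rule rhsI[of e3 e4 \<alpha> ?z2 ?z3 ?z1 ?z2 ?z1 \<mu> ?z2 \<nu>])
        (use that in \<open>simp_all only: sw.tiling_p_q_VV_def sw_lin simp_thms\<close>)

    have sw_V_q_pV: ?rhs
      if "sw.tiling_V_q_pV e3 e4 \<alpha> \<mu> S0 C" "basis e3 e4" "\<alpha> 0 = 0" "\<mu> 0 = 0" for e3 e4 \<alpha> \<mu>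
      by (rule rhsI[of e3 e4 \<alpha> ?z2 ?z3 ?z1 ?z2 ?z1 \<mu> ?z2 ?z1])
        (use that in \<open>simp_all only: sw.tiling_V_q_pV_def sw_lin simp_thms\<close>)

    have sw_pVV_q: ?rhs
      if "sw.tiling_pVV_q e3 e4 \<alpha> S0 C" "basis e3 e4" "\<alpha> 0 0 0 = 0" for e3 e4 \<alpha>
      by (rule rhsI[of e3 e4 ?z1 ?z2 \<alpha> ?z1 ?z2 ?z1 ?z1 ?z2 ?z1])
        (use that in \<open>simp_all only: sw.tiling_pVV_q_def sw_lin simp_thms\<close>)

    consider "card S0 = p" | "card S0 = q" | "card C = p" | "card C = q" | "card S0 = 4" | "card C = 4" | "card C = 2"
      | "card S0 = 2 * p" | "card S0 = 2 * q"
      using cards by blast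
    then show ?rhs
    proof cases
      case 1
      from sw.tilings_card_S_q[OF F 1 one sw_spans[OF spans]] show ?thesis
          by (elim exE conjE) (rule sw_q_pVV, assumption+)
    next
      case 2
      from tilings_card_S_q[OF F 2 one spans] show ?thesis
          by (elim exE conjE) (rule q_pVV, assumption+)
    next
      case 3
      from sw.tilings_card_C_q[OF F 3 one sw_spans[OF spans]] show ?thesis
        by (elim disjE exE conjE)
          (rule sw_pVV_q, assumption+,
           rule sw_pV_q_V, assumption+,
           rule sw_p_q_VV, assumption+,
           rule sw_VV_q_p, assumption+,
           rule sw_V_q_pV, assumption+)
    next
      case 4
      from tilings_card_C_q[OF F 4 one spans] show ?thesis
        by (elim disjE exE conjE)
          (rule pVV_q, assumption+,
           rule pV_q_V, assumption+,
           rule p_q_VV, assumption+,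
           rule VV_q_p, assumption+,
           rule V_q_pV, assumption+)
    next
      case 5
      from tilings_card_S_4[OF F 5 one spans] show ?thesis
        by (elim disjE exE conjE)
          (rule V_pq_V, assumption+,
           rule V_q_V_p, assumption+,
           rule sw_V_q_V_p, assumption+,
           rule VV_pq, assumption+)
    next
      case 6
      consider "\<exists>c\<in>C. P c \<noteq> 0" | "\<exists>c\<in>C. Q c \<noteq> 0" | "\<forall>c\<in>C. P c = 0" "\<forall>c\<in>C. Q c = 0" by blast
      then show ?thesis
      proof cases
        case 1
        from tilings_card_C_4[OF F 6 one spans 1] show ?thesis by (elim disjE exE conjE)
          (rule q_VV_p, assumption+,
           rule q_V_p_V, assumption+)
      next
        case 2
        from sw.tilings_card_C_4[OF F 6 one sw_spans[OF spans] 2] show ?thesis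
          by (elim disjE exE conjE)
          (rule sw_q_VV_p, assumption+,
           rule sw_q_V_p_V, assumption+)
      next
        case 3
        from tilings_card_C_4_klein[OF F 6 one 3] show ?thesis
          by (elim exE conjE) (rule pq_VV, assumption+)
      qed
    next
      case 7
      consider "\<exists>c\<in>C. P c \<noteq> 0" | "\<exists>c\<in>C. Q c \<noteq> 0" | "\<forall>c\<in>C. P c = 0" "\<forall>c\<in>C. Q c = 0" by blast
      then show ?thesis
      proof cases
        case 1
        from tilings_card_C_2[OF F 7 one spans 1] show ?thesis
          by (elim exE conjE) (rule qV_V_p, assumption+)
      next
        case 2
        from sw.tilings_card_C_2[OF F 7 one sw_spans[OF spans] 2] show ?thesis
          by (elim exE conjE) (rule sw_qV_V_p, assumption+)
      next
        case 3
        from tilings_card_C_2_klein[OF F 7 one 3] show ?thesis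
          by (elim exE conjE) (rule pqV_V, assumption+)
      qed
    next
      case 8
      from tilings_card_S_2p[OF F 8 one spans] show ?thesis
        by (elim disjE exE conjE)
          (rule p_qV_V, assumption+,
           rule V_q_p_V, assumption+,
           rule p_q_V_V, assumption+,
           rule pV_qV, assumption+)
    next
      case 9
      from sw.tilings_card_S_2p[OF F 9 one sw_spans[OF spans]] show ?thesis
        by (elim disjE exE conjE)
          (rule sw_p_qV_V, assumption+,
           rule sw_V_q_p_V, assumption+,
           rule sw_p_q_V_V, assumption+,
           rule sw_pV_qV, assumption+)
    qed
  qed
qed

end
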